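(* Suppose $Q\succeq0$, $R\succ0$, $W\succeq0$, $V\succ0$, $(A,W^{1/2})$ and $(A,B)$ are controllable, and $(Q^{1/2},A)$ and $(C,A)$ are observable. Let $J_{\infty,n}(\mathsf{K})=\|\mathbf{T}_{zd}(\mathsf{K},s)\|_{\mathcal{H}_\infty}$ for $\mathsf{K}\in\mathcal{C}_{n}$. Then the canonical projection of $\mathcal{L}_{\infty,\mathrm{d}}$ onto $(\mathsf{K},\gamma)$ satisfies $$\operatorname{epi}_>(J_{\infty,n})\subseteq\pi_{\mathsf{K},\gamma}(\mathcal{L}_{\infty,\mathrm d})\subseteq\operatorname{cl}\operatorname{epi}_\ge(J_{\infty,n}).$$ Furthermore, the mapping $\Phi_{\infty,\mathrm d}$ is a $C^2$ (and in fact $C^\infty$) diffeomorphism from $\mathcal{L}_{\infty,\mathrm d}$ to $\mathcal{F}_{\infty,\mathrm d}\times\mathrm{GL}_n$, and its inverse $\Phi_{\infty,\mathrm d}^{-1}$ is given by $\Psi_{\infty,\mathrm d}$.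
   Context: Data: $A\in\mathbb{R}^{n\times n}$, $B\in\mathbb{R}^{n\times m}$, $C\in\mathbb{R}^{p\times n}$, symmetric $Q,W\in\mathbb{S}^n$, $R\in\mathbb{S}^m$, $V\in\mathbb{S}^p$. $\mathrm{GL}_n$ is the set of invertible real $n\times n$ matrices; $\mathbb{S}^k_{++}$ the positive definite matrices. $B_1=[W^{1/2}\ \ 0_{n\times p}]$, $B_2=B$, $C_1=\begin{bmatrix}Q^{1/2}\\ 0_{m\times n}\end{bmatrix}$, $C_2=C$, $D_{12}=\begin{bmatrix}0_{n\times m}\\ R^{1/2}\end{bmatrix}$, $D_{21}=[0_{p\times n}\ \ V^{1/2}]$. Policies are $\mathsf{K}=\begin{bmatrix}D_{\mathsf K}&C_{\mathsf K}\\ B_{\mathsf K}&A_{\mathsf K}\end{bmatrix}\in\mathbb{R}^{(m+n)\times(p+n)}$ with $D_{\mathsf K}\in\mathbb{R}^{m\times p}$, and $A_{\mathrm{cl}}(\mathsf K)=\begin{bmatrix}A+BD_{\mathsf K}C&BC_{\mathsf K}\\ B_{\mathsf K}C&A_{\mathsf K}\end{bmatrix}$, $B_{\mathrm{cl}}(\mathsf K)=\begin{bmatrix}W^{1/2}&BD_{\mathsf K}V^{1/2}\\ 0&B_{\mathsf K}V^{1/2}\end{bmatrix}$, $C_{\mathrm{cl}}(\mathsf K)=\begin{bmatrix}Q^{1/2}&0\\ R^{1/2}D_{\mathsf K}C&R^{1/2}C_{\mathsf K}\end{bmatrix}$, $D_{\mathrm{cl}}(\mathsf K)=\begin{bmatrix}0&0\\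 0&R^{1/2}D_{\mathsf K}V^{1/2}\end{bmatrix}$. $\mathcal{C}_{n}=\{\mathsf K: A_{\mathrm{cl}}(\mathsf K)\text{ is Hurwitz stable}\}$. $\mathbf{T}_{zd}(\mathsf K,s)=C_{\mathrm{cl}}(\mathsf K)(sI-A_{\mathrm{cl}}(\mathsf K))^{-1}B_{\mathrm{cl}}(\mathsf K)+D_{\mathrm{cl}}(\mathsf K)$; $\|\mathbf{T}\|_{\mathcal{H}_\infty}=\sup_{\omega\in\mathbb{R}}\sigma_{\max}(\mathbf{T}(j\omega))$. $\operatorname{epi}_>(J)=\{(\mathsf K,\gamma):\mathsf K\in\mathcal{C}_{n},\gamma>J(\mathsf K)\}$, $\operatorname{epi}_\ge(J)$ likewise with $\ge$; $\operatorname{cl}$ is closure. For a $2n\times2n$ matrix $P$ (or $P^{-1}$), $P_{ij}$ (or $(P^{-1})_{ij}$) denote its $n\times n$ blocks. Lifted set: $\mathcal{L}_{\infty,\mathrm d}$ is the set of $(\mathsf K,\gamma,P)$ with $\mathsf K\in\mathbb{R}^{(m+n)\times(p+n)}$, $\gamma\in\mathbb{R}$, $P\in\mathbb{S}^{2n}_{++}$, $P_{12}\in\mathrm{GL}_n$, $$\begin{bmatrix}A_{\mathrm{cl}}(\mathsf K)^{\mathsf T}P+PA_{\mathrm{cl}}(\mathsf K)&PB_{\mathrm{cl}}(\mathsf K)&C_{\mathrm{cl}}(\mathsf K)^{\mathsf T}\\ B_{\mathrm{cl}}(\mathsf K)^{\mathsf T}P&-\gamma I&D_{\mathrm{cl}}(\mathsf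 K)^{\mathsf T}\\ C_{\mathrm{cl}}(\mathsf K)&D_{\mathrm{cl}}(\mathsf K)&-\gamma I\end{bmatrix}\preceq0.$$ $\pi_{\mathsf K,\gamma}$ is the projection onto the first two components. Convex set: $\mathcal{F}_{\infty,\mathrm d}$ is the set of $(\gamma,\Lambda,X,Y)$ with $\gamma\in\mathbb{R}$, $\Lambda=\begin{bmatrix}G&F\\ H&M\end{bmatrix}\in\mathbb{R}^{(m+n)\times(p+n)}$ ($G\in\mathbb{R}^{m\times p}$), $\begin{bmatrix}X&I\\ I&Y\end{bmatrix}\in\mathbb{S}^{2n}_{++}$ ($X,Y\in\mathbb{S}^n$), and $\mathscr{M}(\gamma,\Lambda,X,Y)\preceq0$, where ($*$ denotes symmetric completion) $$\mathscr{M}=\begin{bmatrix}AX+B_2F+(AX+B_2F)^{\mathsf T}&M^{\mathsf T}+A+B_2GC_2&B_1+B_2GD_{21}&(C_1X+D_{12}F)^{\mathsf T}\\ *&YA+HC_2+(YA+HC_2)^{\mathsf T}&YB_1+HD_{21}&(C_1+D_{12}GC_2)^{\mathsf T}\\ *&*&-\gamma I&(D_{12}GD_{21})^{\mathsf T}\\ *&*&*&-\gamma I\end{bmatrix}.$$ Mappings: for $(\mathsf K,\gamma,P)\in\mathcal{L}_{\infty,\mathrm d}$, $$\Phi_{\infty,\mathrm d}(\mathsf K,\gamma,P)=\left(\gamma,\begin{bmatrix}D_{\mathsf K}&\Phi_F\\ \Phi_H&\Phi_M\end{bmatrix},(P^{-1})_{11},P_{11},\ P_{12}\right)$$ with $\Phi_M=P_{12}B_{\mathsf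 K}C_2(P^{-1})_{11}+P_{11}B_2C_{\mathsf K}(P^{-1})_{21}+P_{11}(A+B_2D_{\mathsf K}C_2)(P^{-1})_{11}+P_{12}A_{\mathsf K}(P^{-1})_{21}$, $\Phi_H=P_{11}B_2D_{\mathsf K}+P_{12}B_{\mathsf K}$, $\Phi_F=D_{\mathsf K}C_2(P^{-1})_{11}+C_{\mathsf K}(P^{-1})_{21}$ (the last component $P_{12}$ lies in $\mathrm{GL}_n$, the others form the point of $\mathcal{F}_{\infty,\mathrm d}$). For $\mathsf Z=\left(\gamma,\begin{bmatrix}G&F\\ H&M\end{bmatrix},X,Y\right)\in\mathcal{F}_{\infty,\mathrm d}$, $\Xi\in\mathrm{GL}_n$, $\Psi_{\infty,\mathrm d}(\mathsf Z,\Xi)=(\Psi_{\mathsf K},\gamma,\Psi_P)$ with $$\Psi_{\mathsf K}=\begin{bmatrix}I&0\\ YB&\Xi\end{bmatrix}^{-1}\begin{bmatrix}G&F\\ H&M-YAX\end{bmatrix}\begin{bmatrix}I&CX\\ 0&-\Xi^{-1}(Y-X^{-1})X\end{bmatrix}^{-1},\quad\Psi_P=\begin{bmatrix}Y&\Xi\\ \Xi^{\mathsf T}&\Xi^{\mathsf T}(Y-X^{-1})^{-1}\Xi\end{bmatrix}.$$ A $C^2$ (resp. $C^\infty$) diffeomorphism between two subsets of Euclidean spaces means a bijection that extends to a $C^2$ (resp. $C^\infty$) function on an open set containing the first subset, the extension being a bijection onto its image with $C^2$ (resp. $C^\infty$) inverse. *)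

theory Defs
  imports "HOL-Analysis.Analysis"
begin

section \<open>Block matrices\<close>

text \<open>
  A matrix with \<open>r\<close> rows and \<open>c\<close> columns has type \<^typ>\<open>real^'c^'r\<close>; block rows and block columns
  are indexed by sum types. The operator \<open><|>\<close> puts matrices side by side, \<open></>\<close> stacks them, and
  \<open><|>\<close> binds more tightly. Both bind less tightly than the arithmetic operations.
\<close>

definition hcat :: "'x^'c^'r \<Rightarrow> 'x^'d^'r \<Rightarrow> 'x^('c + 'd)^'r"  (infixr "<|>" 62)
  where "hcat M N = (\<chi> i j. case j of Inl c \<Rightarrow> M $ i $ c | Inr d \<Rightarrow> N $ i $ d)"

definition vcat :: "'x^'c^'r \<Rightarrow> 'x^'c^'s \<Rightarrow> 'x^'c^('r + 's)"  (infixr "<'/>" 61)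
  where "vcat M N = (\<chi> i. case i of Inl r \<Rightarrow> M $ r | Inr s \<Rightarrow> N $ s)"

definition blk11 :: "'x^('c::finite + 'd::finite)^('r::finite + 's::finite) \<Rightarrow> 'x^'c^'r"
  where "blk11 M = (\<chi> i j. M $ Inl i $ Inl j)"

definition blk12 :: "'x^('c::finite + 'd::finite)^('r::finite + 's::finite) \<Rightarrow> 'x^'d^'r"
  where "blk12 M = (\<chi> i j. M $ Inl i $ Inr j)"

definition blk21 :: "'x^('c::finite + 'd::finite)^('r::finite + 's::finite) \<Rightarrow> 'x^'c^'s"
  where "blk21 M = (\<chi> i j. M $ Inr i $ Inl j)"

definition blk22 :: "'x^('c::finite + 'd::finite)^('r::finite + 's::finite) \<Rightarrow> 'x^'d^'s"
  where "blk22 M = (\<chi> i j. M $ Inr i $ Inr j)"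


section \<open>Symmetric matrices\<close>

definition sym_mats :: "(real^'n^'n) set"
  where "sym_mats = {M. transpose M = M}"

definition pos_semidef :: "real^'n^'n \<Rightarrow> bool"
  where "pos_semidef M \<longleftrightarrow> M \<in> sym_mats \<and> (\<forall>x. 0 \<le> x \<bullet> (M *v x))"

definition pos_def :: "real^'n^'n \<Rightarrow> bool"
  where "pos_def M \<longleftrightarrow> M \<in> sym_mats \<and> (\<forall>x. x \<noteq> 0 \<longrightarrow> 0 < x \<bullet> (M *v x))"

definition neg_semidef :: "real^'n^'n \<Rightarrow> bool"
  where "neg_semidef M \<longleftrightarrow> pos_semidef (- M)"

text \<open>The positive semidefinite square root, meaningful for positive semidefinite arguments.\<close>

definition msqrt :: "real^'n^'n \<Rightarrow> real^'n^'n"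
  where "msqrt M = (THE S. pos_semidef S \<and> S ** S = M)"

definition GL :: "(real^'n^'n) set"
  where "GL = {M. invertible M}"


text \<open>
  For \<open>K :: ('m, 'n, 'p) policy\<close> the blocks \<open>blk11\<close>, \<open>blk12\<close>, \<open>blk21\<close>, \<open>blk22\<close> are
  \<open>D\<^sub>K\<close>, \<open>C\<^sub>K\<close>, \<open>B\<^sub>K\<close>, \<open>A\<^sub>K\<close>. The other tuples are \<open>(K, \<gamma>, P)\<close> and \<open>(\<gamma>, \<Lambda>, X, Y)\<close>.
\<close>

type_synonym ('m, 'n, 'p) policy = "real^('p + 'n)^('m + 'n)"

type_synonym ('m, 'n, 'p) lifted_point =
  "('m, 'n, 'p) policy \<times> real \<times> (real^('n + 'n)^('n + 'n))"

type_synonym ('m, 'n, 'p) convex_point =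
  "real \<times> ('m, 'n, 'p) policy \<times> (real^'n^'n) \<times> (real^'n^'n)"


section \<open>Controllability, observability, stability\<close>

definition piecewise_continuous :: "real \<Rightarrow> (real \<Rightarrow> 'a::topological_space) \<Rightarrow> bool"
  where "piecewise_continuous T u \<longleftrightarrow>
    (\<exists>S. finite S \<and> continuous_on ({0..T} - S) u) \<and>
    (\<forall>t\<in>{0..T}. (\<exists>l. (u \<longlongrightarrow> l) (at t within {0..<t})) \<and>
                 (\<exists>l. (u \<longlongrightarrow> l) (at t within {t<..T})))"

text \<open>
  The differential equation is required off a finite set, since the input may jump; together with
  continuity of \<open>x\<close> this is the integrated form of the equation.
\<close>

definition lin_trajectory ::
    "real^'n^'n \<Rightarrow> real^'m^'n \<Rightarrow> real \<Rightarrow> (real \<Rightarrow> real^'m) \<Rightarrow> (real \<Rightarrow> real^'n) \<Rightarrow> bool"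
  where "lin_trajectory A B T u x \<longleftrightarrow> continuous_on {0..T} x \<and>
    (\<exists>S. finite S \<and> (\<forall>t\<in>{0..T} - S.
       (x has_vector_derivative (A *v x t + B *v u t)) (at t within {0..T})))"

definition controllable :: "real^'n^'n \<Rightarrow> real^'m^'n \<Rightarrow> bool"
  where "controllable A B \<longleftrightarrow> (\<forall>T>0. \<forall>x0 x1. \<exists>u x. piecewise_continuous T u \<and>
    lin_trajectory A B T u x \<and> x 0 = x0 \<and> x T = x1)"

text \<open>The initial state of the unforced system is determined by the output on any interval.\<close>

definition observable :: "real^'n^'p \<Rightarrow> real^'n^'n \<Rightarrow> bool"
  where "observable C A \<longleftrightarrow> (\<forall>T>0. \<forall>x x'.
    (\<forall>t\<in>{0..T}. (x has_vector_derivative (A *v x t)) (at t within {0..T})) \<and>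
    (\<forall>t\<in>{0..T}. (x' has_vector_derivative (A *v x' t)) (at t within {0..T})) \<and>
    (\<forall>t\<in>{0..T}. C *v x t = C *v x' t) \<longrightarrow> x 0 = x' 0)"

abbreviation cmat :: "real^'c^'r \<Rightarrow> complex^'c^'r"
  where "cmat \<equiv> map_matrix complex_of_real"

definition hurwitz :: "real^'n^'n \<Rightarrow> bool"
  where "hurwitz A \<longleftrightarrow> (\<forall>z v. v \<noteq> 0 \<and> cmat A *v v = z *s v \<longrightarrow> Re z < 0)"


section \<open>The H-infinity cost\<close>

definition ctranspose :: "complex^'c^'r \<Rightarrow> complex^'r^'c"
  where "ctranspose M = (\<chi> i j. cnj (M $ j $ i))"

text \<open>
  Here a singular value is a square root of an eigenvalue of \<open>M\<^sup>* M\<close>. For a wide matrix this adds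
  at most the value zero to other conventions, which does not affect the largest one.
\<close>

definition singular_value :: "complex^'c^'r \<Rightarrow> real \<Rightarrow> bool"
  where "singular_value M s \<longleftrightarrow>
    0 \<le> s \<and> (\<exists>v. v \<noteq> 0 \<and> (ctranspose M ** M) *v v = complex_of_real (s\<^sup>2) *s v)"

definition sigma_max :: "complex^'c^'r \<Rightarrow> real"
  where "sigma_max M = (GREATEST s. singular_value M s)"

definition A_cl :: "real^'n^'n \<Rightarrow> real^'m^'n \<Rightarrow> real^'n^'p \<Rightarrow> ('m, 'n, 'p) policy
    \<Rightarrow> real^('n + 'n)^('n + 'n)"
  where "A_cl A B C K =
    (A + B ** blk11 K ** C <|> B ** blk12 K </>
     blk21 K ** C          <|> blk22 K)"

definition B_cl :: "real^'m^'n \<Rightarrow> real^'n^'n \<Rightarrow> real^'p^'p \<Rightarrow> ('m, 'n, 'p) policy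
    \<Rightarrow> real^('n + 'p)^('n + 'n)"
  where "B_cl B W V K =
    (msqrt W <|> B ** blk11 K ** msqrt V </>
     0       <|> blk21 K ** msqrt V)"

definition C_cl :: "real^'n^'p \<Rightarrow> real^'n^'n \<Rightarrow> real^'m^'m \<Rightarrow> ('m, 'n, 'p) policy
    \<Rightarrow> real^('n + 'n)^('n + 'm)"
  where "C_cl C Q R K =
    (msqrt Q                 <|> 0 </>
     msqrt R ** blk11 K ** C <|> msqrt R ** blk12 K)"

definition D_cl :: "real^'m^'m \<Rightarrow> real^'p^'p \<Rightarrow> ('m, 'n::finite, 'p) policy
    \<Rightarrow> real^('n + 'p)^('n + 'm)"
  where "D_cl R V K =
    (0 <|> 0 </>
     0 <|> msqrt R ** blk11 K ** msqrt V)"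

definition stabilizing :: "real^'n^'n \<Rightarrow> real^'m^'n \<Rightarrow> real^'n^'p \<Rightarrow> ('m, 'n, 'p) policy set"
  where "stabilizing A B C = {K. hurwitz (A_cl A B C K)}"

definition T_zd :: "real^'n^'n \<Rightarrow> real^'m^'n \<Rightarrow> real^'n^'p
    \<Rightarrow> real^'n^'n \<Rightarrow> real^'m^'m \<Rightarrow> real^'n^'n \<Rightarrow> real^'p^'p
    \<Rightarrow> ('m, 'n, 'p) policy \<Rightarrow> complex \<Rightarrow> complex^('n + 'p)^('n + 'm)"
  where "T_zd A B C Q R W V K s =
    cmat (C_cl C Q R K) ** matrix_inv (mat s - cmat (A_cl A B C K)) ** cmat (B_cl B W V K)
      + cmat (D_cl R V K)"

definition Hinf_norm :: "(complex \<Rightarrow> complex^'c^'r) \<Rightarrow> ereal"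
  where "Hinf_norm G = (SUP \<omega>::real. ereal (sigma_max (G (\<i> * complex_of_real \<omega>))))"

definition J_inf :: "real^'n^'n \<Rightarrow> real^'m^'n \<Rightarrow> real^'n^'p
    \<Rightarrow> real^'n^'n \<Rightarrow> real^'m^'m \<Rightarrow> real^'n^'n \<Rightarrow> real^'p^'p
    \<Rightarrow> ('m, 'n, 'p) policy \<Rightarrow> ereal"
  where "J_inf A B C Q R W V K = Hinf_norm (T_zd A B C Q R W V K)"

definition epi_gt :: "'k set \<Rightarrow> ('k \<Rightarrow> ereal) \<Rightarrow> ('k \<times> real) set"
  where "epi_gt D J = {(K, \<gamma>). K \<in> D \<and> ereal \<gamma> > J K}"

definition epi_ge :: "'k set \<Rightarrow> ('k \<Rightarrow> ereal) \<Rightarrow> ('k \<times> real) set"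
  where "epi_ge D J = {(K, \<gamma>). K \<in> D \<and> ereal \<gamma> \<ge> J K}"


section \<open>The lifted set and the convex set\<close>

definition brl_matrix :: "real^'n^'n \<Rightarrow> real^'m^'n \<Rightarrow> real^'n^'p
    \<Rightarrow> real^'n^'n \<Rightarrow> real^'m^'m \<Rightarrow> real^'n^'n \<Rightarrow> real^'p^'p
    \<Rightarrow> ('m, 'n, 'p) policy \<Rightarrow> real \<Rightarrow> real^('n + 'n)^('n + 'n)
    \<Rightarrow> real^(('n + 'n) + ('n + 'p) + ('n + 'm))^(('n + 'n) + ('n + 'p) + ('n + 'm))"
  where "brl_matrix A B C Q R W V K \<gamma> P =
    (let Ac = A_cl A B C K; Bc = B_cl B W V K; Cc = C_cl C Q R K; Dc = D_cl R V K in
     (transpose Ac ** P + P ** Ac <|> P ** Bc   <|> transpose Cc </>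
      transpose Bc ** P           <|> mat (- \<gamma>) <|> transpose Dc </>
      Cc                          <|> Dc        <|> mat (- \<gamma>)))"

definition L_inf_d :: "real^'n^'n \<Rightarrow> real^'m^'n \<Rightarrow> real^'n^'p
    \<Rightarrow> real^'n^'n \<Rightarrow> real^'m^'m \<Rightarrow> real^'n^'n \<Rightarrow> real^'p^'p
    \<Rightarrow> ('m, 'n, 'p) lifted_point set"
  where "L_inf_d A B C Q R W V =
    {(K, \<gamma>, P). pos_def P \<and> blk12 P \<in> GL \<and> neg_semidef (brl_matrix A B C Q R W V K \<gamma> P)}"

definition B1_mat :: "real^'n^'n \<Rightarrow> real^('n + 'p::finite)^'n"
  where "B1_mat W = (msqrt W <|> 0)"

definition C1_mat :: "real^'n^'n \<Rightarrow> real^'n^('n + 'm::finite)"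
  where "C1_mat Q = (msqrt Q </> 0)"

definition D12_mat :: "real^'m^'m \<Rightarrow> real^'m^('n::finite + 'm)"
  where "D12_mat R = (0 </> msqrt R)"

definition D21_mat :: "real^'p^'p \<Rightarrow> real^('n::finite + 'p)^'p"
  where "D21_mat V = (0 <|> msqrt V)"

definition M_lmi :: "real^'n^'n \<Rightarrow> real^'m^'n \<Rightarrow> real^'n^'p
    \<Rightarrow> real^'n^'n \<Rightarrow> real^'m^'m \<Rightarrow> real^'n^'n \<Rightarrow> real^'p^'p
    \<Rightarrow> real \<Rightarrow> ('m, 'n, 'p) policy \<Rightarrow> real^'n^'n \<Rightarrow> real^'n^'n
    \<Rightarrow> real^('n + 'n + ('n + 'p) + ('n + 'm))^('n + 'n + ('n + 'p) + ('n + 'm))"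
  where "M_lmi A B C Q R W V \<gamma> \<Lambda> X Y =
    (let G = blk11 \<Lambda>; F = blk12 \<Lambda>; H = blk21 \<Lambda>; M = blk22 \<Lambda>;
         B1 = B1_mat W; C1 = C1_mat Q; D12 = D12_mat R; D21 = D21_mat V;
         M11 = A ** X + B ** F + transpose (A ** X + B ** F);
         M12 = transpose M + A + B ** G ** C;
         M13 = B1 + B ** G ** D21;
         M14 = transpose (C1 ** X + D12 ** F);
         M22 = Y ** A + H ** C + transpose (Y ** A + H ** C);
         M23 = Y ** B1 + H ** D21;
         M24 = transpose (C1 + D12 ** G ** C);
         M34 = transpose (D12 ** G ** D21)
     in (M11           <|> M12           <|> M13           <|> M14 </>
         transpose M12 <|> M22           <|> M23           <|> M24 </>
         transpose M13 <|> transpose M23 <|> mat (- \<gamma>)     <|> M34 </>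
         transpose M14 <|> transpose M24 <|> transpose M34 <|> mat (- \<gamma>)))"

definition F_inf_d :: "real^'n^'n \<Rightarrow> real^'m^'n \<Rightarrow> real^'n^'p
    \<Rightarrow> real^'n^'n \<Rightarrow> real^'m^'m \<Rightarrow> real^'n^'n \<Rightarrow> real^'p^'p
    \<Rightarrow> ('m, 'n, 'p) convex_point set"
  where "F_inf_d A B C Q R W V =
    {(\<gamma>, \<Lambda>, X, Y). X \<in> sym_mats \<and> Y \<in> sym_mats \<and> pos_def (X <|> mat 1 </> mat 1 <|> Y) \<and>
       neg_semidef (M_lmi A B C Q R W V \<gamma> \<Lambda> X Y)}"

fun Phi_inf_d :: "real^'n^'n \<Rightarrow> real^'m^'n \<Rightarrow> real^'n^'p
    \<Rightarrow> ('m, 'n, 'p) lifted_point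
    \<Rightarrow> ('m, 'n, 'p) convex_point \<times> (real^'n^'n)"
  where "Phi_inf_d A B C (K, \<gamma>, P) =
    (let DK = blk11 K; CK = blk12 K; BK = blk21 K; AK = blk22 K;
         P11 = blk11 P; P12 = blk12 P;
         X = blk11 (matrix_inv P); X21 = blk21 (matrix_inv P);
         M = P12 ** BK ** C ** X + P11 ** B ** CK ** X21 + P11 ** (A + B ** DK ** C) ** X
               + P12 ** AK ** X21;
         H = P11 ** B ** DK + P12 ** BK;
         F = DK ** C ** X + CK ** X21
     in ((\<gamma>, (DK <|> F </> H <|> M), X, P11), P12))"

fun Psi_inf_d :: "real^'n^'n \<Rightarrow> real^'m^'n \<Rightarrow> real^'n^'p
    \<Rightarrow> ('m, 'n, 'p) convex_point \<times> (real^'n^'n)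
    \<Rightarrow> ('m, 'n, 'p) lifted_point"
  where "Psi_inf_d A B C ((\<gamma>, \<Lambda>, X, Y), \<Xi>) =
    (let G = blk11 \<Lambda>; F = blk12 \<Lambda>; H = blk21 \<Lambda>; M = blk22 \<Lambda>;
         \<Delta> = Y - matrix_inv X
     in (matrix_inv (mat 1 <|> 0 </> Y ** B <|> \<Xi>)
           ** (G <|> F </> H <|> M - Y ** A ** X)
           ** matrix_inv (mat 1 <|> C ** X </> 0 <|> - (matrix_inv \<Xi> ** \<Delta> ** X)),
         \<gamma>,
         (Y <|> \<Xi> </> transpose \<Xi> <|> transpose \<Xi> ** matrix_inv \<Delta> ** \<Xi>)))"


section \<open>Diffeomorphisms between subsets of Euclidean spaces\<close>

text \<open>
  The Euclidean spaces in question involve spaces of symmetric matrices, which are proper linear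
  subspaces \<open>E\<close> of a type. So ``open'' means open in \<open>E\<close>, and derivatives are taken within
  \<open>E\<close>: for \<open>U\<close> open in \<open>E\<close>, a derivative of \<open>f\<close> within \<open>U\<close> is uniquely determined on \<open>E\<close>, and
  only its values in directions \<open>v \<in> E\<close> are used.
\<close>

primrec Ck_on :: "nat \<Rightarrow> 'a::euclidean_space set \<Rightarrow> 'a set \<Rightarrow> ('a \<Rightarrow> 'b::euclidean_space) \<Rightarrow> bool"
  where
    "Ck_on 0 E U f \<longleftrightarrow> continuous_on U f"
  | "Ck_on (Suc k) E U f \<longleftrightarrow>
       (\<exists>f'. (\<forall>x\<in>U. (f has_derivative f' x) (at x within U)) \<and>
             (\<forall>v\<in>E. Ck_on k E U (\<lambda>x. f' x v)))"

definition smooth_on :: "enat \<Rightarrow> 'a::euclidean_space set \<Rightarrow> 'a set \<Rightarrow> ('a \<Rightarrow> 'b::euclidean_space) \<Rightarrow> bool"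
  where "smooth_on k E U f \<longleftrightarrow> (\<forall>j. enat j \<le> k \<longrightarrow> Ck_on j E U f)"

definition diffeomorphism ::
    "enat \<Rightarrow> 'a::euclidean_space set \<Rightarrow> 'a set \<Rightarrow> 'b::euclidean_space set \<Rightarrow> 'b set \<Rightarrow> ('a \<Rightarrow> 'b) \<Rightarrow> bool"
  where "diffeomorphism k E S E' S' f \<longleftrightarrow>
    subspace E \<and> subspace E' \<and> S' \<subseteq> E' \<and> bij_betw f S S' \<and>
    (\<exists>U U' g h. openin (top_of_set E) U \<and> S \<subseteq> U \<and> (\<forall>x\<in>S. g x = f x) \<and>
       smooth_on k E U g \<and> bij_betw g U U' \<and>
       openin (top_of_set E') U' \<and> smooth_on k E' U' h \<and> (\<forall>x\<in>U. h (g x) = x))"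

definition lifted_space :: "('m::finite, 'n::finite, 'p::finite) lifted_point set"
  where "lifted_space = UNIV \<times> UNIV \<times> sym_mats"

definition convex_space ::
    "(('m::finite, 'n, 'p::finite) convex_point \<times> (real^'n^'n)) set"
  where "convex_space = (UNIV \<times> UNIV \<times> sym_mats \<times> sym_mats) \<times> UNIV"

end

theory Submission
  imports Defs "HOL-Computational_Algebra.Fundamental_Theorem_Algebra"
begin

text \<open>
  The two inclusions rest on the bounded real lemma for the closed loop \<open>(A\<^sub>c, B\<^sub>c, C\<^sub>c, D\<^sub>c)\<close>.

  If \<open>K\<close> stabilizes and \<open>\<gamma> > J(K)\<close>, the strict bounded real lemma (\<open>bounded_real_strict\<close>) gives a positive
  definite solution of the strict matrix inequality. It is a case of the strict
  Kalman-Yakubovich-Popov lemma (\<open>kyp\<close>), proved by convex duality: if the inequality has no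
  solution, separation of a point from a compact convex set yields a nonzero positive semidefinite \<open>Z\<close>
  that annihilates the terms linear in \<open>P\<close> and has a nonnegative pairing with the remaining quadratic form.
  With \<open>Z = R R\<close>, the equation satisfied by \<open>R\<close> says that a pencil of two linear maps is simultaneously diagonalizable (\<open>pencil_diagonalizable\<close>), and each vector of
  the diagonalizing orthonormal basis is a pair of state and input at one imaginary frequency, finite or
  infinite, where the frequency inequality applies; adding up over the basis gives a contradiction.
  Positivity of the solution is Lyapunov's theorem (\<open>lyapunov_pos_def\<close>). As the inequality is strict, the
  off-diagonal block of \<open>P\<close> can be made invertible by a small perturbation (\<open>brl_strict_coupled\<close>).

  Conversely, the nonstrict inequality with \<open>P\<close> positive definite excludes closed-loop eigenvalues of
  positive real part. An eigenvector \<open>v\<close> for an imaginary eigenvalue satisfies \<open>C\<^sub>c v = 0\<close>, and \<open>P v\<close> is a left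
  eigenvector with \<open>B\<^sub>c\<^sup>T P v = 0\<close>. Observability of \<open>(Q\<^sup>1\<^sup>/\<^sup>2, A)\<close> makes the plant part of \<open>v\<close> vanish,
  controllability of \<open>(A, W\<^sup>1\<^sup>/\<^sup>2)\<close> the plant part of \<open>P v\<close>, and invertibility of \<open>P\<^sub>1\<^sub>2\<close> the rest
  (\<open>lmi_imp_hurwitz\<close>). So the closed loop is stable, and the inequality bounds the transfer function on the
  imaginary axis: the projection of the lifted set is contained in the nonstrict epigraph itself, and the
  closure is not needed.

  For the diffeomorphism, let \<open>T\<close> be the matrix with block rows \<open>(X, I)\<close> and \<open>(X\<^sub>2\<^sub>1, 0)\<close>, where \<open>X\<close> and \<open>X\<^sub>2\<^sub>1\<close> form
  the first block column of \<open>P\<^sup>-\<^sup>1\<close>. Congruence with \<open>T\<close> turns \<open>P\<close> into the matrix with block rows \<open>(X, I)\<close>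
  and \<open>(I, Y)\<close>, and congruence with \<open>diag(T, I, I)\<close> turns the bounded real inequality into the convex one
  (\<open>M_lmi_congruence\<close>). All identities behind \<open>\<Phi>\<close> and \<open>\<Psi>\<close> hold without the matrix inequalities, so
  \<open>\<Phi>\<close> is a bijection with inverse \<open>\<Psi>\<close> between two sets that are open in the ambient linear spaces
  (\<open>Phi_props\<close>, \<open>Psi_props\<close>). Both maps are composed of products and inverses of matrices, hence smooth.
\<close>


section \<open>Self-adjoint operators\<close>

lemma self_adjoint_nonneg_zero:
  fixes T :: "'a::real_inner \<Rightarrow> 'a"
  assumes T: "linear T" and S: "subspace S"
    and sa: "\<And>x y. x \<in> S \<Longrightarrow> y \<in> S \<Longrightarrow> x \<bullet> T y = T x \<bullet> y"
    and nonneg: "\<And>x. x \<in> S \<Longrightarrow> 0 \<le> x \<bullet> T x"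
    and v: "v \<in> S" "T v \<in> S" "v \<bullet> T v = 0"
  shows "T v = 0"
proof (rule ccontr)
  assume ne: "T v \<noteq> 0"
  define w where "w = T v"
  define c where "c = w \<bullet> T w"
  have w: "w \<in> S" "0 < w \<bullet> w" using v ne by (auto simp: w_def)
  have c: "0 \<le> c" using nonneg w by (simp add: c_def)
  have q: "0 \<le> t * t * c - 2 * t * (w \<bullet> w)" for t
  proof -
    have "v - t *\<^sub>R w \<in> S" using v w S by (simp add: subspace_diff subspace_scale)
    from nonneg[OF this] have "0 \<le> (v - t *\<^sub>R w) \<bullet> (T v - t *\<^sub>R T w)"
      using T by (simp add: linear_diff linear_scale)
    also have "\<dots> = v \<bullet> T v - t * (v \<bullet> T w) - t * (w \<bullet> T v) + t * t * (w \<bullet> T w)"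
      by (simp add: inner_diff_left inner_diff_right algebra_simps)
    also have "v \<bullet> T w = w \<bullet> w" using sa[OF v(1) w(1)] by (simp add: w_def)
    finally show ?thesis using v(3) by (simp add: w_def c_def algebra_simps)
  qed
  (* for this small t the linear term of the quadratic polynomial in t dominates *)
  define t where "t = (w \<bullet> w) / (c + 1)"
  have t: "0 < t" using w c by (simp add: t_def)
  have "t * c < 2 * (w \<bullet> w)"
  proof -
    have "t * c \<le> t * (c + 1)" using t by simp
    also have "\<dots> = w \<bullet> w" using c by (simp add: t_def)
    finally show ?thesis using w by linarith
  qed
  then have "t * (t * c) < t * (2 * (w \<bullet> w))" using t by (rule mult_strict_left_mono)
  with q[of t] show False by (simp add: algebra_simps)
qed

text \<open>A maximiser of \<open>x \<bullet> T x\<close> on the unit sphere is an eigenvector, since the nonnegative form of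
  \<open>l - T\<close> vanishes there.\<close>

lemma self_adjoint_eigenvector:
  fixes T :: "'a::euclidean_space \<Rightarrow> 'a"
  assumes T: "linear T" and S: "subspace S" and inv: "\<And>x. x \<in> S \<Longrightarrow> T x \<in> S"
    and sa: "\<And>x y. x \<in> S \<Longrightarrow> y \<in> S \<Longrightarrow> x \<bullet> T y = T x \<bullet> y"
    and nz: "S \<noteq> {0}"
  obtains v l where "v \<in> S" "norm v = 1" "T v = l *\<^sub>R v" "\<And>x. x \<in> S \<Longrightarrow> x \<bullet> T x \<le> l * (x \<bullet> x)"
proof -
  let ?K = "sphere 0 1 \<inter> S"
  have "compact ?K" using closed_subspace[OF S] by (simp add: compact_Int_closed)
  moreover obtain u where "u \<in> S" "u \<noteq> 0" using nz subspace_0[OF S] by blast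
  then have "(1 / norm u) *\<^sub>R u \<in> ?K" using S by (simp add: subspace_scale)
  then have "?K \<noteq> {}" by blast
  moreover have "continuous_on ?K (\<lambda>x. x \<bullet> T x)"
    using T by (intro continuous_intros linear_continuous_on) (simp add: linear_conv_bounded_linear)
  ultimately obtain v where v: "v \<in> ?K" and max: "\<And>x. x \<in> ?K \<Longrightarrow> x \<bullet> T x \<le> v \<bullet> T v"
    by (metis continuous_attains_sup)
  define l where "l = v \<bullet> T v"
  have le: "x \<bullet> T x \<le> l * (x \<bullet> x)" if x: "x \<in> S" for x
  proof (cases "x = 0")
    case True then show ?thesis using T by (simp add: linear_0)
  next
    case False
    let ?y = "(1 / norm x) *\<^sub>R x"
    have "?y \<in> ?K" using False x S by (simp add: subspace_scale)
    from max[OF this] have "(1 / norm x) * ((1 / norm x) * (x \<bullet> T x)) \<le> l"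
      using T by (simp add: linear_scale l_def)
    then have "x \<bullet> T x / (norm x * norm x) \<le> l" by simp
    then have "x \<bullet> T x \<le> l * (norm x * norm x)"
      using False by (simp add: divide_le_eq mult_less_0_iff zero_less_mult_iff)
    then show ?thesis by (simp add: dot_square_norm power2_eq_square)
  qed
  define N where "N = (\<lambda>x. l *\<^sub>R x - T x)"
  have "N v = 0"
  proof (rule self_adjoint_nonneg_zero[of N S])
    show "linear N" unfolding N_def using T
      by (intro linear_compose_sub linear_scale_self) 
    show "x \<bullet> N y = N x \<bullet> y" if "x \<in> S" "y \<in> S" for x y
      using sa[OF that] by (simp add: N_def inner_diff_left inner_diff_right)
    show "0 \<le> x \<bullet> N x" if "x \<in> S" for x
      using le[OF that] by (simp add: N_def inner_diff_right)
    show "N v \<in> S" using v inv S by (simp add: N_def subspace_diff subspace_scale)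
    show "v \<bullet> N v = 0" using v by (simp add: N_def inner_diff_right l_def dot_square_norm)
  qed (use v S in auto)
  then have "T v = l *\<^sub>R v" by (simp add: N_def)
  then show thesis using that[of v l] v le by auto
qed

theorem self_adjoint_diagonalizable:
  fixes T :: "'a::euclidean_space \<Rightarrow> 'a"
  assumes T: "linear T" and S: "subspace S" and inv: "\<And>x. x \<in> S \<Longrightarrow> T x \<in> S"
    and sa: "\<And>x y. x \<in> S \<Longrightarrow> y \<in> S \<Longrightarrow> x \<bullet> T y = T x \<bullet> y"
  shows "\<exists>B. finite B \<and> pairwise orthogonal B \<and> (\<forall>b\<in>B. norm b = 1 \<and> (\<exists>l. T b = l *\<^sub>R b)) \<and> span B = S"
  using S inv sa
proof (induction "dim S" arbitrary: S rule: less_induct)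
  case less
  show ?case
  proof (cases "S = {0}")
    case True
    then show ?thesis by (intro exI[of _ "{}"]) auto
  next
    case False
    obtain v l where v: "v \<in> S" "norm v = 1" "T v = l *\<^sub>R v"
      using self_adjoint_eigenvector[OF T less.prems(1,2,3) False] by metis
    define S' where "S' = S \<inter> {x. v \<bullet> x = 0}"
    have S': "subspace S'" unfolding S'_def
      by (intro subspace_inter less.prems(1) subspace_hyperplane)
    have "v \<notin> S'" using v by (auto simp: S'_def)
    moreover have "S' \<subseteq> S" by (simp add: S'_def)
    ultimately have "S' \<subset> S" using v(1) by blast
    then have "span S' \<subset> span S" using S' less.prems(1) by (simp add: span_eq_iff[THEN iffD2])
    then have "dim S' < dim S" by (rule dim_psubset)
    moreover have "T x \<in> S'" if "x \<in> S'" for x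
      using that less.prems(2)[of x] less.prems(3)[of v x] v by (auto simp: S'_def)
    moreover have "x \<bullet> T y = T x \<bullet> y" if "x \<in> S'" "y \<in> S'" for x y
      using that less.prems(3) by (auto simp: S'_def)
    ultimately obtain B where B: "finite B" "pairwise orthogonal B"
        "\<forall>b\<in>B. norm b = 1 \<and> (\<exists>l. T b = l *\<^sub>R b)" "span B = S'"
      using less.hyps[of S'] S' by metis
    have BS: "B \<subseteq> S'" using B(4) span_superset by blast
    have "span (insert v B) = S"
    proof
      show "span (insert v B) \<subseteq> S"
        using BS v less.prems(1) by (intro span_minimal) (auto simp: S'_def)
      show "S \<subseteq> span (insert v B)"
      proof
        fix x assume x: "x \<in> S"
        have "x - (v \<bullet> x) *\<^sub>R v \<in> S'"
          using x v less.prems(1) by (auto simp: S'_def subspace_diff subspace_scale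
              inner_diff_right dot_square_norm)
        then show "x \<in> span (insert v B)" using B(4) by (auto simp: span_breakdown_eq)
      qed
    qed
    moreover have "pairwise orthogonal (insert v B)"
      using B(2) BS by (auto simp: pairwise_insert S'_def orthogonal_def inner_commute)
    ultimately show ?thesis using B v by (intro exI[of _ "insert v B"]) auto
  qed
qed

lemma trace_orthonormal_basis:
  fixes T :: "'a::euclidean_space \<Rightarrow> 'a"
  assumes T: "linear T" and B: "finite B" "pairwise orthogonal B" "\<And>b. b \<in> B \<Longrightarrow> norm b = 1" "span B =
      UNIV"
  shows "(\<Sum>b\<in>B. b \<bullet> T b) = (\<Sum>b\<in>Basis. b \<bullet> T b)"
proof -
  have exp: "(\<Sum>b\<in>B. (b \<bullet> x) * (b \<bullet> y)) = x \<bullet> y" for x y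
  proof -
    have "x = (\<Sum>b\<in>B. (b \<bullet> x) *\<^sub>R b)"
      using orthonormal_basis_expand[OF B(2,3) _ B(1), of x] B(4) by (simp add: inner_commute)
    then have "x \<bullet> y = (\<Sum>b\<in>B. (b \<bullet> x) *\<^sub>R b) \<bullet> y" by simp
    then show ?thesis by (simp add: inner_sum_left)
  qed
  have "(\<Sum>b\<in>B. b \<bullet> T b) = (\<Sum>b\<in>B. \<Sum>e\<in>Basis. (b \<bullet> e) * (b \<bullet> adjoint T e))"
  proof (rule sum.cong[OF refl])
    fix b
    have "b \<bullet> T b = (\<Sum>e\<in>Basis. (b \<bullet> e) * (T b \<bullet> e))" by (rule euclidean_inner)
    also have "\<dots> = (\<Sum>e\<in>Basis. (b \<bullet> e) * (b \<bullet> adjoint T e))"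
      using adjoint_works[OF T] by (simp add: inner_commute)
    finally show "b \<bullet> T b = \<dots>" .
  qed
  also have "\<dots> = (\<Sum>e\<in>Basis. \<Sum>b\<in>B. (b \<bullet> e) * (b \<bullet> adjoint T e))" by (rule sum.swap)
  also have "\<dots> = (\<Sum>e\<in>Basis. e \<bullet> adjoint T e)" by (simp add: exp)
  also have "\<dots> = (\<Sum>e\<in>Basis. e \<bullet> T e)"
    using adjoint_works[OF T] by (simp add: inner_commute)
  finally show ?thesis .
qed

text \<open>
  If \<open>H F\<^sup>*\<close> is self-adjoint, the pencil \<open>H - l F\<close> is diagonalizable by an orthonormal basis, up to the
  kernel of \<open>F\<close>. On the range of \<open>F\<^sup>*\<close>, which is the orthogonal complement of that kernel, \<open>F\<close> is injective and
  \<open>F\<^sup>-\<^sup>1 H\<close> is well defined and self-adjoint; the kernel contributes an arbitrary orthonormal basis.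
\<close>

lemma pencil_diagonalizable:
  fixes F H :: "'a::euclidean_space \<Rightarrow> 'b::euclidean_space"
  assumes F: "linear F" and H: "linear H"
    and sa: "\<And>y z. y \<bullet> H (adjoint F z) = H (adjoint F y) \<bullet> z"
  shows "\<exists>B. finite B \<and> pairwise orthogonal B \<and> span B = UNIV \<and>
    (\<forall>b\<in>B. norm b = 1 \<and> (F b = 0 \<or> (\<exists>l. H b = l *\<^sub>R F b)))"
proof -
  define V where "V = range (adjoint F)"
  define N where "N = {x. F x = 0}"
  note adj = adjoint_works[OF F] and adjH = adjoint_works[OF H]
  have V: "subspace V" unfolding V_def
    using adjoint_linear[OF F] by (simp add: linear_subspace_image subspace_UNIV)
  have N: "subspace N" unfolding N_def using F by (rule linear_subspace_kernel)
  have orth: "v \<bullet> w = 0" if "v \<in> V" "w \<in> N" for v w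
    using that adj by (auto simp: V_def N_def inner_commute)
  have decomp: "\<exists>v w. v \<in> V \<and> w \<in> N \<and> x = v + w" for x
  proof -
    obtain v w where vw: "v \<in> span V" "\<And>u. u \<in> span V \<Longrightarrow> orthogonal w u" "x = v + w"
      using orthogonal_subspace_decomp_exists[of V x] by metis
    have "w \<bullet> adjoint F y = 0" for y
      using vw(2)[of "adjoint F y"] by (auto simp: V_def span_base orthogonal_def)
    then have "F w \<bullet> y = 0" for y using adj by (simp add: inner_commute)
    then have "w \<in> N" unfolding N_def using inner_eq_zero_iff by blast
    then show ?thesis using vw V by (auto simp: span_eq_iff[THEN iffD2])
  qed
  have inj: "inj_on F V"
  proof (rule inj_onI)
    fix x y assume xy: "x \<in> V" "y \<in> V" "F x = F y"
    then have "x - y \<in> V" "x - y \<in> N" using V F by (auto simp: N_def subspace_diff linear_diff)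
    then have "(x - y) \<bullet> (x - y) = 0" by (rule orth)
    then show "x = y" by simp
  qed
  obtain G where G: "range G \<subseteq> V" "linear G" "\<And>v. v \<in> V \<Longrightarrow> G (F v) = v"
    using linear_exists_left_inverse_on[OF F V inj] by auto
  have HV: "\<exists>v\<in>V. H w = F v" if w: "w \<in> V" for w
  proof -
    obtain y where y: "w = adjoint F y" using w by (auto simp: V_def)
    have "z \<bullet> H w = z \<bullet> F (adjoint H y)" for z
    proof -
      have "z \<bullet> H w = H (adjoint F z) \<bullet> y" unfolding y by (rule sa)
      also have "\<dots> = adjoint F z \<bullet> adjoint H y" using adjH by (simp add: inner_commute)
      also have "\<dots> = z \<bullet> F (adjoint H y)" by (rule adjoint_clauses(2)[OF F])
      finally show ?thesis .
    qed
    then have "(H w - F (adjoint H y)) \<bullet> (H w - F (adjoint H y)) = 0" by (simp add: inner_diff_right)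
    then have "H w = F (adjoint H y)" by simp
    moreover obtain v u where "v \<in> V" "u \<in> N" "adjoint H y = v + u" using decomp by blast
    ultimately show ?thesis using F by (auto simp: N_def linear_add)
  qed
  define T where "T = (\<lambda>x. G (H x))"
  have FT: "F (T w) = H w" if "w \<in> V" for w using HV[OF that] G(3) by (auto simp: T_def)
  have T: "linear T" unfolding T_def using linear_compose[OF H G(2)] by (simp add: o_def)
  have TV: "T x \<in> V" for x using G(1) by (auto simp: T_def)
  have Tsa: "x \<bullet> T y = T x \<bullet> y" if x: "x \<in> V" and y: "y \<in> V" for x y
  proof -
    obtain a b where ab: "x = adjoint F a" "y = adjoint F b" using x y by (auto simp: V_def)
    have "x \<bullet> T y = a \<bullet> F (T y)" unfolding ab(1) by (rule adjoint_clauses(2)[OF F])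
    also have "\<dots> = H x \<bullet> b" using FT[OF y] sa ab by simp
    also have "\<dots> = T x \<bullet> y" unfolding ab(2) adj FT[OF x] ..
    finally show ?thesis .
  qed
  obtain B1 where B1: "finite B1" "pairwise orthogonal B1"
      "\<forall>b\<in>B1. norm b = 1 \<and> (\<exists>l. T b = l *\<^sub>R b)" "span B1 = V"
    using self_adjoint_diagonalizable[OF T V TV Tsa] by blast
  obtain B2 where B2: "finite B2" "pairwise orthogonal B2" "\<forall>b\<in>B2. norm b = 1" "span B2 = N"
    using self_adjoint_diagonalizable[of id N] N by (auto simp: linear_id)
  have s1: "B1 \<subseteq> V" and s2: "B2 \<subseteq> N" using B1(4) B2(4) span_superset by auto
  have orth2: "w \<bullet> v = 0" if "v \<in> V" "w \<in> N" for v w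
    using orth[OF that] by (simp add: inner_commute)
  have "span (B1 \<union> B2) = UNIV"
  proof -
    have "x \<in> span (B1 \<union> B2)" for x
      using decomp[of x] unfolding span_Un B1(4) B2(4) by auto
    then show ?thesis by blast
  qed
  moreover have "pairwise orthogonal (B1 \<union> B2)"
    unfolding pairwise_def
    using B1(2) B2(2) orth orth2 s1 s2 by (auto simp: pairwise_def orthogonal_def subset_iff)
  moreover have "\<exists>l. H b = l *\<^sub>R F b" if "b \<in> B1" for b
    using B1(3) that FT[of b] s1 F by (metis linear_scale subsetD)
  moreover have "F b = 0" if "b \<in> B2" for b using s2 that by (auto simp: N_def)
  ultimately show ?thesis using B1 B2 by (intro exI[of _ "B1 \<union> B2"]) auto
qed


section \<open>Square roots of positive semidefinite matrices\<close>

lemma sym_mats_iff: "M \<in> sym_mats \<longleftrightarrow> (\<forall>x y. x \<bullet> (M *v y) = (M *v x) \<bullet> y)" for M :: "real^'n^'n"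
proof
  assume "M \<in> sym_mats"
  then have t: "transpose M = M" by (simp add: sym_mats_def)
  show "\<forall>x y. x \<bullet> (M *v y) = (M *v x) \<bullet> y"
    by (metis dot_lmul_matrix t vector_transpose_matrix)
next
  assume a: "\<forall>x y. x \<bullet> (M *v y) = (M *v x) \<bullet> y"
  have "M $ i $ j = M $ j $ i" for i j
    using a[rule_format, of "axis i 1" "axis j 1"]
    by (simp add: inner_axis inner_axis' matrix_vector_mult_basis column_def)
  then show "M \<in> sym_mats" by (simp add: sym_mats_def transpose_def vec_eq_iff)
qed

text \<open>Uniqueness of the square root: a positive semidefinite root of \<open>M\<close> acts on the eigenvectors of \<open>M\<close>
  in the only possible way.\<close>

lemma pos_semidef_root_eigenvector:
  assumes S: "pos_semidef (S::real^'n^'n)" and v: "S *v (S *v v) = (m * m) *\<^sub>R v" and m: "0 \<le> m"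
  shows "S *v v = m *\<^sub>R v"
proof -
  have sy: "x \<bullet> (S *v y) = (S *v x) \<bullet> y" for x y
    using S by (simp add: pos_semidef_def sym_mats_iff)
  define w where "w = S *v v - m *\<^sub>R v"
  have Sw: "S *v w = - m *\<^sub>R w"
    by (simp add: w_def v matrix_vector_mult_diff_distrib matrix_vector_mult_scaleR algebra_simps)
  have "0 \<le> w \<bullet> (S *v w)" using S by (simp add: pos_semidef_def)
  then have le: "m * (w \<bullet> w) \<le> 0" by (simp add: Sw)
  have "w = 0"
  proof (cases "m = 0")
    case False
    then have "w \<bullet> w \<le> 0" using le m by (simp add: mult_le_0_iff)
    then have "w \<bullet> w = 0" using inner_ge_zero[of w] by linarith
    then show ?thesis by simp
  next
    case True
    have "(S *v v) \<bullet> (S *v v) = v \<bullet> (S *v (S *v v))" using sy by simp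
    then show ?thesis using v True by (simp add: w_def)
  qed
  then show ?thesis by (simp add: w_def)
qed

lemma msqrt:
  assumes M: "pos_semidef (M::real^'n^'n)"
  shows "pos_semidef (msqrt M)" "msqrt M ** msqrt M = M"
proof -
  have sy: "x \<bullet> (M *v y) = (M *v x) \<bullet> y" for x y
    using M by (simp add: pos_semidef_def sym_mats_iff)
  obtain B where B: "finite B" "pairwise orthogonal B"
      "\<forall>b\<in>B. norm b = 1 \<and> (\<exists>l. M *v b = l *\<^sub>R b)" "span B = UNIV"
    using self_adjoint_diagonalizable[of "(*v) M" UNIV] sy by auto
  then obtain l where l: "\<And>b. b \<in> B \<Longrightarrow> M *v b = l b *\<^sub>R b" by metis
  have ex: "x = (\<Sum>b\<in>B. (b \<bullet> x) *\<^sub>R b)" for x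
    using orthonormal_basis_expand[OF B(2) _ _ B(1), of x] B(3,4) by (simp add: inner_commute)
  have bb: "b \<bullet> b' = (if b = b' then 1 else 0)" if "b \<in> B" "b' \<in> B" for b b'
    using that B(2,3) by (auto simp: pairwise_def orthogonal_def dot_square_norm)
  have l0: "0 \<le> l b" if "b \<in> B" for b
  proof -
    have "0 \<le> b \<bullet> (M *v b)" using M by (simp add: pos_semidef_def)
    then show ?thesis using that l bb by simp
  qed
  define f where "f = (\<lambda>x. \<Sum>b\<in>B. (sqrt (l b) * (b \<bullet> x)) *\<^sub>R b)"
  have f: "linear f"
    by (rule linearI)
       (simp_all add: f_def inner_add_right algebra_simps sum.distrib scaleR_sum_right)
  define S where "S = matrix f"
  have Sv: "S *v x = f x" for x using f by (simp add: S_def)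
  have fb: "f b = sqrt (l b) *\<^sub>R b" if "b \<in> B" for b
  proof -
    have "f b = (\<Sum>c\<in>B. if c = b then sqrt (l b) *\<^sub>R b else 0)"
      unfolding f_def by (rule sum.cong) (auto simp: bb that)
    then show ?thesis using that B(1) by simp
  qed
  have fsym: "x \<bullet> f y = f x \<bullet> y" for x y
    by (simp add: f_def inner_sum_left inner_sum_right inner_commute mult_ac)
  have fnn: "0 \<le> x \<bullet> f x" for x
  proof -
    have "x \<bullet> f x = (\<Sum>b\<in>B. sqrt (l b) * (b \<bullet> x) * (x \<bullet> b))"
      by (simp add: f_def inner_sum_right)
    moreover have "0 \<le> sqrt (l b) * (b \<bullet> x) * (x \<bullet> b)" if "b \<in> B" for b
      unfolding inner_commute[of x b] mult.assoc using l0[OF that] by simp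
    ultimately show ?thesis by (simp add: sum_nonneg)
  qed
  have Sp: "pos_semidef S" unfolding pos_semidef_def sym_mats_iff Sv using fsym fnn by blast
  have "(S ** S) *v x = M *v x" for x
  proof -
    have "f (f x) = M *v x"
    proof (rule linear_eq_on[of "\<lambda>x. f (f x)" "(*v) M" x B])
      show "linear (\<lambda>x. f (f x))" using linear_compose[OF f f] by (simp add: o_def)
      show "f (f b) = M *v b" if "b \<in> B" for b
        using that fb l l0 f by (simp add: linear_scale)
    qed (use B in auto)
    then show ?thesis by (simp add: Sv flip: matrix_vector_mul_assoc)
  qed
  then have SS: "S ** S = M" by (simp add: matrix_eq)
  have uniq: "S' = S" if S': "pos_semidef S'" "S' ** S' = M" for S'
  proof -
    have "S' *v b = S *v b" if b: "b \<in> B" for b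
    proof -
      have "S' *v (S' *v b) = (sqrt (l b) * sqrt (l b)) *\<^sub>R b"
        using b l l0 by (simp add: matrix_vector_mul_assoc S'(2))
      then have "S' *v b = sqrt (l b) *\<^sub>R b"
        by (rule pos_semidef_root_eigenvector[OF S'(1)]) (use l0 b in simp)
      then show ?thesis using fb b by (simp add: Sv)
    qed
    then have "S' *v x = S *v x" for x
      by (intro linear_eq_on[of "(*v) S'" "(*v) S" x B]) (auto simp: B(4))
    then show ?thesis by (simp add: matrix_eq)
  qed
  have "msqrt M = S" unfolding msqrt_def using Sp SS uniq by (intro the_equality conjI) blast+
  then show "pos_semidef (msqrt M)" "msqrt M ** msqrt M = M" using Sp SS by auto
qed


section \<open>Matrix products, outer products and traces\<close>

lemma inner_matrix_vector: "x \<bullet> (M *v y) = (transpose M *v x) \<bullet> y"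
  for M :: "real^'a^'b"
  by (simp add: dot_lmul_matrix)

text \<open>The rank one matrix \<open>x y\<^sup>T\<close>.\<close>

definition outer :: "real^'a \<Rightarrow> real^'b \<Rightarrow> real^'b^'a"
  where "outer x y = (\<chi> i j. x $ i * y $ j)"

lemma inner_outer: "P \<bullet> outer x y = x \<bullet> (P *v y)"
  by (simp add: outer_def inner_vec_def matrix_vector_mult_def sum_distrib_left sum_distrib_right
      mult_ac)

lemma outer_mult: "M ** outer x y ** transpose N = outer (M *v x) (N *v y)"
proof -
  have "(M ** outer x y ** transpose N) $ i $ j = outer (M *v x) (N *v y) $ i $ j" for i j
    by (simp add: outer_def matrix_matrix_mult_def matrix_vector_mult_def transpose_def
        sum_distrib_left sum_distrib_right mult_ac) (rule sum.swap)
  then show ?thesis by (simp add: vec_eq_iff)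
qed

lemma outer_matrix_vector: "outer x y *v z = (y \<bullet> z) *\<^sub>R x"
  by (simp add: outer_def matrix_vector_mult_def vec_eq_iff inner_vec_def sum_distrib_left
      sum_distrib_right mult_ac)

lemma pos_semidef_outer: "pos_semidef (outer x x)"
  by (simp add: pos_semidef_def sym_mats_iff outer_matrix_vector inner_commute)

lemma trace_outer: "trace (outer x x) = x \<bullet> x"
  by (simp add: trace_def outer_def inner_vec_def)

lemma trace_scaleR: "trace (c *\<^sub>R M) = c * trace (M :: real^'n^'n)"
  by (simp add: trace_def sum_distrib_left)

lemma pos_semidef_add: "pos_semidef M \<Longrightarrow> pos_semidef N \<Longrightarrow> pos_semidef (M + N)"
  by (auto simp: pos_semidef_def sym_mats_iff matrix_vector_mult_add_rdistrib inner_add_left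
      inner_add_right)

lemma pos_semidef_scaleR: "pos_semidef M \<Longrightarrow> 0 \<le> c \<Longrightarrow> pos_semidef (c *\<^sub>R M)"
  by (auto simp: pos_semidef_def sym_mats_iff scaleR_matrix_vector_assoc[symmetric])

lemma transpose_add: "transpose (M + N) = transpose M + transpose N"
  by (simp add: transpose_def vec_eq_iff)

lemma matrix_inv:
  fixes M :: "'a::semiring_1^'n^'m"
  assumes "invertible M"
  shows "M ** matrix_inv M = mat 1" "matrix_inv M ** M = mat 1"
  using someI_ex[OF assms[unfolded invertible_def]] by (auto simp: matrix_inv_def)

lemma matrix_inv_unique: "M ** N = mat 1 \<Longrightarrow> matrix_inv M = N" for M N :: "real^'n^'n"
proof -
  assume MN: "M ** N = mat 1"
  then have NM: "N ** M = mat 1" by (simp add: matrix_left_right_inverse)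
  then have "M ** matrix_inv M = mat 1" using MN invertible_def by (intro matrix_inv) blast
  then have "N ** (M ** matrix_inv M) = N" by simp
  then show ?thesis by (simp add: matrix_mul_assoc NM)
qed

lemma transpose_0: "transpose 0 = 0"
  by (simp add: transpose_def vec_eq_iff)

lemma trace_zero: "trace (0 :: real^'n^'n) = 0"
  by (simp add: trace_def)

lemma pos_semidef_0: "pos_semidef 0"
  by (simp add: pos_semidef_def sym_mats_iff)

lemma pos_semidef_zero:
  assumes "pos_semidef M" "x \<bullet> (M *v x) = 0"
  shows "M *v x = 0"
  using assms by (intro self_adjoint_nonneg_zero[of "(*v) M" UNIV x]) (auto simp: pos_semidef_def
      sym_mats_iff)

lemma bounded_bilinear_outer: "bounded_bilinear (outer :: real^'a \<Rightarrow> real^'b \<Rightarrow> _)"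
  unfolding bilinear_conv_bounded_bilinear[symmetric] bilinear_def
  by (auto intro!: linearI simp: outer_def vec_eq_iff algebra_simps)

lemma bounded_bilinear_matrix_mult:
  "bounded_bilinear ((**) :: real^'b^'a \<Rightarrow> real^'c^'b \<Rightarrow> real^'c^'a)"
  unfolding bilinear_conv_bounded_bilinear[symmetric] bilinear_def
  by (auto intro!: linearI simp: matrix_matrix_mult_def vec_eq_iff algebra_simps sum.distrib
      sum_distrib_left)

lemma bounded_bilinear_matrix_vector_mult:
  "bounded_bilinear ((*v) :: real^'b^'a \<Rightarrow> real^'b \<Rightarrow> real^'a)"
  unfolding bilinear_conv_bounded_bilinear[symmetric] bilinear_def
  by (auto intro!: linearI simp: matrix_vector_mult_def vec_eq_iff algebra_simps sum.distrib
      sum_distrib_left)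

lemmas matrix_mult_bilinear =
  bounded_bilinear.add_left[OF bounded_bilinear_matrix_mult] bounded_bilinear.add_right[OF
      bounded_bilinear_matrix_mult]
  bounded_bilinear.diff_left[OF bounded_bilinear_matrix_mult] bounded_bilinear.diff_right[OF
      bounded_bilinear_matrix_mult]
  bounded_bilinear.minus_left[OF bounded_bilinear_matrix_mult] bounded_bilinear.minus_right[OF
      bounded_bilinear_matrix_mult]
  bounded_bilinear.scaleR_left[OF bounded_bilinear_matrix_mult] bounded_bilinear.scaleR_right[OF
      bounded_bilinear_matrix_mult]

lemmas matrix_vector_bilinear =
  bounded_bilinear.add_left[OF bounded_bilinear_matrix_vector_mult] bounded_bilinear.add_right[OF
      bounded_bilinear_matrix_vector_mult]
  bounded_bilinear.diff_left[OF bounded_bilinear_matrix_vector_mult] bounded_bilinear.diff_right[OF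
      bounded_bilinear_matrix_vector_mult]
  bounded_bilinear.minus_left[OF bounded_bilinear_matrix_vector_mult]
      bounded_bilinear.minus_right[OF bounded_bilinear_matrix_vector_mult]
  bounded_bilinear.scaleR_left[OF bounded_bilinear_matrix_vector_mult]
      bounded_bilinear.scaleR_right[OF bounded_bilinear_matrix_vector_mult]

lemma sum_Basis_trace: "(\<Sum>b\<in>Basis. b \<bullet> (M *v b)) = trace (M :: real^'n^'n)"
proof -
  have B: "(Basis :: (real^'n) set) = range (\<lambda>i. axis i 1)" by (auto simp: Basis_vec_def)
  show ?thesis unfolding B
    by (subst sum.reindex) (auto simp: inj_on_def axis_eq_axis trace_def inner_axis'
        matrix_vector_mult_basis column_def)
qed

lemma sum_Basis_prod:
  fixes f :: "'a::euclidean_space \<times> 'b::euclidean_space \<Rightarrow> 'c::comm_monoid_add"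
  shows "sum f Basis = (\<Sum>i\<in>Basis. f (i, 0)) + (\<Sum>i\<in>Basis. f (0, i))"
proof -
  have "inj_on (\<lambda>u. (u :: 'a, 0 :: 'b)) Basis" "inj_on (\<lambda>u. (0 :: 'a, u :: 'b)) Basis"
    by (auto simp: inj_on_def)
  then show ?thesis unfolding Basis_prod_def
    by (subst sum.union_disjoint) (auto simp: sum.reindex nonzero_Basis)
qed

lemma trace_mult_inner: "trace (M ** N) = M \<bullet> transpose N" for M :: "real^'b^'a"
  by (simp add: trace_def matrix_matrix_mult_def inner_vec_def transpose_def)


section \<open>The strict Kalman-Yakubovich-Popov lemma\<close>

text \<open>
  A complex vector \<open>v = a + i b\<close> is represented by the pair \<open>(a, b)\<close>. So the hypothesis \<open>fin\<close> speaks of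
  \<open>H v = i \<omega> X v\<close>, the condition at the frequency \<open>\<omega>\<close>, and \<open>inf\<close> is the condition at infinite frequency; \<open>X\<close>
  extracts the state from \<open>v\<close> and \<open>H\<close> its derivative. The equation for \<open>Z = R R\<close> says that \<open>(H R) (X R)\<^sup>T\<close> is
  skew-symmetric; multiplication by \<open>i\<close> makes it self-adjoint.
\<close>

lemma kyp_dual:
  fixes X H :: "real^'k^'N" and \<Theta> Z :: "real^'k^'k"
  assumes fin: "\<And>a b \<omega>. (a, b) \<noteq> (0, 0) \<Longrightarrow> H *v a = - \<omega> *\<^sub>R (X *v b) \<Longrightarrow> H *v b = \<omega> *\<^sub>R (X *v a) \<Longrightarrow>
      a \<bullet> (\<Theta> *v a) + b \<bullet> (\<Theta> *v b) < 0"
    and inf: "\<And>a. a \<noteq> 0 \<Longrightarrow> X *v a = 0 \<Longrightarrow> a \<bullet> (\<Theta> *v a) < 0"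
    and Z: "pos_semidef Z" and eq: "X ** Z ** transpose H + H ** Z ** transpose X = 0"
    and ge: "0 \<le> Z \<bullet> \<Theta>"
  shows "Z = 0"
proof -
  define R where "R = msqrt Z"
  have R: "pos_semidef R" "R ** R = Z" using msqrt[OF Z] by (auto simp: R_def)
  have Rt: "transpose R = R" using R by (simp add: pos_semidef_def sym_mats_def)
  have Rs: "x \<bullet> (R *v y) = (R *v x) \<bullet> y" for x y using R by (simp add: pos_semidef_def sym_mats_iff)
  define XR where "XR = X ** R"
  define HR where "HR = H ** R"
  have XRv: "XR *v x = X *v (R *v x)" and HRv: "HR *v x = H *v (R *v x)" for x
    by (simp_all add: XR_def HR_def matrix_vector_mul_assoc)
  have "XR ** transpose HR + HR ** transpose XR = 0"
    using eq by (simp add: XR_def HR_def matrix_transpose_mul Rt R(2)[symmetric] matrix_mul_assoc)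
  then have XH: "XR ** transpose HR = - (HR ** transpose XR)" by (simp add: eq_neg_iff_add_eq_0)
  have skew: "y \<bullet> (HR *v (transpose XR *v z)) = - ((HR *v (transpose XR *v y)) \<bullet> z)" for y z
  proof -
    have "y \<bullet> (HR *v (transpose XR *v z)) = (transpose HR *v y) \<bullet> (transpose XR *v z)"
      by (rule inner_matrix_vector)
    also have "\<dots> = (XR *v (transpose HR *v y)) \<bullet> z"
      using inner_matrix_vector[of "transpose HR *v y" "transpose XR" z] by (simp del:
          transpose_matrix_vector)
    also have "\<dots> = - ((HR ** transpose XR) *v y) \<bullet> z"
      unfolding matrix_vector_mul_assoc XH by (simp add: matrix_vector_bilinear)
    finally show ?thesis by (simp only: matrix_vector_mul_assoc[symmetric] inner_minus_left)
  qed
  define F where "F = (\<lambda>p :: (real^'k) \<times> (real^'k). (XR *v fst p, XR *v snd p))"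
  define G where "G = (\<lambda>p :: (real^'k) \<times> (real^'k). (- (HR *v snd p), HR *v fst p))"
  define T where "T = (\<lambda>p :: (real^'k) \<times> (real^'k). ((R ** \<Theta> ** R) *v fst p, (R ** \<Theta> ** R) *v snd p))"
  have lin: "linear F" "linear G" "linear T"
    by (auto intro!: linearI simp: F_def G_def T_def matrix_vector_right_distrib
        matrix_vector_mult_scaleR)
  have adjF: "adjoint F = (\<lambda>q. (transpose XR *v fst q, transpose XR *v snd q))"
    by (rule adjoint_unique) (simp add: F_def inner_prod_def dot_lmul_matrix inner_commute[of _ "_
        v* _"] inner_commute[of "XR *v _"])
  have "y \<bullet> G (adjoint F z) = G (adjoint F y) \<bullet> z" for y z
    unfolding adjF G_def using skew by (simp add: inner_prod_def del: transpose_matrix_vector)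
  from pencil_diagonalizable[OF lin(1,2) this]
  obtain B where B: "finite B" "pairwise orthogonal B" "span B = UNIV"
      "\<And>b. b \<in> B \<Longrightarrow> norm b = 1" "\<And>b. b \<in> B \<Longrightarrow> F b = 0 \<or> (\<exists>l. G b = l *\<^sub>R F b)"
    by metis
  have q: "p \<bullet> T p = (R *v fst p) \<bullet> (\<Theta> *v (R *v fst p)) + (R *v snd p) \<bullet> (\<Theta> *v (R *v snd p))" for p
    by (simp add: T_def inner_prod_def Rs flip: matrix_vector_mul_assoc)
  have neg: "b \<bullet> T b < 0" if b: "b \<in> B" and nz: "(R *v fst b, R *v snd b) \<noteq> (0, 0)" for b
  proof (cases "F b = 0")
    case True
    then have "X *v (R *v fst b) = 0" "X *v (R *v snd b) = 0" by (simp_all add: F_def XRv zero_prod_def)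
    then have le: "R *v fst b \<noteq> 0 \<longrightarrow> (R *v fst b) \<bullet> (\<Theta> *v (R *v fst b)) < 0"
        "R *v snd b \<noteq> 0 \<longrightarrow> (R *v snd b) \<bullet> (\<Theta> *v (R *v snd b)) < 0"
      using inf by blast+
    show ?thesis unfolding q using nz le
      by (cases "R *v fst b = 0"; cases "R *v snd b = 0") (auto intro: add_neg_neg)
  next
    case False
    then obtain l where "G b = l *\<^sub>R F b" using B(5) b by blast
    then have l: "- (H *v (R *v snd b)) = l *\<^sub>R (X *v (R *v fst b))" "H *v (R *v fst b) = l *\<^sub>R (X
        *v (R *v snd b))"
      by (simp_all add: F_def G_def XRv HRv)
    (* a real eigenvalue l of the pencil belongs to the frequency - l *)
    show ?thesis unfolding q
    proof (rule fin[OF nz, of "- l"])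
      show "H *v (R *v fst b) = - (- l) *\<^sub>R (X *v (R *v snd b))" using l by simp
      show "H *v (R *v snd b) = - l *\<^sub>R (X *v (R *v fst b))" using l(1) by (metis minus_minus
          scaleR_minus_left)
    qed
  qed
  (* the trace over pairs of real vectors is twice the trace over real vectors *)
  have "(\<Sum>b\<in>B. b \<bullet> T b) = (\<Sum>b\<in>Basis. b \<bullet> T b)"
    by (rule trace_orthonormal_basis[OF lin(3) B(1,2,4,3)])
  also have "\<dots> = 2 * trace (R ** \<Theta> ** R)"
    by (simp add: sum_Basis_prod T_def inner_prod_def sum_Basis_trace)
  also have "trace (R ** \<Theta> ** R) = trace (R ** (R ** \<Theta>))" by (rule trace_mul_sym)
  also have "\<dots> = trace (\<Theta> ** Z)"
    by (metis R(2) matrix_mul_assoc trace_mul_sym)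
  also have "\<dots> = \<Theta> \<bullet> Z" using Z by (simp add: trace_mult_inner pos_semidef_def sym_mats_def)
  finally have sum: "0 \<le> (\<Sum>b\<in>B. b \<bullet> T b)" using ge by (simp add: inner_commute)
  have zero: "(R *v fst b, R *v snd b) = (0, 0)" if b: "b \<in> B" for b
  proof (rule ccontr)
    assume nz: "(R *v fst b, R *v snd b) \<noteq> (0, 0)"
    have le: "c \<bullet> T c \<le> 0" if "c \<in> B" for c
      using neg[OF that] q[of c] by (cases "(R *v fst c, R *v snd c) = (0, 0)") auto
    have "(\<Sum>c\<in>B. c \<bullet> T c) < (\<Sum>c\<in>B. 0)"
      by (rule sum_strict_mono_ex1) (use B(1) le neg[OF b nz] b in auto)
    with sum show False by simp
  qed
  have "(R *v fst p, R *v snd p) = (0, 0)" for p :: "(real^'k) \<times> (real^'k)"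
  proof (rule linear_eq_on[of "\<lambda>p. (R *v fst p, R *v snd p)" "\<lambda>p. (0, 0)" p B])
    show "linear (\<lambda>p. (R *v fst p, R *v snd p))"
      by (auto intro!: linearI simp: matrix_vector_right_distrib matrix_vector_mult_scaleR)
    show "linear (\<lambda>p. (0, 0))" by (auto intro!: linearI)
  qed (use B zero in auto)
  then have "R *v x = 0 *v x" for x by (metis fst_conv matrix_vector_mult_0)
  then have "R = 0" by (simp add: matrix_eq)
  then show ?thesis using R(2) by simp
qed

text \<open>
  The set \<open>K'\<close> consists of the values of the dual constraints on positive semidefinite \<open>Z\<close> and a slack variable
  \<open>t\<close>, normalized by \<open>trace Z + t = 1\<close>. By the preceding lemma it does not contain zero, and a
  hyperplane that separates zero from the convex hull of the rank one values and the slack direction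
  yields \<open>P\<close>.
\<close>

theorem kyp:
  fixes X H :: "real^'k^'N" and \<Theta> :: "real^'k^'k"
  assumes fin: "\<And>a b \<omega>. (a, b) \<noteq> (0, 0) \<Longrightarrow> H *v a = - \<omega> *\<^sub>R (X *v b) \<Longrightarrow> H *v b = \<omega> *\<^sub>R (X *v a) \<Longrightarrow>
      a \<bullet> (\<Theta> *v a) + b \<bullet> (\<Theta> *v b) < 0"
    and inf: "\<And>a. a \<noteq> 0 \<Longrightarrow> X *v a = 0 \<Longrightarrow> a \<bullet> (\<Theta> *v a) < 0"
  obtains P where "P \<in> sym_mats" "\<And>v. v \<noteq> 0 \<Longrightarrow> 2 * ((X *v v) \<bullet> (P *v (H *v v))) + v \<bullet> (\<Theta> *v v) < 0"
proof -
  define L where "L = (\<lambda>Z. (X ** Z ** transpose H + H ** Z ** transpose X, Z \<bullet> \<Theta>))"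
  define S where "S = (\<lambda>v. L (outer v v)) ` sphere 0 1"
  define K where "K = convex hull (insert (0, -1) S)"
  define K' where "K' = {L Z + (0, - t) | Z t. pos_semidef Z \<and> 0 \<le> t \<and> trace Z + t = 1}"
  have Lo: "L (outer v v) = (outer (X *v v) (H *v v) + outer (H *v v) (X *v v), v \<bullet> (\<Theta> *v v))" for v
    by (simp add: L_def outer_mult inner_commute[of _ \<Theta>] inner_outer)
  have "compact S" unfolding S_def Lo
    by (intro compact_continuous_image continuous_intros compact_sphere
        bounded_bilinear.continuous_on[OF bounded_bilinear_outer]
        bounded_bilinear.continuous_on[OF bounded_bilinear_matrix_vector_mult])
  then have K: "convex K" "closed K"
    by (auto simp: K_def compact_convex_hull compact_imp_closed)
  have L: "L (c *\<^sub>R M + d *\<^sub>R N) = c *\<^sub>R L M + d *\<^sub>R L N" for c d M N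
    by (simp add: L_def matrix_mult_bilinear inner_add_left scaleR_add_right)
  have "convex K'"
  proof (rule convexI)
    fix x y and u v :: real
    assume "x \<in> K'" "y \<in> K'" and uv: "0 \<le> u" "0 \<le> v" "u + v = 1"
    then obtain Z1 t1 Z2 t2 where *: "x = L Z1 + (0, - t1)" "pos_semidef Z1" "0 \<le> t1" "trace Z1 + t1 = 1"
        "y = L Z2 + (0, - t2)" "pos_semidef Z2" "0 \<le> t2" "trace Z2 + t2 = 1"
      by (auto simp: K'_def)
    have "u *\<^sub>R x + v *\<^sub>R y = L (u *\<^sub>R Z1 + v *\<^sub>R Z2) + (0, - (u * t1 + v * t2))"
      unfolding L * by (simp add: algebra_simps)
    moreover have "trace (u *\<^sub>R Z1 + v *\<^sub>R Z2) + (u * t1 + v * t2) = u * (trace Z1 + t1) + v *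
        (trace Z2 + t2)"
      by (simp add: trace_add trace_scaleR algebra_simps)
    then have "trace (u *\<^sub>R Z1 + v *\<^sub>R Z2) + (u * t1 + v * t2) = 1" using * uv by simp
    ultimately show "u *\<^sub>R x + v *\<^sub>R y \<in> K'"
      unfolding K'_def using * uv by (blast intro: pos_semidef_add pos_semidef_scaleR
          add_nonneg_nonneg mult_nonneg_nonneg)
  qed
  moreover have "S \<subseteq> K'"
  proof
    fix x assume "x \<in> S"
    then obtain v where v: "norm v = 1" "x = L (outer v v)" by (auto simp: S_def)
    have "x = L (outer v v) + (0, - 0)" "trace (outer v v) + 0 = 1"
      using v by (simp_all add: trace_outer dot_square_norm flip: zero_prod_def)
    then show "x \<in> K'" unfolding K'_def using pos_semidef_outer by blast
  qed
  moreover have "(0, -1) = L 0 + (0, - 1)" "trace (0 :: real^'k^'k) + 1 = 1" by (simp_all add: L_def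
      trace_zero)
  then have "(0, -1) \<in> K'" unfolding K'_def using pos_semidef_0 by (smt (verit) mem_Collect_eq)
  ultimately have sub: "K \<subseteq> K'" unfolding K_def by (intro hull_minimal) auto
  have "0 \<notin> K'"
  proof
    assume "0 \<in> K'"
    then obtain Z t where Z: "L Z + (0, - t) = 0" "pos_semidef Z" "0 \<le> t" "trace Z + t = 1"
      by (auto simp: K'_def)
    then have "X ** Z ** transpose H + H ** Z ** transpose X = 0" "Z \<bullet> \<Theta> = t"
      by (auto simp: L_def zero_prod_def)
    moreover from this have "Z = 0" using kyp_dual[of H X \<Theta> Z] fin inf Z by auto
    ultimately show False using Z by (simp add: trace_zero)
  qed
  then have "0 \<notin> K" using sub by blast
  then obtain a b where ab: "0 < b" "\<And>x. x \<in> K \<Longrightarrow> b < a \<bullet> x"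
    using separating_hyperplane_closed_0[OF K] by metis
  define P' where "P' = fst a"
  define \<alpha> where "\<alpha> = snd a"
  have a: "a = (P', \<alpha>)" by (simp add: P'_def \<alpha>_def)
  (* the generator (0, -1) of K fixes the sign of the last component of the normal *)
  have "b < a \<bullet> (0, -1)" by (rule ab(2)) (simp add: K_def hull_inc)
  then have \<alpha>: "\<alpha> < 0" using ab(1) by (simp add: a)
  define P where "P = (1 / (2 * \<alpha>)) *\<^sub>R (P' + transpose P')"
  have "P \<in> sym_mats" by (simp add: sym_mats_def P_def transpose_scalar transpose_add add.commute)
  moreover have unit: "2 * ((X *v v) \<bullet> (P *v (H *v v))) + v \<bullet> (\<Theta> *v v) < 0" if v: "norm v = 1" for v
  proof -
    have "b < a \<bullet> L (outer v v)" by (rule ab(2)) (use v in \<open>auto simp: K_def S_def intro!: hull_inc\<close>)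
    then have "0 < (X *v v) \<bullet> (P' *v (H *v v)) + (H *v v) \<bullet> (P' *v (X *v v)) + \<alpha> * (v \<bullet> (\<Theta> *v v))"
      using ab(1) by (simp add: a Lo inner_add_right inner_outer)
    also have "(H *v v) \<bullet> (P' *v (X *v v)) = (X *v v) \<bullet> (transpose P' *v (H *v v))"
      by (simp add: inner_matrix_vector inner_commute)
    also have "(X *v v) \<bullet> (P' *v (H *v v)) + (X *v v) \<bullet> (transpose P' *v (H *v v)) = \<alpha> * (2 * ((X *v
        v) \<bullet> (P *v (H *v v))))"
      using \<alpha> by (simp add: P_def matrix_vector_mult_add_rdistrib inner_add_right field_simps
          del: transpose_matrix_vector flip: scaleR_matrix_vector_assoc)
    finally have "0 < \<alpha> * (2 * ((X *v v) \<bullet> (P *v (H *v v))) + v \<bullet> (\<Theta> *v v))" by (simp add: algebra_simps)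
    then show ?thesis using \<alpha> by (simp add: zero_less_mult_iff)
  qed
  have "2 * ((X *v v) \<bullet> (P *v (H *v v))) + v \<bullet> (\<Theta> *v v) < 0" if "v \<noteq> 0" for v
  proof -
    define w where "w = (1 / norm v) *\<^sub>R v"
    have w: "norm w = 1" "v = norm v *\<^sub>R w" using that by (simp_all add: w_def)
    have "2 * ((X *v v) \<bullet> (P *v (H *v v))) + v \<bullet> (\<Theta> *v v) =
        (norm v)\<^sup>2 * (2 * ((X *v w) \<bullet> (P *v (H *v w))) + w \<bullet> (\<Theta> *v w))"
      by (subst (1 2 3 4) w(2)) (simp add: matrix_vector_mult_scaleR power2_eq_square algebra_simps)
    then show ?thesis using unit[OF w(1)] that by (simp add: mult_less_0_iff)
  qed
  ultimately show thesis using that by blast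
qed


section \<open>Hurwitz matrices and Lyapunov's theorem\<close>

text \<open>The vector \<open>p(A) v\<close> for a polynomial \<open>p\<close>.\<close>

definition poly_apply :: "complex^'n^'n \<Rightarrow> complex^'n \<Rightarrow> complex poly \<Rightarrow> complex^'n"
  where "poly_apply A v p = fold_coeffs (\<lambda>a w. a *s v + A *v w) p 0"

lemma poly_apply_0 [simp]: "poly_apply A v 0 = 0"
  by (simp add: poly_apply_def)

lemma poly_apply_pCons [simp]: "poly_apply A v (pCons a p) = a *s v + A *v poly_apply A v p"
  by (cases "a = 0 \<and> p = 0") (auto simp: poly_apply_def)

lemma poly_apply_add: "poly_apply A v (p + q) = poly_apply A v p + poly_apply A v q"
  by (induction p q rule: poly_induct2) (simp_all add: matrix_vector_right_distrib
      vector_sadd_rdistrib algebra_simps)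

lemma cmatrix_vector_mult_smult: "A *v (c *s x) = c *s (A *v x)" for A :: "complex^'a^'b"
  by (simp add: matrix_vector_mult_def vec_eq_iff sum_distrib_left mult_ac)

lemma poly_apply_smult: "poly_apply A v (smult c p) = c *s poly_apply A v p"
  by (induction p) (simp_all add: cmatrix_vector_mult_smult vector_add_ldistrib vector_smult_assoc)

lemma poly_apply_sum: "poly_apply A v (\<Sum>i\<in>I. f i) = (\<Sum>i\<in>I. poly_apply A v (f i))"
  by (induction I rule: infinite_finite_induct) (simp_all add: poly_apply_add)

text \<open>A nonzero polynomial \<open>p\<close> of least degree with \<open>p(A) v = 0\<close> has a linear factor, and its cofactor
  applied to \<open>v\<close> is an eigenvector. Such a \<open>p\<close> exists as the vectors \<open>A\<^sup>i v\<close> are linearly dependent; real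
  coefficients already suffice for that.\<close>

lemma eigenvector_in_invariant_subspace:
  fixes A :: "complex^'n^'n"
  assumes v: "v \<in> S" "v \<noteq> 0"
    and add: "\<And>x y. x \<in> S \<Longrightarrow> y \<in> S \<Longrightarrow> x + y \<in> S"
    and smult: "\<And>c x. x \<in> S \<Longrightarrow> c *s x \<in> S"
    and inv: "\<And>x. x \<in> S \<Longrightarrow> A *v x \<in> S"
  shows "\<exists>w\<in>S. w \<noteq> 0 \<and> (\<exists>c. A *v w = c *s w)"
proof -
  let ?f = "poly_apply A v"
  have S0: "0 \<in> S" using smult[OF v(1), of 0] by simp
  have fS: "?f p \<in> S" for p
    by (induction p) (auto simp: S0 intro!: add smult inv v)
  define u where "u = (\<lambda>i. ?f (monom 1 i))"
  define N where "N = DIM(complex^'n)"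
  have "\<exists>p :: complex poly. p \<noteq> 0 \<and> ?f p = 0"
  proof (cases "inj_on u {..N}")
    case False
    then obtain i j where ij: "u i = u j" "i \<noteq> j" by (auto simp: inj_on_def)
    have "monom 1 i + smult (-1) (monom 1 j) \<noteq> (0 :: complex poly)"
    proof
      assume "monom 1 i + smult (-1) (monom 1 j) = (0 :: complex poly)"
      then have "coeff (monom 1 i + smult (-1) (monom 1 j) :: complex poly) i = 0" by simp
      then show False using ij by simp
    qed
    moreover have "?f (monom 1 i + smult (-1) (monom 1 j)) = 0"
      unfolding poly_apply_add poly_apply_smult using ij(1) by (simp add: u_def)
    ultimately show ?thesis by blast
  next
    case True
    then have "card (u ` {..N}) = Suc N" by (simp add: card_image)
    then have "dependent (u ` {..N})" by (intro dependent_biggerset) (auto simp: N_def)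
    then obtain c x where c: "x \<in> u ` {..N}" "c x \<noteq> 0" "(\<Sum>y\<in>u ` {..N}. c y *\<^sub>R y) = 0"
      by (auto simp: dependent_finite)
    then obtain k where k: "k \<le> N" "c (u k) \<noteq> 0" by auto
    define p :: "complex poly" where "p = (\<Sum>i\<le>N. smult (of_real (c (u i))) (monom 1 i))"
    have "coeff p k = of_real (c (u k))"
    proof -
      have "coeff p k = (\<Sum>i\<le>N. if i = k then of_real (c (u i)) else 0)"
        unfolding p_def coeff_sum by (rule sum.cong) auto
      then show ?thesis using k by simp
    qed
    then have "p \<noteq> 0" using k by auto
    moreover have "?f p = (\<Sum>i\<le>N. c (u i) *\<^sub>R u i)"
      unfolding p_def poly_apply_sum poly_apply_smult u_def
      by (rule sum.cong) (simp_all add: vec_eq_iff, simp add: scaleR_conv_of_real)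
    then have "?f p = 0" using c(3) True by (simp add: sum.reindex)
    ultimately show ?thesis by blast
  qed
  then obtain p where p: "p \<noteq> 0 \<and> ?f p = 0" and least: "\<And>q. q \<noteq> 0 \<and> ?f q = 0 \<Longrightarrow> degree p \<le> degree q"
    using ex_has_least_nat[of "\<lambda>p. p \<noteq> 0 \<and> ?f p = 0" _ degree] by blast
  have "degree p \<noteq> 0"
  proof
    assume "degree p = 0"
    then obtain a where "p = [:a:]" by (rule degree_eq_zeroE)
    then have "a \<noteq> 0" "a *s v = 0" using p by auto
    then show False using v(2) by (auto simp: vec_eq_iff)
  qed
  then have "\<not> constant (poly p)" by (simp add: constant_degree)
  then obtain z where "poly p z = 0" using fundamental_theorem_of_algebra by blast
  then obtain q where q: "p = [:- z, 1:] * q" by (auto simp: poly_eq_0_iff_dvd)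
  have q0: "q \<noteq> 0" using p q by auto
  then have "degree p = Suc (degree q)" unfolding q by (subst degree_mult_eq) auto
  then have "?f q \<noteq> 0" using least[of q] q0 by auto
  moreover have "smult (- z) q + pCons 0 q = p" by (simp add: q)
  then have "?f (smult (- z) q + pCons 0 q) = 0" using p by metis
  then have "(- z) *s ?f q + (0 *s v + A *v ?f q) = 0"
    unfolding poly_apply_add poly_apply_smult poly_apply_pCons .
  then have "A *v ?f q = z *s ?f q" by (simp add: vec_eq_iff algebra_simps)
  ultimately show ?thesis using fS by blast
qed

text \<open>The complex vector with real part \<open>a\<close> and imaginary part \<open>b\<close>.\<close>

definition complex_vec :: "real^'n \<Rightarrow> real^'n \<Rightarrow> complex^'n"
  where "complex_vec a b = (\<chi> i. Complex (a $ i) (b $ i))"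

lemma complex_vec_cases: obtains a b where "v = complex_vec a b"
proof
  show "v = complex_vec (\<chi> i. Re (v $ i)) (\<chi> i. Im (v $ i))"
    by (simp add: complex_vec_def vec_eq_iff complex_eq_iff)
qed

lemma complex_vec_eq_iff: "complex_vec a b = complex_vec c d \<longleftrightarrow> a = c \<and> b = d"
  by (auto simp: complex_vec_def vec_eq_iff)

lemma complex_vec_0: "complex_vec 0 0 = 0"
  by (simp add: complex_vec_def vec_eq_iff complex_eq_iff)

lemma complex_vec_eq_0_iff: "complex_vec a b = 0 \<longleftrightarrow> a = 0 \<and> b = 0"
  using complex_vec_eq_iff[of a b 0 0] by (simp add: complex_vec_0)

lemma complex_vec_add: "complex_vec a b + complex_vec c d = complex_vec (a + c) (b + d)"
  by (simp add: complex_vec_def vec_eq_iff complex_eq_iff)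

lemma complex_vec_diff: "complex_vec a b - complex_vec c d = complex_vec (a - c) (b - d)"
  by (simp add: complex_vec_def vec_eq_iff complex_eq_iff)

lemma complex_vec_smult:
  "z *s complex_vec a b = complex_vec (Re z *\<^sub>R a - Im z *\<^sub>R b) (Re z *\<^sub>R b + Im z *\<^sub>R a)"
  by (simp add: complex_vec_def vec_eq_iff complex_eq_iff)

lemma cmat_complex_vec: "cmat M *v complex_vec a b = complex_vec (M *v a) (M *v b)"
  by (simp add: complex_vec_def matrix_vector_mult_def vec_eq_iff complex_eq_iff map_matrix_def)

lemma norm_complex_vec: "(norm (complex_vec a b))\<^sup>2 = a \<bullet> a + b \<bullet> b"
proof -
  have "(cmod (Complex x y))\<^sup>2 = x * x + y * y" for x y
    unfolding cmod_power2 by (simp add: power2_eq_square)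
  then show ?thesis
    by (simp add: complex_vec_def norm_vec_def L2_set_def sum_nonneg inner_vec_def sum.distrib)
qed

lemma hurwitz_real:
  "hurwitz A \<longleftrightarrow> (\<forall>a b \<alpha> \<omega>. (a, b) \<noteq> (0, 0) \<longrightarrow> A *v a = \<alpha> *\<^sub>R a - \<omega> *\<^sub>R b \<longrightarrow> A *v b = \<alpha> *\<^sub>R b + \<omega> *\<^sub>R a
      \<longrightarrow> \<alpha> < 0)"
  (is "_ = ?R")
proof
  assume h: "hurwitz A"
  show ?R
  proof (intro allI impI)
    fix a b \<alpha> \<omega>
    assume "(a, b) \<noteq> (0, 0)" "A *v a = \<alpha> *\<^sub>R a - \<omega> *\<^sub>R b" "A *v b = \<alpha> *\<^sub>R b + \<omega> *\<^sub>R a"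
    then have "complex_vec a b \<noteq> 0" "cmat A *v complex_vec a b = Complex \<alpha> \<omega> *s complex_vec a b"
      by (auto simp: complex_vec_eq_0_iff cmat_complex_vec complex_vec_smult)
    then have "Re (Complex \<alpha> \<omega>) < 0" using h unfolding hurwitz_def by blast
    then show "\<alpha> < 0" by simp
  qed
next
  assume R: ?R
  show "hurwitz A" unfolding hurwitz_def
  proof (intro allI impI)
    fix z v assume v: "v \<noteq> 0 \<and> cmat A *v v = z *s v"
    obtain a b where ab: "v = complex_vec a b" by (rule complex_vec_cases)
    show "Re z < 0"
      by (rule R[rule_format, of a b _ "Im z"])
         (use v in \<open>auto simp: ab complex_vec_eq_0_iff cmat_complex_vec complex_vec_smult
             complex_vec_eq_iff\<close>)
  qed
qed

text \<open>The kernel of \<open>Z\<close> is invariant under \<open>A\<^sup>T\<close>, hence its range under \<open>A\<close>. An eigenvector \<open>Z v\<close> of \<open>A\<close> in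
  the complexified range would have an eigenvalue of nonnegative real part.\<close>

lemma hurwitz_dual:
  assumes A: "hurwitz (A :: real^'n^'n)" and Z: "pos_semidef Z" and M: "pos_semidef (A ** Z + Z **
      transpose A)"
  shows "Z = 0"
proof (rule ccontr)
  assume "Z \<noteq> 0"
  then obtain e where e: "Z *v e \<noteq> 0" by (metis matrix_eq matrix_vector_mult_0)
  have Zs: "x \<bullet> (Z *v y) = (Z *v x) \<bullet> y" for x y using Z by (simp add: pos_semidef_def sym_mats_iff)
  have Mq: "x \<bullet> ((A ** Z + Z ** transpose A) *v x) = 2 * (x \<bullet> (A *v (Z *v x)))" for x
  proof -
    have "x \<bullet> (Z *v (transpose A *v x)) = x \<bullet> (A *v (Z *v x))"
      unfolding Zs[of x "transpose A *v x"] inner_matrix_vector[of x A "Z *v x"] by (rule inner_commute)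
    then show ?thesis by (simp only: matrix_vector_mult_add_rdistrib inner_add_right
        matrix_vector_mul_assoc[symmetric])
  qed
  have ker: "Z *v (transpose A *v y) = 0" if y: "Z *v y = 0" for y
  proof -
    have "(A ** Z + Z ** transpose A) *v y = 0"
      by (rule pos_semidef_zero[OF M]) (simp add: Mq y)
    then show ?thesis
      by (simp only: matrix_vector_mult_add_rdistrib matrix_vector_mul_assoc[symmetric] y) simp
  qed
  have range: "\<exists>y. A *v (Z *v x) = Z *v y" for x
  proof -
    obtain y z where yz: "y \<in> span (range ((*v) Z))" "\<And>w. w \<in> span (range ((*v) Z)) \<Longrightarrow> orthogonal z w"
        "A *v (Z *v x) = y + z"
      using orthogonal_subspace_decomp_exists[of "range ((*v) Z)"] by metis
    have "z \<bullet> (Z *v (Z *v z)) = 0" using yz(2)[OF span_base[OF rangeI]] by (simp add: orthogonal_def)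
    then have "(Z *v z) \<bullet> (Z *v z) = 0" by (simp only: Zs[of z "Z *v z", symmetric])
    then have Zz: "Z *v z = 0" by simp
    have "z \<bullet> (A *v (Z *v x)) = (Z *v (transpose A *v z)) \<bullet> x"
      by (simp only: inner_matrix_vector[of _ A] Zs)
    then have "z \<bullet> z = 0" using ker[OF Zz] yz(1) yz(2)[OF yz(1)]
      by (simp add: yz(3) inner_add_right orthogonal_def)
    then have "A *v (Z *v x) = y" using yz(3) by simp
    moreover have "subspace (range ((*v) Z))" by (intro linear_subspace_image subspace_UNIV) simp
    then have "y \<in> range ((*v) Z)" using yz(1) by (simp add: span_eq_iff[THEN iffD2])
    ultimately show ?thesis by auto
  qed
  define S where "S = {complex_vec (Z *v x) (Z *v y) | x y. True}"
  have "\<exists>w\<in>S. w \<noteq> 0 \<and> (\<exists>c. cmat A *v w = c *s w)"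
  proof (rule eigenvector_in_invariant_subspace)
    show "complex_vec (Z *v e) (Z *v e) \<in> S" by (auto simp: S_def)
    show "complex_vec (Z *v e) (Z *v e) \<noteq> 0" using e by (simp add: complex_vec_eq_0_iff)
    show "x + y \<in> S" if "x \<in> S" "y \<in> S" for x y
    proof -
      from that obtain a b c d where "x = complex_vec (Z *v a) (Z *v b)" "y = complex_vec (Z *v c)
          (Z *v d)"
        by (auto simp: S_def)
      then have "x + y = complex_vec (Z *v (a + c)) (Z *v (b + d))"
        by (simp add: complex_vec_add matrix_vector_right_distrib)
      then show ?thesis by (auto simp: S_def)
    qed
    show "c *s x \<in> S" if "x \<in> S" for c x
    proof -
      from that obtain a b where "x = complex_vec (Z *v a) (Z *v b)" by (auto simp: S_def)
      then have "c *s x = complex_vec (Z *v (Re c *\<^sub>R a - Im c *\<^sub>R b)) (Z *v (Re c *\<^sub>R b + Im c *\<^sub>R a))"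
        by (simp add: complex_vec_smult matrix_vector_bilinear)
      then show ?thesis unfolding S_def by blast
    qed
    show "cmat A *v x \<in> S" if "x \<in> S" for x
    proof -
      from that obtain a b where x: "x = complex_vec (Z *v a) (Z *v b)" by (auto simp: S_def)
      obtain a' b' where "A *v (Z *v a) = Z *v a'" "A *v (Z *v b) = Z *v b'" using range by blast
      then have "cmat A *v x = complex_vec (Z *v a') (Z *v b')" by (simp add: x cmat_complex_vec)
      then show ?thesis unfolding S_def by blast
    qed
  qed
  then obtain x y c where w: "complex_vec (Z *v x) (Z *v y) \<noteq> 0"
      "cmat A *v complex_vec (Z *v x) (Z *v y) = c *s complex_vec (Z *v x) (Z *v y)"
    by (auto simp: S_def)
  then have "Re c < 0" using A unfolding hurwitz_def by blast
  have eqs: "A *v (Z *v x) = Re c *\<^sub>R (Z *v x) - Im c *\<^sub>R (Z *v y)" "A *v (Z *v y) = Re c *\<^sub>R (Z *v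
      y) + Im c *\<^sub>R (Z *v x)"
    using w(2) by (auto simp: cmat_complex_vec complex_vec_smult complex_vec_eq_iff)
  have "0 \<le> x \<bullet> ((A ** Z + Z ** transpose A) *v x)" "0 \<le> y \<bullet> ((A ** Z + Z ** transpose A) *v y)"
    using M unfolding pos_semidef_def by blast+
  then have "0 \<le> x \<bullet> (A *v (Z *v x)) + y \<bullet> (A *v (Z *v y))" unfolding Mq by linarith
  moreover have xy: "x \<bullet> (Z *v y) = y \<bullet> (Z *v x)" unfolding Zs[of x y] by (rule inner_commute)
  ultimately have "0 \<le> x \<bullet> (A *v (Z *v x)) + y \<bullet> (A *v (Z *v y))" by simp
  also have "\<dots> = Re c * (x \<bullet> (Z *v x) + y \<bullet> (Z *v y))"
    unfolding eqs by (simp add: inner_add_right inner_diff_right xy algebra_simps)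
  finally have "x \<bullet> (Z *v x) + y \<bullet> (Z *v y) \<le> 0"
    using \<open>Re c < 0\<close> by (simp add: zero_le_mult_iff)
  moreover have "0 \<le> x \<bullet> (Z *v x)" "0 \<le> y \<bullet> (Z *v y)" using Z by (auto simp: pos_semidef_def)
  ultimately have "x \<bullet> (Z *v x) = 0" "y \<bullet> (Z *v y) = 0" by linarith+
  then have "Z *v x = 0" "Z *v y = 0" using pos_semidef_zero[OF Z] by auto
  then show False using w(1) by (simp add: complex_vec_0)
qed

text \<open>Lyapunov's theorem by duality: if no such \<open>P\<close> existed, zero would be a convex combination of the
  constraint matrices, which the preceding lemma excludes.\<close>

lemma lyapunov_exists:
  assumes A: "hurwitz (A :: real^'n^'n)"
  obtains P where "pos_def P" "\<And>x. x \<noteq> 0 \<Longrightarrow> x \<bullet> (P *v (A *v x)) < 0"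
proof -
  define L where "L = (\<lambda>Z. A ** Z + Z ** transpose A)"
  define S1 where "S1 = (\<lambda>v::real^'n. outer v v) ` sphere 0 1"
  define S2 where "S2 = (\<lambda>v. - L (outer v v)) ` sphere 0 1"
  define K where "K = convex hull (S1 \<union> S2)"
  define K' where "K' = {Y - L Z | Y Z. pos_semidef Y \<and> pos_semidef Z \<and> trace Y + trace Z = 1}"
  have Lo: "L (outer v v) = outer (A *v v) v + outer v (A *v v)" for v
    unfolding L_def using outer_mult[of A v v "mat 1"] outer_mult[of "mat 1" v v A] by simp
  have "compact S1" "compact S2" unfolding S1_def S2_def Lo
    by (intro compact_continuous_image continuous_intros compact_sphere
        bounded_bilinear.continuous_on[OF bounded_bilinear_outer]
        bounded_bilinear.continuous_on[OF bounded_bilinear_matrix_vector_mult])+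
  then have K: "convex K" "closed K"
    by (auto simp: K_def compact_convex_hull compact_imp_closed compact_Un)
  have L: "L (c *\<^sub>R M + d *\<^sub>R N) = c *\<^sub>R L M + d *\<^sub>R L N" for c d M N
    by (simp add: L_def matrix_mult_bilinear scaleR_add_right)
  have "convex K'"
  proof (rule convexI)
    fix x y and u v :: real
    assume "x \<in> K'" "y \<in> K'" and uv: "0 \<le> u" "0 \<le> v" "u + v = 1"
    then obtain Z1 Y1 Z2 Y2 where *: "x = Y1 - L Z1" "pos_semidef Z1" "pos_semidef Y1" "trace Y1 +
        trace Z1 = 1"
        "y = Y2 - L Z2" "pos_semidef Z2" "pos_semidef Y2" "trace Y2 + trace Z2 = 1"
      by (auto simp: K'_def)
    have "u *\<^sub>R x + v *\<^sub>R y = (u *\<^sub>R Y1 + v *\<^sub>R Y2) - L (u *\<^sub>R Z1 + v *\<^sub>R Z2)"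
      unfolding L * by (simp add: algebra_simps)
    moreover have "trace (u *\<^sub>R Y1 + v *\<^sub>R Y2) + trace (u *\<^sub>R Z1 + v *\<^sub>R Z2) = u * (trace Y1 + trace
        Z1) + v * (trace Y2 + trace Z2)"
      by (simp add: trace_add trace_scaleR algebra_simps)
    then have "trace (u *\<^sub>R Y1 + v *\<^sub>R Y2) + trace (u *\<^sub>R Z1 + v *\<^sub>R Z2) = 1" using * uv by simp
    ultimately show "u *\<^sub>R x + v *\<^sub>R y \<in> K'"
      unfolding K'_def using * uv by (blast intro: pos_semidef_add pos_semidef_scaleR)
  qed
  moreover have "S1 \<subseteq> K'"
  proof
    fix x assume "x \<in> S1"
    then obtain v where v: "norm v = 1" "x = outer v v" by (auto simp: S1_def)
    have "x = outer v v - L 0" "trace (outer v v) + trace (0 :: real^'n^'n) = 1"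
      using v by (simp_all add: trace_outer dot_square_norm L_def trace_zero)
    then show "x \<in> K'" unfolding K'_def using pos_semidef_outer pos_semidef_0 by blast
  qed
  moreover have "S2 \<subseteq> K'"
  proof
    fix x assume "x \<in> S2"
    then obtain v where v: "norm v = 1" "x = - L (outer v v)" by (auto simp: S2_def)
    have "x = 0 - L (outer v v)" "trace (0 :: real^'n^'n) + trace (outer v v) = 1"
      using v by (simp_all add: trace_outer dot_square_norm trace_zero)
    then show "x \<in> K'" unfolding K'_def using pos_semidef_outer pos_semidef_0 by blast
  qed
  ultimately have sub: "K \<subseteq> K'" unfolding K_def by (intro hull_minimal) auto
  have "0 \<notin> K'"
  proof
    assume "0 \<in> K'"
    then obtain Y Z where Z: "Y = L Z" "pos_semidef Y" "pos_semidef Z" "trace Y + trace Z = 1"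
      by (auto simp: K'_def)
    then have "Z = 0" using hurwitz_dual[OF A, of Z] by (simp add: L_def)
    then show False using Z by (simp add: trace_zero L_def)
  qed
  then have "0 \<notin> K" using sub by blast
  then obtain P' b where ab: "0 < b" "\<And>x. x \<in> K \<Longrightarrow> b < P' \<bullet> x"
    using separating_hyperplane_closed_0[OF K] by metis
  define P where "P = P' + transpose P'"
  have Pq: "x \<bullet> (P *v y) = x \<bullet> (P' *v y) + y \<bullet> (P' *v x)" for x y
    by (simp add: P_def matrix_vector_mult_add_rdistrib inner_add_right inner_matrix_vector[of y P']
        inner_commute)
  have unit: "0 < v \<bullet> (P *v v) \<and> v \<bullet> (P *v (A *v v)) < 0" if v: "norm v = 1" for v
  proof
    have "b < P' \<bullet> outer v v" by (rule ab(2)) (use v in \<open>auto simp: K_def S1_def intro!: hull_inc\<close>)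
    then show "0 < v \<bullet> (P *v v)" using ab(1) by (simp add: Pq inner_outer)
    have "b < P' \<bullet> (- L (outer v v))" by (rule ab(2)) (use v in \<open>auto simp: K_def S2_def intro!:
        hull_inc\<close>)
    then show "v \<bullet> (P *v (A *v v)) < 0" using ab(1) by (simp add: Pq inner_outer Lo inner_add_right
        inner_diff_right)
  qed
  have "0 < v \<bullet> (P *v v) \<and> v \<bullet> (P *v (A *v v)) < 0" if "v \<noteq> 0" for v
  proof -
    define w where "w = (1 / norm v) *\<^sub>R v"
    have w: "norm w = 1" "v = norm v *\<^sub>R w" using that by (simp_all add: w_def)
    have "v \<bullet> (P *v v) = (norm v)\<^sup>2 * (w \<bullet> (P *v w))" "v \<bullet> (P *v (A *v v)) = (norm v)\<^sup>2 * (w \<bullet> (P *v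
        (A *v w)))"
      by (subst (1 2) w(2), simp add: matrix_vector_mult_scaleR power2_eq_square algebra_simps)+
    then show ?thesis using unit[OF w(1)] that by (simp add: mult_less_0_iff)
  qed
  moreover have "P \<in> sym_mats" by (simp add: sym_mats_def P_def transpose_add add.commute)
  ultimately show thesis using that by (auto simp: pos_def_def)
qed

text \<open>
  Let \<open>P0\<close> be a positive definite solution and \<open>\<mu>\<close> the minimum of the quotient of the forms of \<open>P\<close> and \<open>P0\<close>. If
  \<open>\<mu> \<le> 0\<close>, then \<open>P - \<mu> P0\<close> solves the same strict inequality, but it is singular at the minimiser.
\<close>

lemma lyapunov_pos_def:
  assumes A: "hurwitz (A :: real^'n^'n)" and P: "P \<in> sym_mats"
    and neg: "\<And>x. x \<noteq> 0 \<Longrightarrow> x \<bullet> (P *v (A *v x)) < 0"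
  shows "pos_def P"
proof (rule ccontr)
  assume "\<not> pos_def P"
  then obtain x0 where x0: "x0 \<noteq> 0" "x0 \<bullet> (P *v x0) \<le> 0" using P by (auto simp: pos_def_def not_less)
  obtain P0 where P0: "pos_def P0" "\<And>x. x \<noteq> 0 \<Longrightarrow> x \<bullet> (P0 *v (A *v x)) < 0" using lyapunov_exists[OF
      A] by blast
  define r where "r = (\<lambda>x. (x \<bullet> (P *v x)) / (x \<bullet> (P0 *v x)))"
  have pos: "0 < x \<bullet> (P0 *v x)" if "x \<noteq> 0" for x using P0 that by (auto simp: pos_def_def)
  have "continuous_on (sphere 0 1) r" unfolding r_def
  proof (intro continuous_intros bounded_bilinear.continuous_on[OF
      bounded_bilinear_matrix_vector_mult] ballI)
    fix x :: "real^'n" assume "x \<in> sphere 0 1"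
    then have "x \<noteq> 0" by auto
    from pos[OF this] show "x \<bullet> (P0 *v x) \<noteq> 0" by simp
  qed
  moreover have "(1 / norm x0) *\<^sub>R x0 \<in> sphere 0 1" using x0 by simp
  then have "sphere 0 1 \<noteq> ({} :: (real^'n) set)" by blast
  ultimately obtain x where x: "norm x = 1" "\<And>y. norm y = 1 \<Longrightarrow> r x \<le> r y"
    using continuous_attains_inf[OF compact_sphere, of 0 1 r] by auto
  define \<mu> where "\<mu> = r x"
  have scale: "r (c *\<^sub>R y) = r y" if "c \<noteq> 0" for c y
    using that by (simp add: r_def matrix_vector_mult_scaleR)
  have le: "\<mu> \<le> r y" if "y \<noteq> 0" for y
    using x(2)[of "(1 / norm y) *\<^sub>R y"] that scale[of "1 / norm y" y] by (simp add: \<mu>_def)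
  have "\<mu> \<le> r x0" by (rule le) (rule x0)
  also have "r x0 \<le> 0" using x0 pos[OF x0(1)] by (simp add: r_def divide_le_0_iff)
  finally have \<mu>: "\<mu> \<le> 0" .
  define N where "N = P - \<mu> *\<^sub>R P0"
  have Nv: "N *v y = P *v y - \<mu> *\<^sub>R (P0 *v y)" for y by (simp add: N_def matrix_vector_bilinear)
  have "pos_semidef N" unfolding pos_semidef_def
  proof (intro conjI allI)
    show "N \<in> sym_mats" using P P0(1) by (simp add: pos_def_def sym_mats_iff Nv inner_diff_left
        inner_diff_right)
    fix y
    show "0 \<le> y \<bullet> (N *v y)"
    proof (cases "y = 0")
      case False
      then have "\<mu> * (y \<bullet> (P0 *v y)) \<le> y \<bullet> (P *v y)"
        using le[OF False] pos[OF False] by (simp add: r_def pos_le_divide_eq)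
      then show ?thesis by (simp add: Nv inner_diff_right)
    qed simp
  qed
  moreover have xn: "x \<noteq> 0" using x(1) by auto
  have "x \<bullet> (N *v x) = 0" using pos[OF xn] by (simp add: Nv inner_diff_right \<mu>_def r_def)
  ultimately have "N *v x = 0" by (rule pos_semidef_zero)
  moreover have "N \<in> sym_mats" using \<open>pos_semidef N\<close> by (simp add: pos_semidef_def)
  ultimately have "x \<bullet> (N *v (A *v x)) = 0" by (simp add: sym_mats_iff)
  moreover have "x \<bullet> (N *v (A *v x)) < 0"
  proof -
    have "0 \<le> \<mu> * (x \<bullet> (P0 *v (A *v x)))" using \<mu> P0(2)[OF xn] by (intro mult_nonpos_nonpos) auto
    then show ?thesis using neg[OF xn] by (simp add: Nv inner_diff_right)
  qed
  ultimately show False by simp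
qed


section \<open>Block vectors and block matrices\<close>

text \<open>The vector with blocks \<open>x\<close> and \<open>y\<close>, with the same index convention as for block matrices.\<close>

definition vjoin :: "'x^'a \<Rightarrow> 'x^'b \<Rightarrow> 'x^('a + 'b)"
  where "vjoin x y = (\<chi> i. case i of Inl a \<Rightarrow> x $ a | Inr b \<Rightarrow> y $ b)"

lemma sum_UNIV_Plus: "(\<Sum>i\<in>UNIV. f i) = (\<Sum>i\<in>UNIV. f (Inl i)) + (\<Sum>i\<in>UNIV. f (Inr i))"
  for f :: "'a::finite + 'b::finite \<Rightarrow> 'c::comm_monoid_add"
  unfolding UNIV_Plus_UNIV[symmetric] by (subst sum.Plus) auto

lemma all_sum_iff: "(\<forall>i. P i) \<longleftrightarrow> (\<forall>a. P (Inl a)) \<and> (\<forall>b. P (Inr b))"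
  by (metis sum.exhaust)

lemma vjoin_cases: obtains x y where "v = vjoin x y"
proof
  show "v = vjoin (\<chi> a. v $ Inl a) (\<chi> b. v $ Inr b)"
    by (simp add: vjoin_def vec_eq_iff all_sum_iff)
qed

lemma vjoin_eq_iff: "vjoin x y = vjoin z w \<longleftrightarrow> x = z \<and> y = w"
  by (simp add: vjoin_def vec_eq_iff all_sum_iff)

lemma vjoin_0: "vjoin 0 0 = 0"
  by (simp add: vjoin_def vec_eq_iff all_sum_iff)

lemma vjoin_eq_0_iff: "vjoin x y = 0 \<longleftrightarrow> x = 0 \<and> y = 0"
  using vjoin_eq_iff[of x y 0 0] by (simp add: vjoin_0)

lemma vjoin_add: "vjoin x y + vjoin z w = vjoin (x + z) (y + w)"
  by (simp add: vjoin_def vec_eq_iff all_sum_iff)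

lemma inner_vjoin: "vjoin x y \<bullet> vjoin z w = x \<bullet> z + y \<bullet> w"
  by (simp add: vjoin_def inner_vec_def sum_UNIV_Plus)

lemma hcat_vec: "(M <|> N) *v vjoin x y = M *v x + N *v y"
  by (simp add: vjoin_def hcat_def matrix_vector_mult_def vec_eq_iff sum_UNIV_Plus)

lemma vcat_vec: "(M </> N) *v z = vjoin (M *v z) (N *v z)"
  by (simp add: vjoin_def vcat_def matrix_vector_mult_def vec_eq_iff all_sum_iff)

lemma vcat_mult: "(M </> N) ** L = (M ** L </> N ** L)"
  by (simp add: vcat_def matrix_matrix_mult_def vec_eq_iff all_sum_iff)

lemma mult_hcat: "L ** (M <|> N) = (L ** M <|> L ** N)"
  by (simp add: hcat_def matrix_matrix_mult_def vec_eq_iff all_sum_iff)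

lemma hcat_mult_vcat: "(M <|> N) ** (K </> L) = M ** K + N ** L"
  by (simp add: hcat_def vcat_def matrix_matrix_mult_def vec_eq_iff sum_UNIV_Plus)

lemma transpose_hcat: "transpose (M <|> N) = (transpose M </> transpose N)"
  by (simp add: hcat_def vcat_def transpose_def vec_eq_iff all_sum_iff)

lemma transpose_vcat: "transpose (M </> N) = (transpose M <|> transpose N)"
  by (simp add: hcat_def vcat_def transpose_def vec_eq_iff all_sum_iff)

lemma hcat_add: "(M <|> N) + (K <|> L) = (M + K <|> N + L)"
  by (simp add: hcat_def vec_eq_iff all_sum_iff)

lemma vcat_add: "(M </> N) + (K </> L) = (M + K </> N + L)"
  by (simp add: vcat_def vec_eq_iff all_sum_iff)

lemma hcat_eq_iff: "(M <|> N) = (K <|> L) \<longleftrightarrow> M = K \<and> N = L"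
  by (auto simp: hcat_def vec_eq_iff all_sum_iff)

lemma vcat_eq_iff: "(M </> N) = (K </> L) \<longleftrightarrow> M = K \<and> N = L"
  by (auto simp: vcat_def vec_eq_iff all_sum_iff)

lemma blk_simps [simp]:
  "blk11 (K <|> L </> M <|> N) = K" "blk12 (K <|> L </> M <|> N) = L"
  "blk21 (K <|> L </> M <|> N) = M" "blk22 (K <|> L </> M <|> N) = N"
  by (simp_all add: blk11_def blk12_def blk21_def blk22_def hcat_def vcat_def vec_eq_iff)

lemma blk_collapse: "(blk11 M <|> blk12 M </> blk21 M <|> blk22 M) = M"
  by (simp add: blk11_def blk12_def blk21_def blk22_def hcat_def vcat_def vec_eq_iff all_sum_iff)

lemma mat_blocks: "(mat c <|> 0 </> 0 <|> mat c) = mat c"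
  by (simp add: hcat_def vcat_def mat_def vec_eq_iff all_sum_iff)

text \<open>The normal form used below stacks rows; transposition produces the other nesting.\<close>

lemma hcat_of_vcats: "((K </> M) <|> (L </> N)) = (K <|> L </> M <|> N)"
  by (simp add: hcat_def vcat_def vec_eq_iff all_sum_iff)

lemmas block_mult = vcat_mult mult_hcat hcat_mult_vcat

lemmas block_transpose = transpose_hcat transpose_vcat

lemma mat_vector: "mat c *v x = c *\<^sub>R x" for x :: "real^'n"
  by (simp add: mat_def matrix_vector_mult_def vec_eq_iff if_distrib[where f="\<lambda>a. a * _"] cong: if_cong)

lemma sym_blocks_iff: "(M <|> N </> K <|> L) \<in> sym_mats \<longleftrightarrow> M \<in> sym_mats \<and> L \<in> sym_mats \<and> K = transpose N"
proof -
  have "(M <|> N </> K <|> L) \<in> sym_mats \<longleftrightarrow> transpose M = M \<and> transpose K = N \<and> transpose N = K \<and>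
      transpose L = L"
    by (simp add: sym_mats_def block_transpose hcat_of_vcats vcat_eq_iff hcat_eq_iff)
  then show ?thesis by (auto simp: sym_mats_def)
qed

lemma neg_semidef_iff: "neg_semidef M \<longleftrightarrow> M \<in> sym_mats \<and> (\<forall>x. x \<bullet> (M *v x) \<le> 0)"
  by (auto simp: neg_semidef_def pos_semidef_def sym_mats_iff matrix_vector_bilinear)

lemma inner_transpose: "a \<bullet> (transpose N *v b) = b \<bullet> (N *v a)" for N :: "real^'a^'b"
  using inner_matrix_vector[of b N a] by (simp add: inner_commute)


section \<open>The bounded real lemma\<close>

text \<open>The quadratic form of the bounded real matrix at the vector with blocks \<open>x\<close>, \<open>u\<close>, \<open>y\<close>.\<close>

definition brl_form :: "real^'n^'n \<Rightarrow> real^'u^'n \<Rightarrow> real^'n^'y \<Rightarrow> real^'u^'y \<Rightarrow> real \<Rightarrow> real^'n^'n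
    \<Rightarrow> real^'n \<Rightarrow> real^'u \<Rightarrow> real^'y \<Rightarrow> real"
  where "brl_form A B C D \<gamma> P x u y = 2 * (x \<bullet> (P *v (A *v x + B *v u))) + 2 * (y \<bullet> (C *v x + D *v u))
    - \<gamma> * (u \<bullet> u) - \<gamma> * (y \<bullet> y)"

lemma brl_lmi_iff:
  fixes A :: "real^'n^'n" and B :: "real^'u^'n" and C :: "real^'n^'y" and D :: "real^'u^'y"
  assumes P: "P \<in> sym_mats"
  shows "neg_semidef (transpose A ** P + P ** A <|> P ** B <|> transpose C </>
           transpose B ** P <|> mat (- \<gamma>) <|> transpose D </>
           C <|> D <|> mat (- \<gamma>)) \<longleftrightarrow> (\<forall>x u y. brl_form A B C D \<gamma> P x u y \<le> 0)"
    (is "neg_semidef ?M \<longleftrightarrow> _")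
proof -
  have Pt: "transpose P = P" using P by (simp add: sym_mats_def)
  have Ps: "a \<bullet> (P *v b) = (P *v a) \<bullet> b" for a b using P by (simp add: sym_mats_iff)
  have sym: "?M \<in> sym_mats"
    by (simp add: sym_mats_def block_transpose hcat_of_vcats transpose_add matrix_transpose_mul Pt
        add.commute
        vcat_eq_iff hcat_eq_iff)
  have form: "vjoin x (vjoin u y) \<bullet> (?M *v vjoin x (vjoin u y)) = brl_form A B C D \<gamma> P x u y" for x u y
  proof -
    note tr = inner_transpose
    have 1: "x \<bullet> (transpose A *v (P *v x)) = x \<bullet> (P *v (A *v x))"
      unfolding tr Ps[of x "A *v x"] ..
    have 2: "u \<bullet> (transpose B *v (P *v x)) = x \<bullet> (P *v (B *v u))"
      unfolding tr Ps[of x "B *v u"] ..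
    show ?thesis
      by (simp add: brl_form_def hcat_vec vcat_vec inner_vjoin inner_add_right
          matrix_vector_mult_add_rdistrib
          matrix_vector_right_distrib 1 2 tr[of x C] tr[of u D] mat_vector inner_diff_right del:
              transpose_matrix_vector flip: matrix_vector_mul_assoc)
  qed
  show ?thesis unfolding neg_semidef_iff
  proof
    assume a: "?M \<in> sym_mats \<and> (\<forall>v. v \<bullet> (?M *v v) \<le> 0)"
    show "\<forall>x u y. brl_form A B C D \<gamma> P x u y \<le> 0"
      using a unfolding form[symmetric] by blast
  next
    assume a: "\<forall>x u y. brl_form A B C D \<gamma> P x u y \<le> 0"
    have "v \<bullet> (?M *v v) \<le> 0" for v
    proof -
      obtain x w where v: "v = vjoin x w" by (rule vjoin_cases)
      obtain u y where w: "w = vjoin u y" by (rule vjoin_cases)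
      show ?thesis unfolding v w form using a by blast
    qed
    with sym show "?M \<in> sym_mats \<and> (\<forall>v. v \<bullet> (?M *v v) \<le> 0)" by blast
  qed
qed

text \<open>The strict bounded real inequality for positive definite \<open>P\<close>, with \<open>y\<close> eliminated by a Schur complement and
  \<open>P\<close> scaled by \<open>\<gamma>\<close>.\<close>

definition brl_strict :: "real^'n^'n \<Rightarrow> real^'u^'n \<Rightarrow> real^'n^'y \<Rightarrow> real^'u^'y \<Rightarrow> real \<Rightarrow> real^'n^'n \<Rightarrow> bool"
  where "brl_strict A B C D \<gamma> P \<longleftrightarrow> pos_def P \<and> (\<forall>x u. (x, u) \<noteq> (0, 0) \<longrightarrow>
    2 * (x \<bullet> (P *v (A *v x + B *v u))) + (norm (C *v x + D *v u))\<^sup>2 - \<gamma>\<^sup>2 * (norm u)\<^sup>2 < 0)"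

text \<open>In pairs of real vectors: \<open>(i \<omega> - A) (a + i b) = p + i q\<close> is solvable.\<close>

lemma hurwitz_resolvent_exists:
  assumes A: "hurwitz (A :: real^'n^'n)"
  obtains a b where "A *v a + p = - \<omega> *\<^sub>R b" "A *v b + q = \<omega> *\<^sub>R a"
proof -
  define f where "f = (\<lambda>z::(real^'n) \<times> (real^'n). (- \<omega> *\<^sub>R snd z - A *v fst z, \<omega> *\<^sub>R fst z - A *v
      snd z))"
  have f: "linear f"
    by (rule linearI) (simp_all add: f_def matrix_vector_bilinear algebra_simps)
  have "inj f"
  proof (subst linear_inj_iff_eq_0[OF f], intro allI impI)
    fix z assume z: "f z = 0"
    show "z = 0"
    proof (rule ccontr)
      assume "z \<noteq> 0"
      then have "(fst z, snd z) \<noteq> (0, 0)" by (cases z) (simp add: zero_prod_def)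
      moreover have "A *v fst z = 0 *\<^sub>R fst z - \<omega> *\<^sub>R snd z" "A *v snd z = 0 *\<^sub>R snd z + \<omega> *\<^sub>R fst z"
        using z by (simp_all add: f_def zero_prod_def)
      ultimately have "(0::real) < 0" using A unfolding hurwitz_real by blast
      then show False by simp
    qed
  qed
  then have "surj f" by (rule linear_inj_imp_surj[OF f])
  then obtain z where "f z = (p, q)" by (metis surjD)
  then show thesis using that[of "fst z" "snd z"] by (auto simp: f_def algebra_simps)
qed

text \<open>The bound on the imaginary axis passes to the limit of infinite frequency, where the state tends to zero.\<close>

lemma feedthrough_bound:
  fixes A :: "real^'n^'n" and B :: "real^'u^'n" and C :: "real^'n^'y" and D :: "real^'u^'y"
  assumes A: "hurwitz A"
    and freq: "\<And>\<omega> a b g h. A *v a + B *v g = - \<omega> *\<^sub>R b \<Longrightarrow> A *v b + B *v h = \<omega> *\<^sub>R a \<Longrightarrow>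
      (norm (C *v a + D *v g))\<^sup>2 + (norm (C *v b + D *v h))\<^sup>2 \<le> c * ((norm g)\<^sup>2 + (norm h)\<^sup>2)"
  shows "(norm (D *v g))\<^sup>2 \<le> c * (norm g)\<^sup>2"
proof -
  obtain K where K: "0 < K" "\<And>x. norm (A *v x) \<le> norm x * K"
    using bounded_linear.pos_bounded[of "(*v) A"] by auto
  (* beyond the norm bound K of A the resolvent decays like the inverse of the distance to K *)
  have "\<exists>a b. A *v a + B *v g = - (K + real (Suc n)) *\<^sub>R b \<and> A *v b = (K + real (Suc n)) *\<^sub>R a" for n
    using hurwitz_resolvent_exists[OF A, of "B *v g" "K + real (Suc n)" 0] by (metis add.right_neutral)
  then obtain a b where ab: "\<And>n. A *v a n + B *v g = - (K + real (Suc n)) *\<^sub>R b n" "\<And>n. A *v b n =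
      (K + real (Suc n)) *\<^sub>R a n"
    by metis
  have small: "norm (a n) + norm (b n) \<le> norm (B *v g) * inverse (real (Suc n))" for n
  proof -
    have "(K + real (Suc n)) * norm (b n) = norm (A *v a n + B *v g)" using K(1) by (simp add: ab(1))
    also have "\<dots> \<le> K * norm (a n) + norm (B *v g)" using K(2)[of "a n"] norm_triangle_ineq[of "A *v
        a n" "B *v g"]
      by (simp add: mult.commute)
    finally have 1: "(K + real (Suc n)) * norm (b n) \<le> K * norm (a n) + norm (B *v g)" .
    have "(K + real (Suc n)) * norm (a n) = norm (A *v b n)" using K(1) by (simp add: ab(2))
    also have "\<dots> \<le> K * norm (b n)" using K(2)[of "b n"] by (simp add: mult.commute)
    finally have "(K + real (Suc n)) * norm (a n) \<le> K * norm (b n)" .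
    with 1 have "real (Suc n) * (norm (a n) + norm (b n)) \<le> norm (B *v g)" by (simp add: algebra_simps)
    then show ?thesis by (simp add: divide_simps mult.commute)
  qed
  have lim: "(\<lambda>n. norm (B *v g) * inverse (real (Suc n))) \<longlonglongrightarrow> 0"
    using tendsto_mult_left[OF LIMSEQ_inverse_real_of_nat, of "norm (B *v g)"] by simp
  have "norm (a n) \<le> norm (B *v g) * inverse (real (Suc n))" "norm (b n) \<le> norm (B *v g) * inverse
      (real (Suc n))" for n
    using small[of n] norm_ge_zero[of "a n"] norm_ge_zero[of "b n"] by linarith+
  then have "a \<longlonglongrightarrow> 0" "b \<longlonglongrightarrow> 0" using lim by (auto intro!: Lim_null_comparison[OF always_eventually lim])
  then have "(\<lambda>n. (norm (C *v a n + D *v g))\<^sup>2 + (norm (C *v b n + D *v 0))\<^sup>2) \<longlonglongrightarrow> (norm (C *v 0 + D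
      *v g))\<^sup>2 + (norm (C *v 0 + D *v 0))\<^sup>2"
    by (intro tendsto_intros bounded_linear.tendsto[OF matrix_vector_mul_bounded_linear])
  moreover have "(norm (C *v a n + D *v g))\<^sup>2 + (norm (C *v b n + D *v 0))\<^sup>2 \<le> c * ((norm g)\<^sup>2 +
      (norm (0::real^'u))\<^sup>2)" for n
    by (rule freq[OF ab(1)]) (simp add: ab(2))
  ultimately have "(norm (C *v 0 + D *v g))\<^sup>2 + (norm (C *v 0 + D *v 0))\<^sup>2 \<le> c * ((norm g)\<^sup>2 + (norm
      (0::real^'u))\<^sup>2)"
    by (intro LIMSEQ_le_const2) auto
  then show ?thesis by simp
qed

theorem bounded_real_strict:
  fixes A :: "real^'n^'n" and B :: "real^'u^'n" and C :: "real^'n^'y" and D :: "real^'u^'y"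
  assumes A: "hurwitz A" and \<gamma>: "0 \<le> c" "c < \<gamma>\<^sup>2"
    and freq: "\<And>\<omega> a b g h. A *v a + B *v g = - \<omega> *\<^sub>R b \<Longrightarrow> A *v b + B *v h = \<omega> *\<^sub>R a \<Longrightarrow>
      (norm (C *v a + D *v g))\<^sup>2 + (norm (C *v b + D *v h))\<^sup>2 \<le> c * ((norm g)\<^sup>2 + (norm h)\<^sup>2)"
  obtains P where "brl_strict A B C D \<gamma> P"
proof -
  define X :: "real^('n + 'u)^'n" where "X = (mat 1 <|> 0)"
  define H where "H = (A <|> B)"
  define N where "N = (C <|> D)"
  define E :: "real^('n + 'u)^'u" where "E = (0 <|> mat 1)"
  define \<Theta> where "\<Theta> = transpose N ** N - \<gamma>\<^sup>2 *\<^sub>R (transpose E ** E)"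
  have [simp]: "X *v vjoin x u = x" "H *v vjoin x u = A *v x + B *v u" for x u
    by (simp_all add: X_def H_def hcat_vec)
  have th: "vjoin x u \<bullet> (\<Theta> *v vjoin x u) = (norm (C *v x + D *v u))\<^sup>2 - \<gamma>\<^sup>2 * (norm u)\<^sup>2" for x u
  proof -
    have "v \<bullet> (\<Theta> *v v) = (N *v v) \<bullet> (N *v v) - \<gamma>\<^sup>2 * ((E *v v) \<bullet> (E *v v))" for v
    proof -
      show ?thesis
        unfolding \<Theta>_def matrix_vector_bilinear inner_diff_right inner_scaleR_right
            matrix_vector_mul_assoc[symmetric]
        by (simp only: inner_transpose)
    qed
    then show ?thesis by (simp add: N_def E_def hcat_vec dot_square_norm)
  qed
  have hz: "(a, b) = (0, 0)" if "A *v a = - \<omega> *\<^sub>R b" "A *v b = \<omega> *\<^sub>R a" for a b \<omega>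
  proof (rule ccontr)
    assume "(a, b) \<noteq> (0, 0)"
    moreover have "A *v a = 0 *\<^sub>R a - \<omega> *\<^sub>R b" "A *v b = 0 *\<^sub>R b + \<omega> *\<^sub>R a" using that by simp_all
    ultimately have "(0::real) < 0" using A unfolding hurwitz_real by blast
    then show False by simp
  qed
  obtain P where P: "P \<in> sym_mats" "\<And>v. v \<noteq> 0 \<Longrightarrow> 2 * ((X *v v) \<bullet> (P *v (H *v v))) + v \<bullet> (\<Theta> *v v) < 0"
  proof (rule kyp[of H X \<Theta>])
    fix p q :: "real^('n + 'u)" and \<omega>
    assume nz: "(p, q) \<noteq> (0, 0)" and eq: "H *v p = - \<omega> *\<^sub>R (X *v q)" "H *v q = \<omega> *\<^sub>R (X *v p)"
    obtain a g where p: "p = vjoin a g" by (rule vjoin_cases)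
    obtain b h where q: "q = vjoin b h" by (rule vjoin_cases)
    have eq': "A *v a + B *v g = - \<omega> *\<^sub>R b" "A *v b + B *v h = \<omega> *\<^sub>R a" using eq by (simp_all add: p q)
    have "(g, h) \<noteq> (0, 0)"
    proof
      assume "(g, h) = (0, 0)"
      then show False using hz[of a \<omega> b] eq' nz by (simp add: p q vjoin_0)
    qed
    then have "0 < (norm g)\<^sup>2 + (norm h)\<^sup>2" by (auto simp: sum_power2_gt_zero_iff)
    then have "c * ((norm g)\<^sup>2 + (norm h)\<^sup>2) < \<gamma>\<^sup>2 * ((norm g)\<^sup>2 + (norm h)\<^sup>2)" using \<gamma> by simp
    with freq[OF eq'] show "p \<bullet> (\<Theta> *v p) + q \<bullet> (\<Theta> *v q) < 0"
      unfolding p q th by (simp add: algebra_simps)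
  next
    fix p :: "real^('n + 'u)"
    assume nz: "p \<noteq> 0" and "X *v p = 0"
    obtain a g where p: "p = vjoin a g" by (rule vjoin_cases)
    have a: "a = 0" using \<open>X *v p = 0\<close> by (simp add: p)
    then have "g \<noteq> 0" using nz by (auto simp: p vjoin_0)
    then have "c * (norm g)\<^sup>2 < \<gamma>\<^sup>2 * (norm g)\<^sup>2" using \<gamma> by simp
    moreover have "(norm (D *v g))\<^sup>2 \<le> c * (norm g)\<^sup>2"
      by (rule feedthrough_bound[OF A]) (rule freq)
    ultimately show "p \<bullet> (\<Theta> *v p) < 0"
      unfolding p th a by simp
  qed blast
  have strict: "2 * (x \<bullet> (P *v (A *v x + B *v u))) + (norm (C *v x + D *v u))\<^sup>2 - \<gamma>\<^sup>2 * (norm u)\<^sup>2 < 0"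
    if "(x, u) \<noteq> (0, 0)" for x u
    using P(2)[of "vjoin x u"] that by (simp add: th vjoin_eq_0_iff)
  have "pos_def P"
  proof (rule lyapunov_pos_def[OF A P(1)])
    fix x :: "real^'n" assume "x \<noteq> 0"
    then have "2 * (x \<bullet> (P *v (A *v x))) + (norm (C *v x))\<^sup>2 < 0" using strict[of x 0] by simp
    then show "x \<bullet> (P *v (A *v x)) < 0" using zero_le_power2[of "norm (C *v x)"] by linarith
  qed
  then show thesis using that[of P] strict by (simp add: brl_strict_def)
qed

lemma brl_strict_imp_form:
  assumes "brl_strict A B C D \<gamma> P" and \<gamma>: "0 < \<gamma>"
  shows "pos_def ((1 / \<gamma>) *\<^sub>R P)" "brl_form A B C D \<gamma> ((1 / \<gamma>) *\<^sub>R P) x u y \<le> 0"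
proof -
  show "pos_def ((1 / \<gamma>) *\<^sub>R P)" using assms
    by (auto simp: brl_strict_def pos_def_def sym_mats_iff matrix_vector_bilinear)
  define z where "z = C *v x + D *v u"
  define w where "w = x \<bullet> (P *v (A *v x + B *v u))"
  have "2 * w + z \<bullet> z - \<gamma>\<^sup>2 * (u \<bullet> u) \<le> 0"
  proof (cases "(x, u) = (0, 0)")
    case False
    then show ?thesis using assms(1) unfolding brl_strict_def z_def w_def power2_norm_eq_inner
      by (meson less_imp_le)
  qed (auto simp: z_def w_def)
  moreover have "0 \<le> (z - \<gamma> *\<^sub>R y) \<bullet> (z - \<gamma> *\<^sub>R y)" by simp
  then have "2 * \<gamma> * (y \<bullet> z) - \<gamma>\<^sup>2 * (y \<bullet> y) \<le> z \<bullet> z"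
    by (simp add: inner_diff_left inner_diff_right inner_commute power2_eq_square algebra_simps)
  ultimately have "2 * w + (2 * \<gamma> * (y \<bullet> z) - \<gamma>\<^sup>2 * (y \<bullet> y)) - \<gamma>\<^sup>2 * (u \<bullet> u) \<le> 0" by linarith
  moreover have "\<gamma> * brl_form A B C D \<gamma> ((1 / \<gamma>) *\<^sub>R P) x u y = 2 * w + (2 * \<gamma> * (y \<bullet> z) - \<gamma>\<^sup>2 * (y
      \<bullet> y)) - \<gamma>\<^sup>2 * (u \<bullet> u)"
    using \<gamma> unfolding brl_form_def matrix_vector_bilinear(7) z_def[symmetric] w_def[symmetric]
        inner_scaleR_right
    by (simp add: w_def power2_eq_square algebra_simps)
  ultimately show "brl_form A B C D \<gamma> ((1 / \<gamma>) *\<^sub>R P) x u y \<le> 0"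
    using \<gamma> by (metis mult_le_0_iff not_less)
qed

text \<open>The determinant of \<open>M + t I\<close> is a polynomial in \<open>t\<close>, which is not zero as \<open>M + t I\<close> is invertible for
  large \<open>t\<close>.\<close>

lemma finite_singular_shifts: "finite {t. \<not> invertible (M + t *\<^sub>R mat 1)}" for M :: "real^'n^'n"
proof -
  define N where "N = (\<chi> i j. [: M $ i $ j, mat 1 $ i $ j :])"
  have N: "poly (det N) t = det (M + t *\<^sub>R mat 1)" for t
    by (simp add: det_def poly_sum poly_prod N_def)
  obtain K where K: "0 < K" "\<And>x. norm (M *v x) \<le> norm x * K"
    using bounded_linear.pos_bounded[of "(*v) M"] by auto
  have "x = 0" if x: "(M + (K + 1) *\<^sub>R mat 1) *v x = 0" for x
  proof -
    have "M *v x = - ((K + 1) *\<^sub>R x)" using x by (simp add: matrix_vector_bilinear eq_neg_iff_add_eq_0)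
    then have "(K + 1) * norm x \<le> norm x * K" using K(2)[of x] K(1) by simp
    then show "x = 0" by (simp add: algebra_simps)
  qed
  then have "invertible (M + (K + 1) *\<^sub>R mat 1)"
    using matrix_left_invertible_ker[of "M + (K + 1) *\<^sub>R mat 1"] invertible_left_inverse by blast
  then have "poly (det N) (K + 1) \<noteq> 0" by (simp add: N invertible_det_nz)
  then have "det N \<noteq> 0" by auto
  then have "finite {t. poly (det N) t = 0}" by (rule poly_roots_finite)
  then show ?thesis by (simp add: N invertible_det_nz)
qed

lemma compact_strict_perturb:
  fixes f g :: "'a::metric_space \<Rightarrow> real"
  assumes "compact K" "continuous_on K f" "continuous_on K g" "\<And>x. x \<in> K \<Longrightarrow> f x < 0"
  shows "\<exists>e>0. \<forall>t. 0 < t \<and> t < e \<longrightarrow> (\<forall>x\<in>K. f x + t * g x < 0)"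
proof (cases "K = {}")
  case False
  obtain a where a: "a \<in> K" "\<And>x. x \<in> K \<Longrightarrow> f x \<le> f a" using continuous_attains_sup[OF assms(1) False
      assms(2)] by blast
  obtain b where b: "b \<in> K" "\<And>x. x \<in> K \<Longrightarrow> g x \<le> g b" using continuous_attains_sup[OF assms(1) False
      assms(3)] by blast
  define e where "e = - f a / (\<bar>g b\<bar> + 1)"
  have fa: "f a < 0" using assms(4) a by blast
  then have "0 < e" by (simp add: e_def divide_neg_pos)
  moreover have "f x + t * g x < 0" if t: "0 < t" "t < e" and x: "x \<in> K" for t x
  proof -
    have "g x \<le> \<bar>g b\<bar> + 1" using b(2)[OF x] by linarith
    then have "t * g x \<le> t * (\<bar>g b\<bar> + 1)" using t(1) by simp
    also have "\<dots> < e * (\<bar>g b\<bar> + 1)" using t(2) by (intro mult_strict_right_mono) auto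
    also have "\<dots> = - f a" by (simp add: e_def)
    finally show ?thesis using a(2)[OF x] by linarith
  qed
  ultimately show ?thesis by blast
qed (use zero_less_one in blast)

text \<open>Adding \<open>t\<close> times the matrix with identity off-diagonal blocks preserves the strict inequalities for small
  \<open>t\<close> and makes the off-diagonal block invertible for all but finitely many \<open>t\<close>.\<close>

lemma brl_strict_coupled:
  fixes A :: "real^('n::finite + 'n)^('n + 'n)" and B :: "real^'u^('n + 'n)" and C :: "real^('n +
      'n)^'y" and D :: "real^'u^'y"
  assumes P: "brl_strict A B C D \<gamma> P"
  obtains P' where "brl_strict A B C D \<gamma> P'" "invertible (blk12 P')"
proof -
  define E :: "real^('n + 'n)^('n + 'n)" where "E = (0 <|> mat 1 </> mat 1 <|> 0)"
  have E: "E \<in> sym_mats" by (simp add: E_def sym_blocks_iff) (simp add: sym_mats_def transpose_def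
      vec_eq_iff)
  define f where "f = (\<lambda>(x, u). 2 * (x \<bullet> (P *v (A *v x + B *v u))) + (norm (C *v x + D *v u))\<^sup>2 -
      \<gamma>\<^sup>2 * (norm u)\<^sup>2)"
  define g where "g = (\<lambda>(x, u). 2 * (x \<bullet> (E *v (A *v x + B *v u))))"
  have cont: "continuous_on S f" "continuous_on S g" for S
    unfolding f_def g_def case_prod_unfold
    by (intro continuous_intros bounded_linear.continuous_on[OF matrix_vector_mul_bounded_linear])+
  have "f z < 0" if "z \<in> sphere 0 1" for z
    using P that unfolding brl_strict_def f_def case_prod_unfold
    by (metis mem_sphere_0 norm_zero prod.collapse zero_neq_one zero_prod_def)
  then obtain e1 where e1: "0 < e1" "\<And>t z. 0 < t \<Longrightarrow> t < e1 \<Longrightarrow> norm z = 1 \<Longrightarrow> f z + t * g z < 0"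
    using compact_strict_perturb[OF compact_sphere cont, of 0 1] by auto
  have "continuous_on S (\<lambda>x. - (x \<bullet> (P *v x)))" "continuous_on S (\<lambda>x. - (x \<bullet> (E *v x)))" for S
    by (intro continuous_intros bounded_linear.continuous_on[OF matrix_vector_mul_bounded_linear])+
  moreover have "- (x \<bullet> (P *v x)) < 0" if "x \<in> sphere 0 1" for x
  proof -
    have "x \<noteq> 0" using that by auto
    then show ?thesis using P by (auto simp: brl_strict_def pos_def_def)
  qed
  ultimately obtain e2 where e2: "0 < e2" "\<And>t x. 0 < t \<Longrightarrow> t < e2 \<Longrightarrow> norm x = 1 \<Longrightarrow> - (x \<bullet> (P *v x)) + t
      * - (x \<bullet> (E *v x)) < 0"
    using compact_strict_perturb[OF compact_sphere, of 0 1 "\<lambda>x. - (x \<bullet> (P *v x))" "\<lambda>x. - (x \<bullet> (E *v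
        x))"] by auto
  have "infinite {0<..<min e1 e2}" using e1(1) e2(1) by (simp add: infinite_Ioo)
  then have "{0<..<min e1 e2} - {t. \<not> invertible (blk12 P + t *\<^sub>R mat 1)} \<noteq> {}"
    using Diff_infinite_finite[OF finite_singular_shifts] infinite_imp_nonempty by blast
  then obtain t where t: "0 < t" "t < e1" "t < e2" "invertible (blk12 P + t *\<^sub>R mat 1)" by auto
  define P' where "P' = P + t *\<^sub>R E"
  have P'v: "P' *v x = P *v x + t *\<^sub>R (E *v x)" for x by (simp add: P'_def matrix_vector_bilinear)
  have "blk12 P' = blk12 P + t *\<^sub>R mat 1"
  proof -
    have "blk12 (M + t *\<^sub>R N) = blk12 M + t *\<^sub>R blk12 N" for M N :: "real^('n + 'n)^('n + 'n)"
      by (simp add: blk12_def vec_eq_iff)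
    then show ?thesis by (simp add: P'_def E_def)
  qed
  moreover have "brl_strict A B C D \<gamma> P'" unfolding brl_strict_def
  proof (intro conjI allI impI)
    have "P' \<in> sym_mats" using P E by (simp add: brl_strict_def pos_def_def sym_mats_iff P'v
        inner_add_left inner_add_right)
    moreover have "0 < x \<bullet> (P' *v x)" if "x \<noteq> 0" for x
    proof -
      define w where "w = (1 / norm x) *\<^sub>R x"
      have w: "norm w = 1" "x = norm x *\<^sub>R w" using that by (simp_all add: w_def)
      have "x \<bullet> (P' *v x) = (norm x)\<^sup>2 * (w \<bullet> (P' *v w))"
        by (subst (1 2) w(2)) (simp add: matrix_vector_mult_scaleR power2_eq_square)
      moreover have "0 < w \<bullet> (P' *v w)" using e2(2)[OF t(1,3) w(1)] by (simp add: P'v inner_add_right)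
      ultimately show ?thesis using that by simp
    qed
    ultimately show "pos_def P'" by (simp add: pos_def_def)
    fix x :: "real^('n + 'n)" and u :: "real^'u"
    assume nz: "(x, u) \<noteq> (0, 0)"
    define n where "n = norm (x, u)"
    have n: "n \<noteq> 0" using nz by (simp add: n_def zero_prod_def)
    define a where "a = (1 / n) *\<^sub>R x"
    define b where "b = (1 / n) *\<^sub>R u"
    have "(a, b) = (1 / n) *\<^sub>R (x, u)" by (simp add: a_def b_def)
    then have "norm (a, b) = \<bar>1 / n\<bar> * n" by (simp only: norm_scaleR n_def)
    moreover have "0 \<le> n" by (simp add: n_def)
    ultimately have "norm (a, b) = 1" using n by simp
    from e1(2)[OF t(1,2) this]
    have "2 * (a \<bullet> (P' *v (A *v a + B *v b))) + (norm (C *v a + D *v b))\<^sup>2 - \<gamma>\<^sup>2 * (norm b)\<^sup>2 < 0"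
        (is "?q a b < 0")
      by (simp add: f_def g_def P'v inner_add_right algebra_simps)
    moreover have xu: "x = n *\<^sub>R a" "u = n *\<^sub>R b" using n by (simp_all add: a_def b_def)
    have "norm (C *v x + D *v u) = \<bar>n\<bar> * norm (C *v a + D *v b)" "norm u = \<bar>n\<bar> * norm b"
      "x \<bullet> (P' *v (A *v x + B *v u)) = n\<^sup>2 * (a \<bullet> (P' *v (A *v a + B *v b)))"
      by (simp_all only: xu matrix_vector_mult_scaleR scaleR_add_right[symmetric] norm_scaleR
          inner_scaleR_left inner_scaleR_right power2_eq_square mult.assoc)
    then have "?q x u = n\<^sup>2 * ?q a b" by (simp add: power_mult_distrib algebra_simps)
    ultimately show "?q x u < 0" using n by (simp add: mult_less_0_iff)
  qed
  ultimately show thesis using that t(4) by simp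
qed


section \<open>Singular values and the transfer function\<close>

lemma inner_cmatrix_vector: "x \<bullet> (M *v y) = (ctranspose M *v x) \<bullet> y" for M :: "complex^'c^'r"
proof -
  have c: "a \<bullet> (b * c) = (cnj b * a) \<bullet> c" for a b c :: complex
    by (simp add: inner_complex_def algebra_simps)
  show ?thesis
    by (simp add: inner_vec_def matrix_vector_mult_def ctranspose_def inner_sum_left inner_sum_right c)
       (rule sum.swap)
qed

lemma smult_of_real: "complex_of_real c *s v = c *\<^sub>R v"
  by (simp add: vec_eq_iff) (simp add: scaleR_conv_of_real)

text \<open>The greatest singular value exists, and it is the operator norm.\<close>

lemma sigma_max:
  fixes M :: "complex^'c^'r"
  shows "singular_value M (sigma_max M)" "norm (M *v v) \<le> sigma_max M * norm v"
proof -
  define N where "N = (\<lambda>v. (ctranspose M ** M) *v v)"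
  have N: "linear N" unfolding N_def
    by (rule linearI) (simp_all add: matrix_vector_right_distrib smult_of_real[symmetric]
        cmatrix_vector_mult_smult)
  have xNy: "x \<bullet> N y = (M *v x) \<bullet> (M *v y)" "N x \<bullet> y = (M *v x) \<bullet> (M *v y)" for x y
    by (simp_all add: N_def inner_cmatrix_vector[of "M *v x" M y] matrix_vector_mul_assoc)
       (metis inner_cmatrix_vector inner_commute matrix_vector_mul_assoc)
  have nrm: "(norm (M *v x))\<^sup>2 = x \<bullet> N x" for x by (simp add: xNy power2_norm_eq_inner)
  have "(1 :: complex^'c) \<noteq> 0" by simp
  then have "(UNIV :: (complex^'c) set) \<noteq> {0}" by blast
  then obtain w l where w: "norm w = 1" "N w = l *\<^sub>R w" and le: "\<And>x. x \<bullet> N x \<le> l * (x \<bullet> x)"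
    using self_adjoint_eigenvector[OF N subspace_UNIV] xNy by (metis UNIV_I)
  have "l = (norm (M *v w))\<^sup>2" unfolding nrm w(2) using w(1) by (simp add: dot_square_norm)
  then have l: "0 \<le> l" by simp
  have sv: "singular_value M (sqrt l)" unfolding singular_value_def
  proof (intro conjI exI)
    show "w \<noteq> 0" using w(1) by auto
    show "(ctranspose M ** M) *v w = complex_of_real ((sqrt l)\<^sup>2) *s w"
      using w(2) l by (simp add: N_def smult_of_real)
  qed (use l in auto)
  have "t \<le> sqrt l" if t: "singular_value M t" for t
  proof -
    obtain v where v: "v \<noteq> 0" "N v = t\<^sup>2 *\<^sub>R v" and t0: "0 \<le> t"
      using t unfolding singular_value_def N_def smult_of_real by blast
    have "t\<^sup>2 * (v \<bullet> v) \<le> l * (v \<bullet> v)" using le[of v] by (simp add: v(2))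
    then have "t\<^sup>2 \<le> l" using v(1) by simp
    then show ?thesis by (rule real_le_rsqrt)
  qed
  then have s: "sigma_max M = sqrt l" unfolding sigma_max_def
    by (intro Greatest_equality sv)
  show "singular_value M (sigma_max M)" using sv by (simp add: s)
  have "(norm (M *v v))\<^sup>2 \<le> (sqrt l * norm v)\<^sup>2"
    unfolding nrm using le[of v] l by (simp add: power_mult_distrib power2_norm_eq_inner)
  then show "norm (M *v v) \<le> sigma_max M * norm v" unfolding s
    by (rule power2_le_imp_le) (simp add: l)
qed

lemma sigma_max_nonneg: "0 \<le> sigma_max M"
  using sigma_max(1)[of M] by (simp add: singular_value_def)

lemma sigma_max_le:
  assumes "\<And>v. norm (M *v v) \<le> c * norm v"
  shows "sigma_max M \<le> c"
proof -
  obtain v where v: "v \<noteq> 0" "(ctranspose M ** M) *v v = (sigma_max M)\<^sup>2 *\<^sub>R v"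
    using sigma_max(1)[of M] unfolding singular_value_def smult_of_real by blast
  have "(norm (M *v v))\<^sup>2 = v \<bullet> ((ctranspose M ** M) *v v)"
    by (metis inner_cmatrix_vector inner_commute matrix_vector_mul_assoc power2_norm_eq_inner)
  also have "\<dots> = (sigma_max M * norm v)\<^sup>2" unfolding v(2) by (simp add: power_mult_distrib
      power2_norm_eq_inner)
  finally have "norm (M *v v) = sigma_max M * norm v"
    by (rule power2_eq_imp_eq) (simp_all add: sigma_max_nonneg)
  then show ?thesis using assms[of v] v(1) by simp
qed

text \<open>The value of the transfer function of the system \<open>(A, B, C, D)\<close> at \<open>s\<close>.\<close>

definition transfer_matrix :: "real^'n^'n \<Rightarrow> real^'u^'n \<Rightarrow> real^'n^'y \<Rightarrow> real^'u^'y \<Rightarrow> complex \<Rightarrow>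
    complex^'u^'y"
  where "transfer_matrix A B C D s = cmat C ** matrix_inv (mat s - cmat A) ** cmat B + cmat D"

lemma transfer_matrix_apply:
  fixes A :: "real^'n^'n" and B :: "real^'u^'n" and C :: "real^'n^'y" and D :: "real^'u^'y"
  assumes A: "hurwitz A" and eqs: "A *v a + B *v g = - \<omega> *\<^sub>R b" "A *v b + B *v h = \<omega> *\<^sub>R a"
  shows "transfer_matrix A B C D (\<i> * complex_of_real \<omega>) *v complex_vec g h = complex_vec (C *v a +
      D *v g) (C *v b + D *v h)"
proof -
  let ?s = "\<i> * complex_of_real \<omega>"
  define R where "R = mat ?s - cmat A"
  have "mat ?s *v v = ?s *s v" for v :: "complex^'n"
    by (simp add: mat_def matrix_vector_mult_def vec_eq_iff if_distrib[where f="\<lambda>a. a * _"] cong: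
        if_cong)
  then have R: "R *v v = ?s *s v - cmat A *v v" for v
    by (simp add: R_def matrix_vector_mult_diff_rdistrib)
  have "v = 0" if "R *v v = 0" for v
  proof (rule ccontr)
    assume "v \<noteq> 0"
    moreover have "cmat A *v v = ?s *s v" using that by (simp add: R)
    ultimately have "Re ?s < 0" using A unfolding hurwitz_def by blast
    then show False by simp
  qed
  then have "invertible R" using matrix_left_invertible_ker[of R] invertible_left_inverse by blast
  then have inv: "matrix_inv R *v (R *v v) = v" for v
    by (simp add: matrix_vector_mul_assoc matrix_inv)
  have "R *v complex_vec a b = cmat B *v complex_vec g h"
    using eqs unfolding R cmat_complex_vec complex_vec_smult complex_vec_diff complex_vec_eq_iff
    by (simp add: algebra_simps)
  then have "matrix_inv R *v (cmat B *v complex_vec g h) = complex_vec a b" by (metis inv)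
  then show ?thesis
    unfolding transfer_matrix_def R_def[symmetric] matrix_vector_mult_add_rdistrib
        matrix_vector_mul_assoc[symmetric]
    by (simp add: cmat_complex_vec complex_vec_add)
qed

text \<open>With \<open>z\<close> the response to \<open>v\<close>, the form at output \<open>t z\<close> gives \<open>2 t |z|\<^sup>2 \<le> \<gamma> (|v|\<^sup>2 + t\<^sup>2 |z|\<^sup>2)\<close>; the best
  choice is \<open>t = |v| / |z|\<close>. Nothing is assumed about the sign of \<open>\<gamma>\<close>.\<close>

lemma bounded_real_converse:
  fixes A :: "real^'n^'n" and B :: "real^'u^'n" and C :: "real^'n^'y" and D :: "real^'u^'y"
  assumes A: "hurwitz A" and P: "P \<in> sym_mats" and lmi: "\<And>x u y. brl_form A B C D \<gamma> P x u y \<le> 0"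
  shows "sigma_max (transfer_matrix A B C D (\<i> * complex_of_real \<omega>)) \<le> \<gamma>"
proof (rule sigma_max_le)
  fix v :: "complex^'u"
  obtain g h where v: "v = complex_vec g h" by (rule complex_vec_cases)
  obtain a b where ab: "A *v a + B *v g = - \<omega> *\<^sub>R b" "A *v b + B *v h = \<omega> *\<^sub>R a"
    using hurwitz_resolvent_exists[OF A] by metis
  define z1 where "z1 = C *v a + D *v g"
  define z2 where "z2 = C *v b + D *v h"
  define N where "N = norm (complex_vec z1 z2)"
  define M where "M = norm (complex_vec g h)"
  have N2: "z1 \<bullet> z1 + z2 \<bullet> z2 = N\<^sup>2" and M2: "g \<bullet> g + h \<bullet> h = M\<^sup>2"
    by (simp_all add: N_def M_def norm_complex_vec)
  have Ps: "b \<bullet> (P *v a) = a \<bullet> (P *v b)"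
    using P by (metis inner_commute sym_mats_iff)
  have key: "2 * t * N\<^sup>2 \<le> \<gamma> * (M\<^sup>2 + t\<^sup>2 * N\<^sup>2)" for t
  proof -
    have "brl_form A B C D \<gamma> P a g (t *\<^sub>R z1) + brl_form A B C D \<gamma> P b h (t *\<^sub>R z2) \<le> 0"
      using lmi by (intro add_nonpos_nonpos)
    also have "brl_form A B C D \<gamma> P a g (t *\<^sub>R z1) + brl_form A B C D \<gamma> P b h (t *\<^sub>R z2) =
        2 * t * (z1 \<bullet> z1 + z2 \<bullet> z2) - \<gamma> * ((g \<bullet> g + h \<bullet> h) + t\<^sup>2 * (z1 \<bullet> z1 + z2 \<bullet> z2))"
      unfolding brl_form_def ab z1_def[symmetric] z2_def[symmetric]
      by (simp add: matrix_vector_bilinear Ps power2_eq_square algebra_simps)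
    finally show ?thesis unfolding N2 M2 by simp
  qed
  have "brl_form A B C D \<gamma> P 0 0 1 \<le> 0" by (rule lmi)
  then have "0 \<le> \<gamma> * ((1 :: real^'y) \<bullet> 1)" by (simp add: brl_form_def)
  moreover have "0 < (1 :: real^'y) \<bullet> 1" by (simp add: inner_gt_zero_iff)
  ultimately have g0: "0 \<le> \<gamma>" by (simp add: zero_le_mult_iff)
  have M0: "0 \<le> M" and N0: "0 \<le> N" by (simp_all add: M_def N_def)
  have "N \<le> \<gamma> * M"
  proof (cases "N = 0")
    case False
    then have N: "0 < N" using N0 by simp
    show ?thesis
    proof (cases "M = 0")
      case True
      define t where "t = 1 / (\<gamma> + 1)"
      have t: "0 < t" "\<gamma> * t < 1" using g0 by (simp_all add: t_def divide_simps)
      have "2 * t * N\<^sup>2 \<le> (\<gamma> * t) * (t * N\<^sup>2)" using key[of t] True by (simp add: power2_eq_square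
          mult_ac)
      also have "\<dots> \<le> 1 * (t * N\<^sup>2)" using t N by (intro mult_right_mono) auto
      finally show ?thesis using t N by simp
    next
      case False
      then have M: "0 < M" using M0 by simp
      have "2 * (M / N) * N\<^sup>2 \<le> \<gamma> * (M\<^sup>2 + (M / N)\<^sup>2 * N\<^sup>2)" by (rule key)
      then have "M * N \<le> M * (\<gamma> * M)" using N by (simp add: power2_eq_square field_simps)
      then show ?thesis using M by simp
    qed
  qed (use g0 M0 in simp)
  then show "norm (transfer_matrix A B C D (\<i> * complex_of_real \<omega>) *v v) \<le> \<gamma> * norm v"
    unfolding v transfer_matrix_apply[OF A ab] N_def M_def z1_def z2_def .
qed


section \<open>The projection of the lifted set\<close>

text \<open>An unobservable mode \<open>a + i b\<close> with eigenvalue \<open>i \<omega>\<close> gives a trajectory with zero output.\<close>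

lemma observable_imaginary_mode:
  assumes obs: "observable C A" and A: "A *v a = - \<omega> *\<^sub>R b" "A *v b = \<omega> *\<^sub>R a" and C: "C *v a = 0"
      "C *v b = 0"
  shows "a = 0"
proof -
  define x where "x = (\<lambda>t. cos (\<omega> * t) *\<^sub>R a - sin (\<omega> * t) *\<^sub>R b)"
  have "(x has_vector_derivative (A *v x t)) (at t within {0..1})" for t
  proof -
    have "(x has_vector_derivative ((- sin (\<omega> * t) * \<omega>) *\<^sub>R a - (cos (\<omega> * t) * \<omega>) *\<^sub>R b)) (at t
        within {0..1})"
      unfolding x_def by (auto intro!: derivative_eq_intros)
    also have "(- sin (\<omega> * t) * \<omega>) *\<^sub>R a - (cos (\<omega> * t) * \<omega>) *\<^sub>R b = A *v x t"
      by (simp add: x_def matrix_vector_bilinear A)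
    finally show ?thesis .
  qed
  moreover have "((\<lambda>t. 0) has_vector_derivative (A *v 0)) (at t within {0..1})" for t by simp
  moreover have "C *v x t = C *v 0" for t by (simp add: x_def matrix_vector_bilinear C)
  ultimately have "x 0 = 0" using obs[unfolded observable_def, rule_format, of 1 x "\<lambda>_. 0"] by simp
  then show ?thesis by (simp add: x_def)
qed

text \<open>A left eigenvector \<open>p + i q\<close> of \<open>A\<close> that annihilates \<open>B\<close> gives a solution \<open>r\<close> of the adjoint equation
  such that \<open>r \<bullet> x\<close> is constant along all controlled trajectories. Steering the origin to \<open>r 1\<close> shows
  \<open>r 1 = 0\<close>.\<close>

lemma controllable_mode_flow:
  assumes ctrl: "controllable A B" and A: "transpose A *v p = \<omega> *\<^sub>R q" "transpose A *v q = - \<omega> *\<^sub>R p"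
    and B: "transpose B *v p = 0" "transpose B *v q = 0"
  shows "cos \<omega> *\<^sub>R p - sin \<omega> *\<^sub>R q = 0"
proof -
  define r where "r = (\<lambda>t. cos (\<omega> * t) *\<^sub>R p - sin (\<omega> * t) *\<^sub>R q)"
  obtain u x where "lin_trajectory A B 1 u x" "x 0 = 0" "x 1 = r 1"
    using ctrl unfolding controllable_def by (metis zero_less_one)
  then obtain S where x: "continuous_on {0..1} x" "finite S" "x 0 = 0" "x 1 = r 1"
      "\<And>t. t \<in> {0..1} - S \<Longrightarrow> (x has_vector_derivative (A *v x t + B *v u t)) (at t within {0..1})"
    by (auto simp: lin_trajectory_def)
  define f where "f = (\<lambda>t. r t \<bullet> x t)"
  have r': "(r has_vector_derivative (- (transpose A *v r t))) (at t within {0..1})" for t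
  proof -
    have "(r has_vector_derivative ((- sin (\<omega> * t) * \<omega>) *\<^sub>R p - (cos (\<omega> * t) * \<omega>) *\<^sub>R q)) (at t
        within {0..1})"
      unfolding r_def by (auto intro!: derivative_eq_intros)
    also have "(- sin (\<omega> * t) * \<omega>) *\<^sub>R p - (cos (\<omega> * t) * \<omega>) *\<^sub>R q = - (transpose A *v r t)"
      unfolding r_def matrix_vector_bilinear A by simp
    finally show ?thesis .
  qed
  have Br: "transpose B *v r t = 0" for t unfolding r_def matrix_vector_bilinear B by simp
  have "f 1 = 0"
  proof (rule has_derivative_zero_unique_strong_interval[OF x(2), where f=f and a=0 and b=1])
    show "continuous_on {0..1} f" unfolding f_def r_def by (intro continuous_intros x(1))
    show "f 0 = 0" by (simp add: f_def x)
    show "(1::real) \<in> {0..1}" by simp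
    fix t :: real assume t: "t \<in> {0..1} - S"
    have "(f has_vector_derivative (r t \<bullet> (A *v x t + B *v u t) + - (transpose A *v r t) \<bullet> x t)) (at
        t within {0..1})"
      unfolding f_def by (rule bounded_bilinear.has_vector_derivative[OF bounded_bilinear_inner r'
          x(5)[OF t]])
    also have "r t \<bullet> (A *v x t + B *v u t) + - (transpose A *v r t) \<bullet> x t = 0"
      unfolding inner_add_right inner_matrix_vector Br by (simp del: transpose_matrix_vector)
    finally show "(f has_derivative (\<lambda>h. 0)) (at t within {0..1})"
      by (simp add: has_vector_derivative_def)
  qed
  then show ?thesis by (simp add: f_def x r_def)
qed

lemma controllable_imaginary_mode:
  assumes ctrl: "controllable A B" and A: "transpose A *v p = \<omega> *\<^sub>R q" "transpose A *v q = - \<omega> *\<^sub>R p"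
    and B: "transpose B *v p = 0" "transpose B *v q = 0"
  shows "p = 0"
proof -
  have 1: "cos \<omega> *\<^sub>R p - sin \<omega> *\<^sub>R q = 0" by (rule controllable_mode_flow[OF assms])
  have 2: "cos \<omega> *\<^sub>R q - sin \<omega> *\<^sub>R (- p) = 0"
    using A B by (intro controllable_mode_flow[OF ctrl]) (simp_all add: matrix_vector_bilinear del:
        transpose_matrix_vector)
  have "(cos \<omega> * cos \<omega>) *\<^sub>R p + (sin \<omega> * sin \<omega>) *\<^sub>R p = p"
    unfolding scaleR_left_distrib[symmetric] sin_cos_squared_add3 by simp
  then have "p = cos \<omega> *\<^sub>R (cos \<omega> *\<^sub>R p - sin \<omega> *\<^sub>R q) + sin \<omega> *\<^sub>R (cos \<omega> *\<^sub>R q - sin \<omega> *\<^sub>R (- p))"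
    by (simp add: algebra_simps)
  then show ?thesis unfolding 1 2 by simp
qed

lemma msqrt_pos_def_inj:
  assumes R: "pos_def (R :: real^'n^'n)"
  shows "msqrt R *v x = 0 \<Longrightarrow> x = 0" "transpose (msqrt R) *v x = 0 \<Longrightarrow> x = 0"
proof -
  have psd: "pos_semidef R"
    unfolding pos_semidef_def
  proof (intro conjI allI)
    show "R \<in> sym_mats" using R by (simp add: pos_def_def)
    show "0 \<le> x \<bullet> (R *v x)" for x using R by (cases "x = 0") (auto simp: pos_def_def less_imp_le)
  qed
  show 1: "x = 0" if "msqrt R *v x = 0" for x
  proof (rule ccontr)
    assume "x \<noteq> 0"
    then have "0 < x \<bullet> (R *v x)" using R by (simp add: pos_def_def)
    moreover have "R *v x = msqrt R *v (msqrt R *v x)" using msqrt(2)[OF psd] by (simp add: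
        matrix_vector_mul_assoc)
    ultimately show False using that by simp
  qed
  have "transpose (msqrt R) = msqrt R" using msqrt(1)[OF psd] by (simp add: pos_semidef_def sym_mats_def)
  then show "transpose (msqrt R) *v x = 0 \<Longrightarrow> x = 0" using 1 by simp
qed

text \<open>Stability from the nonstrict inequality. Here the coupling block \<open>P\<^sub>1\<^sub>2\<close> must be invertible: otherwise
  the controller may contain an oscillation that is neither excited nor seen.\<close>

lemma lmi_imp_hurwitz:
  fixes A :: "real^'n^'n" and B :: "real^'m^'n" and C :: "real^'n^'p"
    and K :: "('m, 'n, 'p) policy"
  assumes R: "pos_def R" and V: "pos_def V" and ctrl: "controllable A (msqrt W)" and obs:
      "observable (msqrt Q) A"
    and P: "pos_def P" and P12: "invertible (blk12 P)" and lmi: "neg_semidef (brl_matrix A B C Q R W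
        V K \<gamma> P)"
  shows "hurwitz (A_cl A B C K)"
  unfolding hurwitz_real
proof (intro allI impI)
  define Ac where "Ac = A_cl A B C K"
  define Bc where "Bc = B_cl B W V K"
  define Cc where "Cc = C_cl C Q R K"
  define Dc where "Dc = D_cl R V K"
  define M where "M = brl_matrix A B C Q R W V K \<gamma> P"
  have M: "M = (transpose Ac ** P + P ** Ac <|> P ** Bc <|> transpose Cc </>
           transpose Bc ** P <|> mat (- \<gamma>) <|> transpose Dc </>
           Cc <|> Dc <|> mat (- \<gamma>))"
    by (simp add: M_def brl_matrix_def Ac_def Bc_def Cc_def Dc_def Let_def)
  have Psym: "P \<in> sym_mats" using P by (simp add: pos_def_def)
  have form: "brl_form Ac Bc Cc Dc \<gamma> P x u y \<le> 0" for x u y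
    using lmi brl_lmi_iff[OF Psym, of Ac Bc Cc \<gamma> Dc] unfolding M_def[symmetric] M by blast
  have psd: "pos_semidef (- M)" using lmi by (simp add: neg_semidef_def M_def)
  have Mv: "M *v vjoin x (vjoin 0 0) = vjoin (transpose Ac *v (P *v x) + P *v (Ac *v x)) (vjoin
      (transpose Bc *v (P *v x)) (Cc *v x))" for x
    by (simp add: M hcat_vec vcat_vec matrix_vector_mult_add_rdistrib matrix_vector_mul_assoc del:
        transpose_matrix_vector)
  have Ps: "y \<bullet> (P *v x) = x \<bullet> (P *v y)" for x y using Psym by (metis inner_commute sym_mats_iff)
  have Mq: "vjoin x (vjoin 0 0) \<bullet> (M *v vjoin x (vjoin 0 0)) = 2 * (x \<bullet> (P *v (Ac *v x)))" for x
    using Psym unfolding Mv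
    by (simp add: inner_vjoin inner_add_right inner_transpose sym_mats_iff del: transpose_matrix_vector)
  fix a b \<alpha> \<omega>
  assume nz: "(a, b) \<noteq> (0, 0)" and "A_cl A B C K *v a = \<alpha> *\<^sub>R a - \<omega> *\<^sub>R b" "A_cl A B C K *v b = \<alpha>
      *\<^sub>R b + \<omega> *\<^sub>R a"
  then have ab: "Ac *v a = \<alpha> *\<^sub>R a - \<omega> *\<^sub>R b" "Ac *v b = \<alpha> *\<^sub>R b + \<omega> *\<^sub>R a" by (simp_all add: Ac_def)
  have sum: "a \<bullet> (P *v (Ac *v a)) + b \<bullet> (P *v (Ac *v b)) = \<alpha> * (a \<bullet> (P *v a) + b \<bullet> (P *v b))"
    unfolding ab by (simp add: matrix_vector_bilinear inner_add_right inner_diff_right Ps[of a b]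
        algebra_simps)
  have le: "x \<bullet> (P *v (Ac *v x)) \<le> 0" for x using form[of x 0 0] by (simp add: brl_form_def)
  have "0 < a \<bullet> (P *v a) + b \<bullet> (P *v b)"
    using P nz by (cases "a = 0"; cases "b = 0") (auto simp: pos_def_def intro: add_pos_pos)
  moreover have "\<alpha> * (a \<bullet> (P *v a) + b \<bullet> (P *v b)) \<le> 0" using sum le[of a] le[of b] by linarith
  ultimately have "\<alpha> \<le> 0" by (simp add: mult_le_0_iff)
  moreover have "\<alpha> \<noteq> 0"
  proof
    assume "\<alpha> = 0"
    then have ab0: "Ac *v a = - \<omega> *\<^sub>R b" "Ac *v b = \<omega> *\<^sub>R a" using ab by simp_all
    have zero: "transpose Ac *v (P *v x) + P *v (Ac *v x) = 0 \<and> transpose Bc *v (P *v x) = 0 \<and> Cc *v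
        x = 0"
      if "x \<bullet> (P *v (Ac *v x)) = 0" for x
    proof -
      have "(- M) *v vjoin x (vjoin 0 0) = 0"
        by (rule pos_semidef_zero[OF psd]) (simp add: matrix_vector_bilinear Mq that)
      then have "M *v vjoin x (vjoin 0 0) = 0" by (simp add: matrix_vector_bilinear)
      then show ?thesis unfolding Mv vjoin_eq_0_iff by blast
    qed
    (* the form is nonpositive and vanishes in sum at a and b, so both lie in the kernel of M *)
    have "a \<bullet> (P *v (Ac *v a)) = 0" "b \<bullet> (P *v (Ac *v b)) = 0"
      using sum le[of a] le[of b] \<open>\<alpha> = 0\<close> by simp_all
    note za = zero[OF this(1)] and zb = zero[OF this(2)]
    obtain x1 \<xi>1 where a: "a = vjoin x1 \<xi>1" by (rule vjoin_cases)
    obtain x2 \<xi>2 where b: "b = vjoin x2 \<xi>2" by (rule vjoin_cases)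
    have AcV: "Ac *v vjoin x \<xi> = vjoin (A *v x + B *v (blk11 K *v (C *v x) + blk12 K *v \<xi>)) (blk21 K
        *v (C *v x) + blk22 K *v \<xi>)" for x \<xi>
      by (simp add: Ac_def A_cl_def hcat_vec vcat_vec matrix_vector_mult_add_rdistrib
          matrix_vector_right_distrib add.assoc
          flip: matrix_vector_mul_assoc)
    have CcV: "Cc *v vjoin x \<xi> = vjoin (msqrt Q *v x) (msqrt R *v (blk11 K *v (C *v x) + blk12 K *v
        \<xi>))" for x \<xi>
      by (simp add: Cc_def C_cl_def hcat_vec vcat_vec matrix_vector_right_distrib flip:
          matrix_vector_mul_assoc)
    have c: "msqrt Q *v x1 = 0" "msqrt Q *v x2 = 0" "blk11 K *v (C *v x1) + blk12 K *v \<xi>1 = 0"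
        "blk11 K *v (C *v x2) + blk12 K *v \<xi>2 = 0"
      using za zb msqrt_pos_def_inj(1)[OF R] unfolding a b CcV vjoin_eq_0_iff by blast+
    have A12: "A *v x1 = - \<omega> *\<^sub>R x2" "A *v x2 = \<omega> *\<^sub>R x1"
    proof -
      have sc: "s *\<^sub>R vjoin x \<xi> = vjoin (s *\<^sub>R x) (s *\<^sub>R \<xi>)" for s x \<xi>
        by (simp add: vjoin_def vec_eq_iff all_sum_iff)
      show "A *v x1 = - \<omega> *\<^sub>R x2" "A *v x2 = \<omega> *\<^sub>R x1"
        using ab0 unfolding a b AcV c sc vjoin_eq_iff by simp_all
    qed
    have x1: "x1 = 0" by (rule observable_imaginary_mode[OF obs A12 c(1,2)])
    have x2: "x2 = 0"
      using observable_imaginary_mode[OF obs, of x2 \<omega> "- x1"] A12 c by (simp add: matrix_vector_bilinear)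
    obtain p1 q1 where p1: "P *v a = vjoin p1 q1" by (rule vjoin_cases)
    obtain p2 q2 where p2: "P *v b = vjoin p2 q2" by (rule vjoin_cases)
    have "P *v vjoin 0 \<xi> = vjoin (blk12 P *v \<xi>) (blk22 P *v \<xi>)" for \<xi>
      by (subst blk_collapse[of P, symmetric]) (simp add: hcat_vec vcat_vec)
    then have P12v: "p1 = blk12 P *v \<xi>1" "p2 = blk12 P *v \<xi>2" using p1 p2 unfolding a b x1 x2 by
        (simp_all add: vjoin_eq_iff)
    have BcV: "transpose Bc *v vjoin p q = vjoin (transpose (msqrt W) *v p)
        (transpose (msqrt V) *v (transpose (blk11 K) *v (transpose B *v p) + transpose (blk21 K) *v
            q))" for p q
      by (simp add: Bc_def B_cl_def block_transpose transpose_0 hcat_vec vcat_vec vjoin_add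
          matrix_transpose_mul
           matrix_vector_right_distrib del: transpose_matrix_vector flip: matrix_vector_mul_assoc)
    have AtV: "transpose Ac *v vjoin p q = vjoin (transpose A *v p + transpose C *v (transpose
        (blk11 K) *v (transpose B *v p) + transpose (blk21 K) *v q))
        (transpose (blk12 K) *v (transpose B *v p) + transpose (blk22 K) *v q)" for p q
      by (simp add: Ac_def A_cl_def block_transpose hcat_vec vcat_vec matrix_transpose_mul
          matrix_vector_right_distrib
           transpose_add matrix_vector_mult_add_rdistrib vjoin_add add.assoc
           del: transpose_matrix_vector flip: matrix_vector_mul_assoc)
    have w: "transpose (msqrt W) *v p1 = 0" "transpose (msqrt W) *v p2 = 0"
        "transpose (blk11 K) *v (transpose B *v p1) + transpose (blk21 K) *v q1 = 0"
        "transpose (blk11 K) *v (transpose B *v p2) + transpose (blk21 K) *v q2 = 0"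
      using za zb msqrt_pos_def_inj(2)[OF V] unfolding p1 p2 BcV vjoin_eq_0_iff by blast+
    (* P a and P b span a left invariant plane for the same imaginary eigenvalue *)
    have "transpose Ac *v (P *v a) = \<omega> *\<^sub>R (P *v b)" "transpose Ac *v (P *v b) = - \<omega> *\<^sub>R (P *v a)"
      using za zb unfolding ab0 matrix_vector_bilinear by (simp_all add: eq_neg_iff_add_eq_0 del:
          transpose_matrix_vector)
    then have At: "transpose A *v p1 = \<omega> *\<^sub>R p2" "transpose A *v p2 = - \<omega> *\<^sub>R p1"
    proof -
      have sc: "s *\<^sub>R vjoin x \<xi> = vjoin (s *\<^sub>R x) (s *\<^sub>R \<xi>)" for s x \<xi>
        by (simp add: vjoin_def vec_eq_iff all_sum_iff)
      assume "transpose Ac *v (P *v a) = \<omega> *\<^sub>R (P *v b)" "transpose Ac *v (P *v b) = - \<omega> *\<^sub>R (P *v a)"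
      then show "transpose A *v p1 = \<omega> *\<^sub>R p2" "transpose A *v p2 = - \<omega> *\<^sub>R p1"
        unfolding p1 p2 AtV w sc vjoin_eq_iff by (simp_all del: transpose_matrix_vector)
    qed
    have "p1 = 0" by (rule controllable_imaginary_mode[OF ctrl At w(1,2)])
    moreover have "p2 = 0"
      using At w by (intro controllable_imaginary_mode[OF ctrl, of p2 \<omega> "- p1"]) (simp_all add:
          matrix_vector_bilinear del: transpose_matrix_vector)
    moreover have "\<xi> = 0" if "blk12 P *v \<xi> = 0" for \<xi>
      using matrix_inv(2)[OF P12] that by (metis matrix_vector_mul_assoc matrix_vector_mul_lid
          matrix_vector_mult_0_right)
    ultimately have "\<xi>1 = 0" "\<xi>2 = 0" using P12v by auto
    then show False using nz by (simp add: a b x1 x2 vjoin_0)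
  qed
  ultimately show "\<alpha> < 0" by simp
qed

lemma T_zd_transfer: "T_zd A B C Q R W V K = transfer_matrix (A_cl A B C K) (B_cl B W V K) (C_cl C Q
    R K) (D_cl R V K)"
  by (simp add: T_zd_def transfer_matrix_def fun_eq_iff)

lemma brl_matrix_iff:
  assumes "P \<in> sym_mats"
  shows "neg_semidef (brl_matrix A B C Q R W V K \<gamma> P) \<longleftrightarrow>
    (\<forall>x u y. brl_form (A_cl A B C K) (B_cl B W V K) (C_cl C Q R K) (D_cl R V K) \<gamma> P x u y \<le> 0)"
  unfolding brl_matrix_def Let_def by (rule brl_lmi_iff[OF assms])

lemma projection_subset_epi:
  fixes A :: "real^'n^'n" and B :: "real^'m^'n" and C :: "real^'n^'p"
  assumes R: "pos_def R" and V: "pos_def V" and ctrl: "controllable A (msqrt W)" and obs: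
      "observable (msqrt Q) A"
    and L: "(K, \<gamma>, P) \<in> L_inf_d A B C Q R W V"
  shows "(K, \<gamma>) \<in> epi_ge (stabilizing A B C) (J_inf A B C Q R W V)"
proof -
  have P: "pos_def P" "invertible (blk12 P)" and lmi: "neg_semidef (brl_matrix A B C Q R W V K \<gamma> P)"
    using L by (auto simp: L_inf_d_def GL_def)
  have Psym: "P \<in> sym_mats" using P(1) by (simp add: pos_def_def)
  have h: "hurwitz (A_cl A B C K)" by (rule lmi_imp_hurwitz[OF R V ctrl obs P lmi])
  have "J_inf A B C Q R W V K \<le> ereal \<gamma>"
    unfolding J_inf_def Hinf_norm_def T_zd_transfer
    using lmi unfolding brl_matrix_iff[OF Psym]
    by (intro SUP_least) (simp add: bounded_real_converse[OF h Psym])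
  with h show ?thesis by (simp add: epi_ge_def stabilizing_def)
qed

lemma epi_subset_projection:
  fixes A :: "real^'n^'n" and B :: "real^'m^'n" and C :: "real^'n^'p"
  assumes K: "(K, \<gamma>) \<in> epi_gt (stabilizing A B C) (J_inf A B C Q R W V)"
  shows "\<exists>P. (K, \<gamma>, P) \<in> L_inf_d A B C Q R W V"
proof -
  define Ac where "Ac = A_cl A B C K"
  define Bc where "Bc = B_cl B W V K"
  define Cc where "Cc = C_cl C Q R K"
  define Dc where "Dc = D_cl R V K"
  note defs = Ac_def[symmetric] Bc_def[symmetric] Cc_def[symmetric] Dc_def[symmetric]
  define J where "J = J_inf A B C Q R W V K"
  have h: "hurwitz Ac" and J: "J < ereal \<gamma>" using K by (auto simp: epi_gt_def stabilizing_def Ac_def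
      J_def)
  let ?s = "\<lambda>\<omega>. sigma_max (transfer_matrix Ac Bc Cc Dc (\<i> * complex_of_real \<omega>))"
  have le: "ereal (?s \<omega>) \<le> J" for \<omega>
    unfolding J_def J_inf_def Hinf_norm_def T_zd_transfer defs by (rule SUP_upper) simp
  have "0 \<le> J" using le[of 0] sigma_max_nonneg by (meson ereal_less_eq(5) order_trans)
  then obtain c where c: "J = ereal c" "0 \<le> c" using J by (cases J) auto
  have c\<gamma>: "c < \<gamma>" using J by (simp add: c)
  have s: "?s \<omega> \<le> c" for \<omega> using le[of \<omega>] by (simp add: c)
  obtain P where "brl_strict Ac Bc Cc Dc \<gamma> P"
  proof (rule bounded_real_strict[OF h, of "c\<^sup>2" \<gamma> Bc Cc Dc])
    show "c\<^sup>2 < \<gamma>\<^sup>2" using c\<gamma> c(2) by (intro power_strict_mono) auto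
    fix \<omega> a b g k
    assume eqs: "Ac *v a + Bc *v g = - \<omega> *\<^sub>R b" "Ac *v b + Bc *v k = \<omega> *\<^sub>R a"
    let ?v = "complex_vec g k"
    have "norm (complex_vec (Cc *v a + Dc *v g) (Cc *v b + Dc *v k)) \<le> ?s \<omega> * norm ?v"
      unfolding transfer_matrix_apply[OF h eqs, symmetric] by (rule sigma_max(2))
    also have "\<dots> \<le> c * norm ?v" by (intro mult_right_mono s) simp
    finally have "(norm (complex_vec (Cc *v a + Dc *v g) (Cc *v b + Dc *v k)))\<^sup>2 \<le> (c * norm ?v)\<^sup>2"
      by (intro power_mono) simp_all
    then show "(norm (Cc *v a + Dc *v g))\<^sup>2 + (norm (Cc *v b + Dc *v k))\<^sup>2 \<le> c\<^sup>2 * ((norm g)\<^sup>2 +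
        (norm k)\<^sup>2)"
      by (simp only: power_mult_distrib norm_complex_vec power2_norm_eq_inner[of "_ + _"]
          power2_norm_eq_inner[of g] power2_norm_eq_inner[of k])
  qed auto
  then obtain P where P: "brl_strict Ac Bc Cc Dc \<gamma> P" "invertible (blk12 P)"
    using brl_strict_coupled by blast
  define P' where "P' = (1 / \<gamma>) *\<^sub>R P"
  have g0: "0 < \<gamma>" using c c\<gamma> by simp
  have P': "pos_def P'" "\<And>x u y. brl_form Ac Bc Cc Dc \<gamma> P' x u y \<le> 0"
    using brl_strict_imp_form[OF P(1) g0] by (simp_all add: P'_def)
  have "blk12 P' = (1 / \<gamma>) *\<^sub>R blk12 P" by (simp add: P'_def blk12_def vec_eq_iff)
  then have "invertible (blk12 P')" using scalar_invertible[OF _ P(2), of "1 / \<gamma>"] g0 by simp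
  moreover have "P' \<in> sym_mats" using P'(1) by (simp add: pos_def_def)
  ultimately show ?thesis using P' by (auto simp: L_inf_d_def GL_def brl_matrix_iff defs intro!:
      exI[of _ P'])
qed


section \<open>Calculus of continuously differentiable maps\<close>

lemma Ck_on_Suc_imp: "Ck_on (Suc k) E U f \<Longrightarrow> Ck_on k E U f"
proof (induction k arbitrary: f)
  case 0
  then show ?case
    by (auto simp: continuous_on_eq_continuous_within intro: has_derivative_continuous)
next
  case (Suc k)
  then show ?case by (metis Ck_on.simps(2))
qed

lemma Ck_on_const: "Ck_on k E U (\<lambda>x. c)"
proof (induction k arbitrary: c)
  case (Suc k)
  show ?case unfolding Ck_on.simps
    by (intro exI[of _ "\<lambda>x v. 0"]) (simp add: Suc)
qed simp

lemma Ck_on_bounded_linear: "bounded_linear f \<Longrightarrow> Ck_on k E U f"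
proof (cases k)
  case (Suc k')
  assume "bounded_linear f"
  then show ?thesis unfolding Suc Ck_on.simps
    by (intro exI[of _ "\<lambda>x. f"]) (auto intro: bounded_linear_imp_has_derivative Ck_on_const)
qed (simp add: linear_continuous_on)

lemma Ck_on_add: "Ck_on k E U f \<Longrightarrow> Ck_on k E U g \<Longrightarrow> Ck_on k E U (\<lambda>x. f x + g x)"
proof (induction k arbitrary: f g)
  case 0
  then show ?case by (simp add: continuous_on_add)
next
  case (Suc k)
  obtain f' where f': "\<And>x. x \<in> U \<Longrightarrow> (f has_derivative f' x) (at x within U)" "\<And>v. v \<in> E \<Longrightarrow> Ck_on k E U
      (\<lambda>x. f' x v)"
    using Suc.prems(1) by auto
  obtain g' where g': "\<And>x. x \<in> U \<Longrightarrow> (g has_derivative g' x) (at x within U)" "\<And>v. v \<in> E \<Longrightarrow> Ck_on k E U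
      (\<lambda>x. g' x v)"
    using Suc.prems(2) by auto
  show ?case unfolding Ck_on.simps
    by (intro exI[of _ "\<lambda>x v. f' x v + g' x v"]) (auto intro!: has_derivative_add f' g' Suc.IH)
qed

lemma Ck_on_linear_compose:
  assumes h: "bounded_linear h"
  shows "Ck_on k E U f \<Longrightarrow> Ck_on k E U (\<lambda>x. h (f x))"
proof (induction k arbitrary: f)
  case 0
  then show ?case using bounded_linear.continuous_on[OF h] by auto
next
  case (Suc k)
  obtain f' where f': "\<And>x. x \<in> U \<Longrightarrow> (f has_derivative f' x) (at x within U)" "\<And>v. v \<in> E \<Longrightarrow> Ck_on k E U
      (\<lambda>x. f' x v)"
    using Suc.prems by auto
  show ?case unfolding Ck_on.simps
    by (intro exI[of _ "\<lambda>x v. h (f' x v)"]) (auto intro!: bounded_linear.has_derivative[OF h] f' Suc.IH)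
qed

lemma Ck_on_bilinear:
  assumes h: "bounded_bilinear h"
  shows "Ck_on k E U f \<Longrightarrow> Ck_on k E U g \<Longrightarrow> Ck_on k E U (\<lambda>x. h (f x) (g x))"
proof (induction k arbitrary: f g)
  case 0
  then show ?case using bounded_bilinear.continuous_on[OF h] by auto
next
  case (Suc k)
  obtain f' where f': "\<And>x. x \<in> U \<Longrightarrow> (f has_derivative f' x) (at x within U)" "\<And>v. v \<in> E \<Longrightarrow> Ck_on k E U
      (\<lambda>x. f' x v)"
    using Suc.prems(1) by auto
  obtain g' where g': "\<And>x. x \<in> U \<Longrightarrow> (g has_derivative g' x) (at x within U)" "\<And>v. v \<in> E \<Longrightarrow> Ck_on k E U
      (\<lambda>x. g' x v)"
    using Suc.prems(2) by auto
  show ?case unfolding Ck_on.simps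
    by (intro exI[of _ "\<lambda>x v. h (f x) (g' x v) + h (f' x v) (g x)"])
       (auto intro!: bounded_bilinear.FDERIV[OF h] f' g' Suc.IH Ck_on_add Ck_on_Suc_imp[OF
           Suc.prems(1)] Ck_on_Suc_imp[OF Suc.prems(2)])
qed

lemma invertible_open: "open {M :: real^'n^'n. invertible M}"
proof -
  have "continuous_on UNIV (\<lambda>M :: real^'n^'n. det M)"
    unfolding det_def by (intro continuous_intros)
  then have "open ((\<lambda>M :: real^'n^'n. det M) -` (- {0}))"
    by (intro open_vimage) auto
  moreover have "{M :: real^'n^'n. invertible M} = (\<lambda>M. det M) -` (- {0})"
    by (auto simp: invertible_det_nz)
  ultimately show ?thesis by simp
qed

text \<open>Cramer's rule, which gives the continuity of the matrix inverse.\<close>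

lemma matrix_inv_cramer:
  fixes M :: "real^'n^'n"
  assumes M: "invertible M"
  shows "matrix_inv M = (\<chi> k j. det (\<chi> i l. if l = k then axis j 1 $ i else M $ i $ l) / det M)"
proof -
  have d: "det M \<noteq> 0" using M by (simp add: invertible_det_nz)
  obtain N where N: "M ** N = mat 1" using M invertible_def by blast
  have "N $ k $ j = det (\<chi> i l. if l = k then axis j 1 $ i else M $ i $ l) / det M" for k j
  proof -
    have "M *v (N *v axis j 1) = axis j 1" by (simp add: matrix_vector_mul_assoc N)
    then have "N *v axis j 1 = (\<chi> k. det (\<chi> i l. if l = k then axis j 1 $ i else M $ i $ l) / det M)"
      by (rule cramer[OF d, THEN iffD1])
    moreover have "(N *v axis j 1) $ k = N $ k $ j"
      by (simp add: matrix_vector_mult_basis column_def)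
    ultimately show ?thesis by simp
  qed
  then show ?thesis using matrix_inv_unique[OF N] by (simp add: vec_eq_iff)
qed

lemma continuous_on_matrix_inv: "continuous_on {M :: real^'n^'n. invertible M} matrix_inv"
proof -
  have "continuous_on {M :: real^'n^'n. invertible M}
      (\<lambda>M. \<chi> k j. det (\<chi> i l. if l = k then axis j 1 $ i else M $ i $ l) / det M)"
  proof (intro continuous_on_vec_lambda continuous_on_divide ballI)
    have c: "continuous_on S (\<lambda>M. if b then c else (M :: real^'n^'n) $ i $ l)" for S b c i l
      by (cases b) (auto intro!: continuous_intros)
    show "continuous_on {M :: real^'n^'n. invertible M} (\<lambda>M. det (\<chi> i l. if l = k then axis j 1 $ i
        else M $ i $ l))" for k j
      unfolding det_def by (intro continuous_intros) (simp add: c)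
    show "continuous_on {M :: real^'n^'n. invertible M} det"
      unfolding det_def by (intro continuous_intros)
  qed (auto simp: invertible_det_nz)
  then show ?thesis
    by (rule continuous_on_cong[THEN iffD1, rotated -1]) (auto simp: matrix_inv_cramer)
qed

lemma has_derivative_matrix_inv:
  fixes M :: "real^'n^'n"
  assumes M: "invertible M"
  shows "(matrix_inv has_derivative (\<lambda>H. - (matrix_inv M ** H ** matrix_inv M))) (at M)"
proof -
  note bl = bounded_bilinear_matrix_mult
  obtain K where K: "0 < K" "\<And>(A :: real^'n^'n) (B :: real^'n^'n). norm (A ** B) \<le> norm A * norm B * K"
    using bounded_bilinear.pos_bounded[OF bl] by blast
  have lin: "bounded_linear (\<lambda>H. - (matrix_inv M ** H ** matrix_inv M))"
    by (intro bounded_linear_minus bounded_linear_compose[OF bounded_bilinear.bounded_linear_left[OF bl]]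
        bounded_bilinear.bounded_linear_right[OF bl])
  have cont: "(matrix_inv \<longlongrightarrow> matrix_inv M) (at M)"
    using continuous_on_matrix_inv M unfolding continuous_on_eq_continuous_at[OF invertible_open]
        isCont_def by blast
  have ev: "\<forall>\<^sub>F N in at M. invertible N"
    using eventually_at_topological invertible_open M by (metis mem_Collect_eq)
  define c where "c = norm (matrix_inv M) * K"
  have "((\<lambda>N. norm (matrix_inv N - matrix_inv M) * (c * K)) \<longlongrightarrow> 0) (at M)"
    using tendsto_mult_right[OF tendsto_norm[OF tendsto_diff[OF cont tendsto_const[of "matrix_inv
        M"]]], of "c * K"] by simp
  moreover have "norm ((matrix_inv N - matrix_inv M - - (matrix_inv M ** (N - M) ** matrix_inv M))
      /\<^sub>R norm (N - M))
      \<le> norm (matrix_inv N - matrix_inv M) * (c * K)" if N: "invertible N" "N \<noteq> M" for N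
  proof -
    let ?H = "N - M"
    have 1: "matrix_inv N - matrix_inv M = - (matrix_inv N ** ?H ** matrix_inv M)"
    proof -
      have "matrix_inv N ** ?H ** matrix_inv M = matrix_inv N ** N ** matrix_inv M - matrix_inv N **
          (M ** matrix_inv M)"
        by (simp add: matrix_mult_bilinear matrix_mul_assoc)
      then show ?thesis using matrix_inv(1)[OF M] matrix_inv(2)[OF N(1)] by simp
    qed
    have "matrix_inv N - matrix_inv M - - (matrix_inv M ** ?H ** matrix_inv M) = - ((matrix_inv N -
        matrix_inv M) ** ?H ** matrix_inv M)"
      by (subst 1) (simp add: matrix_mult_bilinear)
    then have "norm (matrix_inv N - matrix_inv M - - (matrix_inv M ** ?H ** matrix_inv M)) = norm
        ((matrix_inv N - matrix_inv M) ** ?H ** matrix_inv M)"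
      by (simp only: norm_minus_cancel)
    also have "\<dots> \<le> norm ((matrix_inv N - matrix_inv M) ** ?H) * norm (matrix_inv M) * K"
      using K(2)[of "(matrix_inv N - matrix_inv M) ** ?H" "matrix_inv M"] .
    also have "\<dots> \<le> (norm (matrix_inv N - matrix_inv M) * norm ?H * K) * norm (matrix_inv M) * K"
      using K by (intro mult_right_mono) auto
    also have "\<dots> = norm ?H * (norm (matrix_inv N - matrix_inv M) * (c * K))" by (simp add: c_def mult_ac)
    finally show ?thesis using N(2) by (simp add: divide_simps mult.commute)
  qed
  then have "\<forall>\<^sub>F N in at M. norm ((matrix_inv N - matrix_inv M - - (matrix_inv M ** (N - M) **
      matrix_inv M)) /\<^sub>R norm (N - M))
      \<le> norm (matrix_inv N - matrix_inv M) * (c * K)"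
    using ev by (auto simp: eventually_at_filter elim: eventually_mono)
  ultimately have "((\<lambda>N. (matrix_inv N - matrix_inv M - - (matrix_inv M ** (N - M) ** matrix_inv M))
      /\<^sub>R norm (N - M)) \<longlongrightarrow> 0) (at M)"
    by (rule Lim_null_comparison[rotated])
  then show ?thesis unfolding has_derivative_at_within using lin by (simp add: divide_inverse_commute)
qed

lemma Ck_on_matrix_inv:
  fixes f :: "'a::euclidean_space \<Rightarrow> real^'n^'n"
  assumes inv: "\<And>x. x \<in> U \<Longrightarrow> invertible (f x)"
  shows "Ck_on k E U f \<Longrightarrow> Ck_on k E U (\<lambda>x. matrix_inv (f x))"
proof (induction k)
  case 0
  then show ?case using inv by (auto intro!: continuous_on_compose2[OF continuous_on_matrix_inv])
next
  case (Suc k)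
  obtain f' where f': "\<And>x. x \<in> U \<Longrightarrow> (f has_derivative f' x) (at x within U)" "\<And>v. v \<in> E \<Longrightarrow> Ck_on k E U
      (\<lambda>x. f' x v)"
    using Suc.prems by auto
  have IH: "Ck_on k E U (\<lambda>x. matrix_inv (f x))" by (rule Suc.IH[OF Ck_on_Suc_imp[OF Suc.prems]])
  note mm = Ck_on_bilinear[OF bounded_bilinear_matrix_mult]
  show ?case unfolding Ck_on.simps
  proof (intro exI[of _ "\<lambda>x v. - (matrix_inv (f x) ** f' x v ** matrix_inv (f x))"] conjI ballI)
    fix x assume "x \<in> U"
    then show "((\<lambda>x. matrix_inv (f x)) has_derivative (\<lambda>v. - (matrix_inv (f x) ** f' x v **
        matrix_inv (f x)))) (at x within U)"
      using has_derivative_compose[OF f'(1) has_derivative_matrix_inv[OF inv]] by simp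
  next
    fix v assume "v \<in> E"
    then show "Ck_on k E U (\<lambda>x. - (matrix_inv (f x) ** f' x v ** matrix_inv (f x)))"
      by (intro Ck_on_linear_compose[OF bounded_linear_minus[OF bounded_linear_ident]] mm IH f')
  qed
qed

lemma Ck_on_Pair: "Ck_on k E U f \<Longrightarrow> Ck_on k E U g \<Longrightarrow> Ck_on k E U (\<lambda>x. (f x, g x))"
proof -
  assume fg: "Ck_on k E U f" "Ck_on k E U g"
  have l: "bounded_linear (\<lambda>y :: 'b. (y, 0 :: 'c))" "bounded_linear (\<lambda>z :: 'c. (0 :: 'b, z))"
    by (auto intro!: bounded_linear_Pair bounded_linear_ident bounded_linear_zero)
  have "Ck_on k E U (\<lambda>x. (f x, 0) + (0, g x))"
    by (intro Ck_on_add Ck_on_linear_compose[OF l(1)] Ck_on_linear_compose[OF l(2)] fg)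
  then show ?thesis by simp
qed

lemma Ck_on_fst: "Ck_on k E U f \<Longrightarrow> Ck_on k E U (\<lambda>x. fst (f x))"
  by (rule Ck_on_linear_compose[OF bounded_linear_fst])

lemma Ck_on_snd: "Ck_on k E U f \<Longrightarrow> Ck_on k E U (\<lambda>x. snd (f x))"
  by (rule Ck_on_linear_compose[OF bounded_linear_snd])

lemma Ck_on_uminus: "Ck_on k E U f \<Longrightarrow> Ck_on k E U (\<lambda>x. - f x)"
  by (rule Ck_on_linear_compose[OF bounded_linear_minus[OF bounded_linear_ident]])

lemma Ck_on_diff: "Ck_on k E U f \<Longrightarrow> Ck_on k E U g \<Longrightarrow> Ck_on k E U (\<lambda>x. f x - g x)"
  using Ck_on_add[of k E U f "\<lambda>x. - g x"] Ck_on_uminus[of k E U g] by simp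

lemma linear_block_ops:
  "linear (blk11 :: real^('c::finite + 'd::finite)^('r::finite + 's::finite) \<Rightarrow> _)"
  "linear (blk12 :: real^('c::finite + 'd::finite)^('r::finite + 's::finite) \<Rightarrow> _)"
  "linear (blk21 :: real^('c::finite + 'd::finite)^('r::finite + 's::finite) \<Rightarrow> _)"
  "linear (blk22 :: real^('c::finite + 'd::finite)^('r::finite + 's::finite) \<Rightarrow> _)"
  "linear (transpose :: real^'a^'b \<Rightarrow> _)"
  by (auto intro!: linearI simp: blk11_def blk12_def blk21_def blk22_def transpose_def vec_eq_iff)

lemmas Ck_on_block_ops = linear_block_ops[THEN linear_conv_bounded_linear[THEN iffD1], THEN
    Ck_on_linear_compose]

lemma Ck_on_hcat: "Ck_on k E U f \<Longrightarrow> Ck_on k E U g \<Longrightarrow> Ck_on k E U (\<lambda>x. f x <|> g x)"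
  for f :: "'a::euclidean_space \<Rightarrow> real^'c^'r" and g :: "'a \<Rightarrow> real^'d^'r"
proof -
  assume fg: "Ck_on k E U f" "Ck_on k E U g"
  have "linear (\<lambda>M :: real^'c^'r. M <|> (0 :: real^'d^'r))" "linear (\<lambda>N :: real^'d^'r. (0 ::
      real^'c^'r) <|> N)"
    by (auto intro!: linearI simp: hcat_def vec_eq_iff all_sum_iff)
  then have l: "bounded_linear (\<lambda>M :: real^'c^'r. M <|> (0 :: real^'d^'r))" "bounded_linear (\<lambda>N ::
      real^'d^'r. (0 :: real^'c^'r) <|> N)"
    by (simp_all add: linear_conv_bounded_linear)
  have "Ck_on k E U (\<lambda>x. (f x <|> 0) + (0 <|> g x))"
    by (intro Ck_on_add Ck_on_linear_compose[OF l(1)] Ck_on_linear_compose[OF l(2)] fg)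
  then show ?thesis by (simp add: hcat_add)
qed

lemma Ck_on_vcat: "Ck_on k E U f \<Longrightarrow> Ck_on k E U g \<Longrightarrow> Ck_on k E U (\<lambda>x. f x </> g x)"
  for f :: "'a::euclidean_space \<Rightarrow> real^'c^'r" and g :: "'a \<Rightarrow> real^'c^'s"
proof -
  assume fg: "Ck_on k E U f" "Ck_on k E U g"
  have "linear (\<lambda>M :: real^'c^'r. M </> (0 :: real^'c^'s))" "linear (\<lambda>N :: real^'c^'s. (0 ::
      real^'c^'r) </> N)"
    by (auto intro!: linearI simp: vcat_def vec_eq_iff all_sum_iff)
  then have l: "bounded_linear (\<lambda>M :: real^'c^'r. M </> (0 :: real^'c^'s))" "bounded_linear (\<lambda>N ::
      real^'c^'s. (0 :: real^'c^'r) </> N)"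
    by (simp_all add: linear_conv_bounded_linear)
  have "Ck_on k E U (\<lambda>x. (f x </> 0) + (0 </> g x))"
    by (intro Ck_on_add Ck_on_linear_compose[OF l(1)] Ck_on_linear_compose[OF l(2)] fg)
  then show ?thesis by (simp add: vcat_add)
qed

lemmas Ck_on_matrix_mult = Ck_on_bilinear[OF bounded_bilinear_matrix_mult]

lemma Ck_on_id: "Ck_on k E U (\<lambda>x. x)"
  by (rule Ck_on_bounded_linear[OF bounded_linear_ident])

lemmas Ck_on_intros = Ck_on_const Ck_on_add Ck_on_diff Ck_on_uminus Ck_on_Pair Ck_on_block_ops
  Ck_on_hcat Ck_on_vcat Ck_on_matrix_mult Ck_on_fst Ck_on_snd Ck_on_id

lemma Ck_on_Phi:
  assumes "\<And>z. z \<in> U \<Longrightarrow> invertible (snd (snd z))"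
  shows "Ck_on k E U (Phi_inf_d A B C)"
proof -
  have "Phi_inf_d A B C = (\<lambda>z. Phi_inf_d A B C (fst z, fst (snd z), snd (snd z)))" by (simp add:
      fun_eq_iff)
  then show ?thesis unfolding Phi_inf_d.simps Let_def
    by (simp only:) (intro Ck_on_intros Ck_on_matrix_inv assms)
qed

lemma Ck_on_Psi:
  assumes inv: "\<And>\<gamma> \<Lambda> X Y \<Xi>. ((\<gamma>, \<Lambda>, X, Y), \<Xi>) \<in> U \<Longrightarrow>
      invertible X \<and> invertible \<Xi> \<and> invertible (Y - matrix_inv X) \<and>
      invertible (mat 1 <|> 0 </> Y ** B <|> \<Xi>) \<and>
      invertible (mat 1 <|> C ** X </> 0 <|> - (matrix_inv \<Xi> ** (Y - matrix_inv X) ** X))"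
  shows "Ck_on k E U (Psi_inf_d A B C)"
proof -
  have "Psi_inf_d A B C = (\<lambda>z. Psi_inf_d A B C ((fst (fst z), fst (snd (fst z)), fst (snd (snd (fst
      z))), snd (snd (snd (fst z)))), snd z))"
    by (simp add: fun_eq_iff)
  moreover have "Ck_on k E U (\<lambda>z. Psi_inf_d A B C ((fst (fst z), fst (snd (fst z)), fst (snd (snd
      (fst z))), snd (snd (snd (fst z)))), snd z))"
    unfolding Psi_inf_d.simps Let_def
    by (intro Ck_on_intros Ck_on_matrix_inv) (auto dest: inv)
  ultimately show ?thesis by simp
qed


section \<open>The change of variables\<close>

lemma pos_def_invertible: "pos_def (M :: real^'n^'n) \<Longrightarrow> invertible M"
proof -
  assume M: "pos_def M"
  have "x = 0" if "M *v x = 0" for x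
    using M that unfolding pos_def_def by (metis inner_zero_right less_irrefl)
  then show "invertible M" using matrix_left_invertible_ker[of M] invertible_left_inverse by blast
qed

lemma sym_mats_inv:
  assumes M: "M \<in> sym_mats" "invertible M"
  shows "matrix_inv M \<in> sym_mats"
proof -
  have "transpose (matrix_inv M ** M) = mat 1" by (simp add: matrix_inv(2)[OF M(2)])
  then have "M ** transpose (matrix_inv M) = mat 1"
    using M(1) unfolding matrix_transpose_mul by (simp add: sym_mats_def)
  then have "matrix_inv M = transpose (matrix_inv M)" by (rule matrix_inv_unique)
  then show ?thesis unfolding sym_mats_def mem_Collect_eq by (rule sym)
qed

lemma invertible_cancel_right:
  assumes "invertible N" "M ** N = L ** N"
  shows "M = L"
  using arg_cong[OF assms(2), of "\<lambda>Z. Z ** matrix_inv N"] matrix_inv(1)[OF assms(1)]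
  by (simp add: matrix_mul_assoc[symmetric])

lemma schur_pos_def:
  fixes X Y :: "real^'n^'n"
  assumes XY: "pos_def (X <|> mat 1 </> mat 1 <|> Y)"
  shows "X \<in> sym_mats" "Y \<in> sym_mats" "pos_def X" "pos_def (Y - matrix_inv X)"
proof -
  show X: "X \<in> sym_mats" and Y: "Y \<in> sym_mats" using XY by (simp_all add: pos_def_def sym_blocks_iff)
  have pos: "0 < x \<bullet> (X *v x) + 2 * (x \<bullet> y) + y \<bullet> (Y *v y)" if "(x, y) \<noteq> (0, 0)" for x y
  proof -
    have "vjoin x y \<noteq> 0" using that by (simp add: vjoin_eq_0_iff)
    then have "0 < vjoin x y \<bullet> ((X <|> mat 1 </> mat 1 <|> Y) *v vjoin x y)"
      using XY unfolding pos_def_def by blast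
    then show ?thesis by (simp add: hcat_vec vcat_vec inner_vjoin inner_add_right inner_commute[of y x])
  qed
  show Xp: "pos_def X" unfolding pos_def_def using X pos[of _ 0] by auto
  have inv: "invertible X" by (rule pos_def_invertible[OF Xp])
  have Xi: "matrix_inv X \<in> sym_mats" by (rule sym_mats_inv[OF X inv])
  have "0 < y \<bullet> ((Y - matrix_inv X) *v y)" if "y \<noteq> 0" for y
  proof -
    have "X *v (matrix_inv X *v y) = y" by (simp add: matrix_vector_mul_assoc matrix_inv[OF inv])
    then show ?thesis using pos[of "- (matrix_inv X *v y)" y] that
      by (simp add: matrix_vector_bilinear inner_diff_right inner_commute[of _ y])
  qed
  then show "pos_def (Y - matrix_inv X)"
    using Y Xi by (auto simp: pos_def_def sym_mats_iff matrix_vector_bilinear inner_diff_left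
        inner_diff_right)
qed

text \<open>
  The relation between a lifted matrix \<open>P\<close> and the new variables: \<open>P\<close> is symmetric with first block row
  \<open>(Y, \<Xi>)\<close>, the block \<open>\<Xi>\<close> is invertible, and \<open>X\<close>, \<open>X21\<close> solve the equations for the first block column of the
  inverse of \<open>P\<close>. The definition does not require \<open>P\<close> to be invertible.
\<close>

definition linked :: "real^('n::finite + 'n)^('n + 'n) \<Rightarrow> real^'n^'n \<Rightarrow> real^'n^'n \<Rightarrow> real^'n^'n \<Rightarrow>
    real^'n^'n \<Rightarrow> bool"
  where "linked P X X21 Y \<Xi> \<longleftrightarrow> P \<in> sym_mats \<and> invertible \<Xi> \<and> blk11 P = Y \<and> blk12 P = \<Xi> \<and>
    Y ** X + \<Xi> ** X21 = mat 1 \<and> transpose \<Xi> ** X + blk22 P ** X21 = 0"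

lemma linkedD:
  assumes "linked P X X21 Y \<Xi>"
  shows "P ** (X <|> mat 1 </> X21 <|> 0) = (mat 1 <|> Y </> 0 <|> transpose \<Xi>)"
    and "P = (Y <|> \<Xi> </> transpose \<Xi> <|> blk22 P)" and "Y \<in> sym_mats"
proof -
  have P: "P = (Y <|> \<Xi> </> blk21 P <|> blk22 P)" using assms blk_collapse[of P] by (simp add:
      linked_def)
  have "P \<in> sym_mats" using assms by (simp add: linked_def)
  then have s: "Y \<in> sym_mats" "blk21 P = transpose \<Xi>" using sym_blocks_iff[of Y \<Xi> "blk21 P" "blk22
      P"] P by auto
  then show 1: "P = (Y <|> \<Xi> </> transpose \<Xi> <|> blk22 P)" "Y \<in> sym_mats" using P by simp_all
  show "P ** (X <|> mat 1 </> X21 <|> 0) = (mat 1 <|> Y </> 0 <|> transpose \<Xi>)"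
    using assms by (subst 1(1)) (simp add: linked_def block_mult hcat_add)
qed

lemma linked_congruence:
  fixes P :: "real^('n::finite + 'n)^('n + 'n)"
  assumes l: "linked P X X21 Y \<Xi>" and X: "X \<in> sym_mats"
  defines "T \<equiv> (X <|> mat 1 </> X21 <|> 0)"
  shows "invertible T" and "(T *v z) \<bullet> (P *v (T *v z)) = z \<bullet> ((X <|> mat 1 </> mat 1 <|> Y) *v z)"
    and "pos_def P \<longleftrightarrow> pos_def (X <|> mat 1 </> mat 1 <|> Y)"
proof -
  note PT = linkedD(1)[OF l, folded T_def]
  have \<Xi>: "invertible \<Xi>" and e: "Y ** X + \<Xi> ** X21 = mat 1" using l by (auto simp: linked_def)
  have Y: "Y \<in> sym_mats" using linkedD(3)[OF l] .
  have "z = 0" if "T *v z = 0" for z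
  proof -
    obtain a b where z: "z = vjoin a b" by (rule vjoin_cases)
    have "(mat 1 <|> Y </> 0 <|> transpose \<Xi>) *v z = 0" using that unfolding PT[symmetric]
        matrix_vector_mul_assoc[symmetric] by simp
    then have eq: "a + Y *v b = 0" "transpose \<Xi> *v b = 0"
      by (simp_all add: z hcat_vec vcat_vec vjoin_eq_0_iff del: transpose_matrix_vector)
    have "b = matrix_inv (transpose \<Xi>) *v (transpose \<Xi> *v b)"
      unfolding matrix_vector_mul_assoc matrix_inv(2)[OF transpose_invertible[OF \<Xi>]] by simp
    then have "b = 0" using eq(2) by (metis matrix_vector_mult_0_right)
    then show "z = 0" using eq(1) by (simp add: z vjoin_0)
  qed
  then show Tinv: "invertible T" using matrix_left_invertible_ker[of T] invertible_left_inverse by blast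
  have "transpose (Y ** X + \<Xi> ** X21) = mat 1" using e by simp
  then have e': "X ** Y + transpose X21 ** transpose \<Xi> = mat 1"
    using X Y by (simp add: transpose_add matrix_transpose_mul sym_mats_def)
  have TPT: "transpose T ** (P ** T) = (X <|> mat 1 </> mat 1 <|> Y)"
    unfolding PT unfolding T_def using X e'
    by (simp add: block_transpose hcat_of_vcats block_mult hcat_add transpose_0 sym_mats_def)
  show q: "(T *v z) \<bullet> (P *v (T *v z)) = z \<bullet> ((X <|> mat 1 </> mat 1 <|> Y) *v z)" for z
    unfolding TPT[symmetric] matrix_vector_mul_assoc[symmetric] inner_transpose by (rule inner_commute)
  have Psym: "P \<in> sym_mats" using l by (simp add: linked_def)
  have Ssym: "(X <|> mat 1 </> mat 1 <|> Y) \<in> sym_mats" using X Y by (simp add: sym_blocks_iff)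
  have T1: "T *v (matrix_inv T *v z) = z" for z
    by (simp add: matrix_vector_mul_assoc matrix_inv[OF Tinv])
  have T2: "matrix_inv T *v (T *v z) = z" for z
    by (simp add: matrix_vector_mul_assoc matrix_inv[OF Tinv])
  show "pos_def P \<longleftrightarrow> pos_def (X <|> mat 1 </> mat 1 <|> Y)"
  proof
    assume P: "pos_def P"
    have "0 < z \<bullet> ((X <|> mat 1 </> mat 1 <|> Y) *v z)" if "z \<noteq> 0" for z
    proof -
      have "T *v z \<noteq> 0" using that T2[of z] by auto
      then show ?thesis using P unfolding q[symmetric] pos_def_def by blast
    qed
    then show "pos_def (X <|> mat 1 </> mat 1 <|> Y)" using Ssym by (simp add: pos_def_def)
  next
    assume S: "pos_def (X <|> mat 1 </> mat 1 <|> Y)"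
    have "0 < z \<bullet> (P *v z)" if "z \<noteq> 0" for z
    proof -
      have "matrix_inv T *v z \<noteq> 0" using that T1[of z] by auto
      then have "0 < (T *v (matrix_inv T *v z)) \<bullet> (P *v (T *v (matrix_inv T *v z)))"
        using S unfolding q pos_def_def by blast
      then show ?thesis unfolding T1 .
    qed
    then show "pos_def P" using Psym by (simp add: pos_def_def)
  qed
qed

lemma linked_inverse:
  assumes P: "pos_def P" and inv: "invertible (blk12 P)"
  shows "linked P (blk11 (matrix_inv P)) (blk21 (matrix_inv P)) (blk11 P) (blk12 P)"
    and "blk11 (matrix_inv P) \<in> sym_mats"
proof -
  define N where "N = matrix_inv P"
  have Psym: "P \<in> sym_mats" using P by (simp add: pos_def_def)
  have Pinv: "invertible P" by (rule pos_def_invertible[OF P])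
  have "(blk11 P <|> blk12 P </> blk21 P <|> blk22 P) ** (blk11 N <|> blk12 N </> blk21 N <|> blk22
      N) = (mat 1 <|> 0 </> 0 <|> mat 1)"
    unfolding blk_collapse mat_blocks N_def by (rule matrix_inv(1)[OF Pinv])
  moreover have "blk21 P = transpose (blk12 P)"
    using Psym sym_blocks_iff[of "blk11 P" "blk12 P" "blk21 P" "blk22 P"] by (simp add: blk_collapse)
  ultimately show "linked P (blk11 (matrix_inv P)) (blk21 (matrix_inv P)) (blk11 P) (blk12 P)"
    using Psym inv unfolding N_def[symmetric]
    by (simp add: linked_def block_mult hcat_add vcat_eq_iff hcat_eq_iff)
  have "N \<in> sym_mats" unfolding N_def by (rule sym_mats_inv[OF Psym Pinv])
  then show "blk11 (matrix_inv P) \<in> sym_mats" unfolding N_def[symmetric]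
    using sym_blocks_iff[of "blk11 N" "blk12 N" "blk21 N" "blk22 N"] by (simp add: blk_collapse)
qed

lemma linked_unique:
  assumes l: "linked P X X21 Y \<Xi>" and P: "invertible P"
  shows "blk11 (matrix_inv P) = X" "blk21 (matrix_inv P) = X21"
proof -
  define N where "N = matrix_inv P"
  have "N ** (P ** (X <|> mat 1 </> X21 <|> 0)) = (X <|> mat 1 </> X21 <|> 0)"
    using matrix_inv(2)[OF P] by (simp add: matrix_mul_assoc N_def)
  then have "(blk11 N <|> blk12 N </> blk21 N <|> blk22 N) ** (mat 1 <|> Y </> 0 <|> transpose \<Xi>) =
      (X <|> mat 1 </> X21 <|> 0)"
    unfolding blk_collapse linkedD(1)[OF l] .
  then show "blk11 (matrix_inv P) = X" "blk21 (matrix_inv P) = X21"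
    unfolding N_def[symmetric] by (simp_all add: block_mult hcat_add vcat_eq_iff hcat_eq_iff)
qed

text \<open>If \<open>X\<close>, \<open>Y\<close>, \<open>\<Xi>\<close> satisfy the constraints of the convex formulation, there is exactly one linked pair
  of \<open>P\<close> and \<open>X21\<close>, given by the formula in \<open>\<Psi>\<close>.\<close>

lemma linked_explicit:
  fixes X Y \<Xi> :: "real^'n^'n"
  assumes XY: "pos_def (X <|> mat 1 </> mat 1 <|> Y)" and \<Xi>: "invertible \<Xi>"
  defines "\<Delta> \<equiv> Y - matrix_inv X"
  defines "P \<equiv> (Y <|> \<Xi> </> transpose \<Xi> <|> transpose \<Xi> ** matrix_inv \<Delta> ** \<Xi>)"
  shows "linked P X (- (matrix_inv \<Xi> ** \<Delta> ** X)) Y \<Xi>" "invertible (- (matrix_inv \<Xi> ** \<Delta> ** X))"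
    and "linked P' X Z Y \<Xi> \<Longrightarrow> Z = - (matrix_inv \<Xi> ** \<Delta> ** X) \<and> P' = P"
proof -
  note s = schur_pos_def[OF XY, folded \<Delta>_def]
  have Xi: "invertible X" and Di: "invertible \<Delta>" using s pos_def_invertible by auto
  define X21 where "X21 = - (matrix_inv \<Xi> ** \<Delta> ** X)"
  have DX: "\<Delta> ** X = Y ** X - mat 1" by (simp add: \<Delta>_def matrix_mult_bilinear matrix_inv[OF Xi])
  have 1: "Y ** X + \<Xi> ** X21 = mat 1"
    by (simp add: X21_def matrix_mult_bilinear matrix_mul_assoc matrix_inv[OF \<Xi>] DX)
  have \<Xi>X: "\<Xi> ** X21 = - (\<Delta> ** X)"
    by (simp add: X21_def matrix_mult_bilinear matrix_mul_assoc matrix_inv[OF \<Xi>])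
  have 2: "transpose \<Xi> ** X + transpose \<Xi> ** matrix_inv \<Delta> ** \<Xi> ** X21 = 0"
  proof -
    have "transpose \<Xi> ** matrix_inv \<Delta> ** \<Xi> ** X21 = transpose \<Xi> ** (matrix_inv \<Delta> ** (\<Xi> ** X21))"
      by (simp add: matrix_mul_assoc)
    also have "\<dots> = - (transpose \<Xi> ** ((matrix_inv \<Delta> ** \<Delta>) ** X))"
      unfolding \<Xi>X by (simp add: matrix_mult_bilinear matrix_mul_assoc)
    also have "\<dots> = - (transpose \<Xi> ** X)" by (simp add: matrix_inv[OF Di])
    finally show ?thesis by simp
  qed
  have Di_sym: "matrix_inv \<Delta> \<in> sym_mats" using s(4) Di by (intro sym_mats_inv) (auto simp: pos_def_def)
  have "P \<in> sym_mats" unfolding P_def sym_blocks_iff using s(2) Di_sym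
    by (simp add: sym_mats_def matrix_transpose_mul matrix_mul_assoc)
  then show "linked P X (- (matrix_inv \<Xi> ** \<Delta> ** X)) Y \<Xi>"
    using 1 2 \<Xi> unfolding X21_def[symmetric] linked_def by (simp add: P_def)
  have "invertible (matrix_inv \<Xi>)" using matrix_inv[OF \<Xi>] invertible_def by blast
  then have "invertible (matrix_inv \<Xi> ** \<Delta> ** X)" using Di Xi by (intro invertible_mult)
  then have X21i: "invertible X21" unfolding X21_def using scalar_invertible[of "-1" "matrix_inv \<Xi>
      ** \<Delta> ** X"] by simp
  then show "invertible (- (matrix_inv \<Xi> ** \<Delta> ** X))" by (simp add: X21_def)
  assume l: "linked P' X Z Y \<Xi>"
  then have e: "Y ** X + \<Xi> ** Z = mat 1" "transpose \<Xi> ** X + blk22 P' ** Z = 0" by (auto simp: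
      linked_def)
  have "\<Xi> ** Z = \<Xi> ** X21" using e(1) 1 by (metis add_left_cancel)
  then have "matrix_inv \<Xi> ** (\<Xi> ** Z) = matrix_inv \<Xi> ** (\<Xi> ** X21)" by simp
  then have Z: "Z = X21" by (simp add: matrix_mul_assoc matrix_inv[OF \<Xi>])
  have "blk22 P' ** X21 = transpose \<Xi> ** matrix_inv \<Delta> ** \<Xi> ** X21"
    using e(2) 2 unfolding Z by (metis add_left_cancel)
  then have "blk22 P' = transpose \<Xi> ** matrix_inv \<Delta> ** \<Xi>" by (rule invertible_cancel_right[OF X21i])
  then show "Z = - (matrix_inv \<Xi> ** \<Delta> ** X) \<and> P' = P" using Z linkedD(2)[OF l] by (simp add: X21_def
      P_def)
qed

lemma M_lmi_quadratic_form:
  fixes A :: "real^'n^'n" and B :: "real^'m^'n" and C :: "real^'n^'p"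
  shows "vjoin a (vjoin b (vjoin u y)) \<bullet> (M_lmi A B C Q R W V \<gamma> (G <|> F </> H <|> M) X Y *v vjoin a
      (vjoin b (vjoin u y))) =
    2 * (a \<bullet> ((A ** X + B ** F) *v a)) + 2 * (a \<bullet> ((transpose M + A + B ** G ** C) *v b))
    + 2 * (a \<bullet> ((B1_mat W + B ** G ** D21_mat V) *v u)) + 2 * (y \<bullet> ((C1_mat Q ** X + D12_mat R ** F)
        *v a))
    + 2 * (b \<bullet> ((Y ** A + H ** C) *v b)) + 2 * (b \<bullet> ((Y ** B1_mat W + H ** D21_mat V) *v u))
    + 2 * (y \<bullet> ((C1_mat Q + D12_mat R ** G ** C) *v b)) + 2 * (y \<bullet> ((D12_mat R ** G ** D21_mat V) *v u))
    - \<gamma> * (u \<bullet> u) - \<gamma> * (y \<bullet> y)"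
proof -
  define S1 where "S1 = A ** X + B ** F"
  define S2 where "S2 = Y ** A + H ** C"
  define M12 where "M12 = transpose M + A + B ** G ** C"
  define M13 where "M13 = B1_mat W + B ** G ** D21_mat V"
  define M23 where "M23 = Y ** B1_mat W + H ** D21_mat V"
  define N1 where "N1 = C1_mat Q ** X + D12_mat R ** F"
  define N2 where "N2 = C1_mat Q + D12_mat R ** G ** C"
  define N3 where "N3 = D12_mat R ** G ** D21_mat V"
  show ?thesis
    unfolding M_lmi_def Let_def blk_simps transpose_transpose
    unfolding S1_def[symmetric] S2_def[symmetric] M12_def[symmetric] M13_def[symmetric]
        M23_def[symmetric]
      N1_def[symmetric] N2_def[symmetric] N3_def[symmetric]
    by (simp add: hcat_vec vcat_vec inner_vjoin inner_add_right inner_diff_right inner_transpose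
        matrix_vector_mult_add_rdistrib mat_vector del: transpose_matrix_vector)
qed

lemma M_lmi_sym: "M_lmi A B C Q R W V \<gamma> \<Lambda> X Y \<in> sym_mats"
  unfolding sym_mats_def mem_Collect_eq M_lmi_def Let_def
  by (simp add: block_transpose hcat_of_vcats transpose_add add.commute vcat_eq_iff hcat_eq_iff)

text \<open>The congruence with \<open>diag(T, I, I)\<close>, stated for the quadratic forms.\<close>

lemma M_lmi_congruence:
  fixes A :: "real^'n^'n" and B :: "real^'m^'n" and C :: "real^'n^'p"
  assumes l: "linked P X X21 Y \<Xi>"
    and F: "F = blk11 K ** C ** X + blk12 K ** X21" and H: "H = Y ** B ** blk11 K + \<Xi> ** blk21 K"
    and M: "M = \<Xi> ** blk21 K ** C ** X + Y ** B ** blk12 K ** X21 + Y ** (A + B ** blk11 K ** C) **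
        X + \<Xi> ** blk22 K ** X21"
  shows "vjoin a (vjoin b (vjoin u y)) \<bullet> (M_lmi A B C Q R W V \<gamma> (blk11 K <|> F </> H <|> M) X Y *v
      vjoin a (vjoin b (vjoin u y))) =
    brl_form (A_cl A B C K) (B_cl B W V K) (C_cl C Q R K) (D_cl R V K) \<gamma> P ((X <|> mat 1 </> X21 <|>
        0) *v vjoin a b) u y"
proof -
  define x where "x = (X <|> mat 1 </> X21 <|> 0) *v vjoin a b"
  have x: "x = vjoin (X *v a + b) (X21 *v a)" by (simp add: x_def hcat_vec vcat_vec)
  have Px: "P *v x = vjoin (a + Y *v b) (transpose \<Xi> *v b)"
    unfolding x_def matrix_vector_mul_assoc linkedD(1)[OF l]
    by (simp add: hcat_vec vcat_vec del: transpose_matrix_vector)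
  have Psym: "P \<in> sym_mats" using l by (simp add: linked_def)
  then have xP: "x \<bullet> (P *v w) = vjoin (a + Y *v b) (transpose \<Xi> *v b) \<bullet> w" for w
    unfolding Px[symmetric] by (simp add: sym_mats_iff)
  have Yb: "(Y *v b) \<bullet> w = b \<bullet> (Y *v w)" for w using linkedD(3)[OF l] by (simp add: sym_mats_iff)
  have \<Xi>b: "(transpose \<Xi> *v b) \<bullet> w = b \<bullet> (\<Xi> *v w)" for w by (rule inner_matrix_vector[symmetric])
  have Ma: "a \<bullet> (transpose M *v b) = b \<bullet> (M *v a)" by (rule inner_transpose)
  obtain u1 u2 where u: "u = vjoin u1 u2" by (rule vjoin_cases)
  obtain y1 y2 where y: "y = vjoin y1 y2" by (rule vjoin_cases)
  show ?thesis
    unfolding M_lmi_quadratic_form brl_form_def x_def[symmetric] xP matrix_vector_mult_add_rdistrib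
        inner_add_right Ma
    unfolding x u y A_cl_def B_cl_def C_cl_def D_cl_def B1_mat_def C1_mat_def D12_mat_def
        D21_mat_def F H M
    by (simp add: hcat_vec vcat_vec inner_vjoin vjoin_add inner_add_left inner_add_right Yb \<Xi>b
        matrix_vector_right_distrib
        matrix_vector_mult_add_rdistrib algebra_simps del: transpose_matrix_vector flip:
            matrix_vector_mul_assoc)
qed

lemma M_lmi_iff:
  fixes A :: "real^'n^'n" and B :: "real^'m^'n" and C :: "real^'n^'p"
  assumes l: "linked P X X21 Y \<Xi>" and X: "X \<in> sym_mats"
    and F: "F = blk11 K ** C ** X + blk12 K ** X21" and H: "H = Y ** B ** blk11 K + \<Xi> ** blk21 K"
    and M: "M = \<Xi> ** blk21 K ** C ** X + Y ** B ** blk12 K ** X21 + Y ** (A + B ** blk11 K ** C) **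
        X + \<Xi> ** blk22 K ** X21"
  shows "neg_semidef (M_lmi A B C Q R W V \<gamma> (blk11 K <|> F </> H <|> M) X Y) \<longleftrightarrow> neg_semidef
      (brl_matrix A B C Q R W V K \<gamma> P)"
proof -
  let ?T = "(X <|> mat 1 </> X21 <|> 0)"
  let ?form = "brl_form (A_cl A B C K) (B_cl B W V K) (C_cl C Q R K) (D_cl R V K) \<gamma> P"
  note cong = M_lmi_congruence[OF l F H M]
  have Psym: "P \<in> sym_mats" using l by (simp add: linked_def)
  have T: "?T *v (matrix_inv ?T *v x) = x" for x
    by (simp add: matrix_vector_mul_assoc matrix_inv[OF linked_congruence(1)[OF l X]])
  show ?thesis unfolding brl_matrix_iff[OF Psym]
  proof
    assume a: "neg_semidef (M_lmi A B C Q R W V \<gamma> (blk11 K <|> F </> H <|> M) X Y)"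
    show "\<forall>x u y. ?form x u y \<le> 0"
    proof (intro allI)
      fix x u y
      obtain a b where "matrix_inv ?T *v x = vjoin a b" by (rule vjoin_cases)
      then have "?T *v vjoin a b = x" by (metis T)
      then show "?form x u y \<le> 0"
        using a cong[of a b u y Q R W V \<gamma>] unfolding neg_semidef_iff by metis
    qed
  next
    assume a: "\<forall>x u y. ?form x u y \<le> 0"
    have "v \<bullet> (M_lmi A B C Q R W V \<gamma> (blk11 K <|> F </> H <|> M) X Y *v v) \<le> 0" for v
    proof -
      obtain a w where v: "v = vjoin a w" by (rule vjoin_cases)
      obtain b t where w: "w = vjoin b t" by (rule vjoin_cases)
      obtain u y where t: "t = vjoin u y" by (rule vjoin_cases)
      show ?thesis unfolding v w t cong using a by blast
    qed
    then show "neg_semidef (M_lmi A B C Q R W V \<gamma> (blk11 K <|> F </> H <|> M) X Y)"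
      using M_lmi_sym unfolding neg_semidef_iff by blast
  qed
qed

text \<open>The domain and the range of the extension of \<open>\<Phi>\<close>: the matrix inequalities are dropped. Symmetry of \<open>P\<close>, \<open>X\<close>
  and \<open>Y\<close> is part of positive definiteness.\<close>

definition lifted_dom :: "('m::finite, 'n::finite, 'p::finite) lifted_point set"
  where "lifted_dom = {(K, \<gamma>, P). pos_def P \<and> invertible (blk12 P)}"

definition convex_dom :: "(('m::finite, 'n::finite, 'p::finite) convex_point \<times> (real^'n^'n)) set"
  where "convex_dom = {((\<gamma>, \<Lambda>, X, Y), \<Xi>). pos_def (X <|> mat 1 </> mat 1 <|> Y) \<and> invertible \<Xi>}"

text \<open>The multiplicative form of the substitution for the policy; the result differs from \<open>\<Lambda>\<close> only by the
  term \<open>Y A X\<close> in the last block.\<close>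

lemma policy_change:
  fixes B :: "real^'m^'n" and C :: "real^'n^'p"
  shows "(mat 1 <|> 0 </> Y ** B <|> \<Xi>) ** K ** (mat 1 <|> C ** X </> 0 <|> X21) =
    (blk11 K <|> blk11 K ** C ** X + blk12 K ** X21 </>
     Y ** B ** blk11 K + \<Xi> ** blk21 K <|>
     \<Xi> ** blk21 K ** C ** X + Y ** B ** blk12 K ** X21 + Y ** B ** blk11 K ** C ** X + \<Xi> ** blk22 K
         ** X21)"
  by (subst blk_collapse[of K, symmetric])
     (simp add: block_mult hcat_add vcat_eq_iff hcat_eq_iff matrix_mult_bilinear matrix_mul_assoc
         algebra_simps)

lemma block_triangular_invertible:
  fixes N :: "real^'n^'n" and L :: "real^'m^'n" and L' :: "real^'n^'m"
  assumes N: "invertible N"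
  shows "invertible (mat 1 <|> 0 </> L <|> N)" "invertible (mat 1 <|> L' </> 0 <|> N)"
proof -
  have "(mat 1 <|> 0 </> L <|> N) ** (mat 1 <|> 0 </> - (matrix_inv N ** L) <|> matrix_inv N) = mat 1"
    by (simp add: block_mult hcat_add matrix_mult_bilinear matrix_mul_assoc matrix_inv[OF N] mat_blocks)
  then show "invertible (mat 1 <|> 0 </> L <|> N)" using invertible_right_inverse by blast
  have "(mat 1 <|> L' </> 0 <|> N) ** (mat 1 <|> - (L' ** matrix_inv N) </> 0 <|> matrix_inv N) = mat 1"
    by (simp add: block_mult hcat_add matrix_mult_bilinear matrix_mul_assoc matrix_inv[OF N] mat_blocks)
  then show "invertible (mat 1 <|> L' </> 0 <|> N)" using invertible_right_inverse by blast
qed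

lemma mult_inv_cancel:
  fixes L :: "real^'a^'a" and N :: "real^'b^'b"
  assumes "invertible L" "invertible N"
  shows "matrix_inv L ** (L ** K ** N) ** matrix_inv N = K" "L ** (matrix_inv L ** K ** matrix_inv
      N) ** N = K"
proof -
  have "matrix_inv L ** (L ** K ** N) ** matrix_inv N = (matrix_inv L ** L) ** K ** (N ** matrix_inv N)"
    "L ** (matrix_inv L ** K ** matrix_inv N) ** N = (L ** matrix_inv L) ** K ** (matrix_inv N ** N)"
    by (simp_all add: matrix_mul_assoc)
  then show "matrix_inv L ** (L ** K ** N) ** matrix_inv N = K" "L ** (matrix_inv L ** K **
      matrix_inv N) ** N = K"
    using assms by (simp_all add: matrix_inv)
qed

lemma Phi_props:
  fixes A :: "real^'n^'n" and B :: "real^'m^'n" and C :: "real^'n^'p"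
  assumes z: "z \<in> lifted_dom"
  shows "Phi_inf_d A B C z \<in> convex_dom" "Psi_inf_d A B C (Phi_inf_d A B C z) = z"
    and "Phi_inf_d A B C z \<in> F_inf_d A B C Q R W V \<times> GL \<longleftrightarrow> z \<in> L_inf_d A B C Q R W V"
proof -
  obtain K \<gamma> P where zz: "z = (K, \<gamma>, P)" by (cases z)
  have P: "pos_def P" "invertible (blk12 P)" using z by (auto simp: zz lifted_dom_def)
  define X where "X = blk11 (matrix_inv P)"
  define X21 where "X21 = blk21 (matrix_inv P)"
  define Y where "Y = blk11 P"
  define \<Xi> where "\<Xi> = blk12 P"
  define F where "F = blk11 K ** C ** X + blk12 K ** X21"
  define H where "H = Y ** B ** blk11 K + \<Xi> ** blk21 K"
  define M where "M = \<Xi> ** blk21 K ** C ** X + Y ** B ** blk12 K ** X21 + Y ** (A + B ** blk11 K **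
      C) ** X + \<Xi> ** blk22 K ** X21"
  have Phi: "Phi_inf_d A B C z = ((\<gamma>, (blk11 K <|> F </> H <|> M), X, Y), \<Xi>)"
    by (simp add: zz Let_def F_def H_def M_def X_def X21_def Y_def \<Xi>_def)
  have l: "linked P X X21 Y \<Xi>" and X: "X \<in> sym_mats"
    using linked_inverse[OF P] by (simp_all add: X_def X21_def Y_def \<Xi>_def)
  have XY: "pos_def (X <|> mat 1 </> mat 1 <|> Y)" using linked_congruence(3)[OF l X] P(1) by simp
  have \<Xi>: "invertible \<Xi>" using P(2) by (simp add: \<Xi>_def)
  show "Phi_inf_d A B C z \<in> convex_dom" by (simp add: Phi convex_dom_def XY \<Xi>)
  have e: "X21 = - (matrix_inv \<Xi> ** (Y - matrix_inv X) ** X)"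
    "P = (Y <|> \<Xi> </> transpose \<Xi> <|> transpose \<Xi> ** matrix_inv (Y - matrix_inv X) ** \<Xi>)"
    using linked_explicit(3)[OF XY \<Xi> l] by auto
  have X21i: "invertible X21" unfolding e(1) by (rule linked_explicit(2)[OF XY \<Xi>])
  have MM: "M - Y ** A ** X = \<Xi> ** blk21 K ** C ** X + Y ** B ** blk12 K ** X21 + Y ** B ** blk11 K
      ** C ** X + \<Xi> ** blk22 K ** X21"
    by (simp add: M_def matrix_mult_bilinear matrix_mul_assoc)
  have "matrix_inv (mat 1 <|> 0 </> Y ** B <|> \<Xi>) ** (blk11 K <|> F </> H <|> M - Y ** A ** X) **
      matrix_inv (mat 1 <|> C ** X </> 0 <|> X21) = K"
    unfolding MM F_def H_def policy_change[symmetric]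
    by (rule mult_inv_cancel(1)) (intro block_triangular_invertible \<Xi> X21i)+
  then show "Psi_inf_d A B C (Phi_inf_d A B C z) = z"
    unfolding Phi Psi_inf_d.simps Let_def blk_simps e(1)[symmetric] e(2)[symmetric] by (simp add: zz)
  have "neg_semidef (M_lmi A B C Q R W V \<gamma> (blk11 K <|> F </> H <|> M) X Y) \<longleftrightarrow> neg_semidef
      (brl_matrix A B C Q R W V K \<gamma> P)"
    by (rule M_lmi_iff[OF l X F_def H_def M_def])
  then show "Phi_inf_d A B C z \<in> F_inf_d A B C Q R W V \<times> GL \<longleftrightarrow> z \<in> L_inf_d A B C Q R W V"
    unfolding Phi unfolding zz F_inf_d_def L_inf_d_def GL_def using P X XY \<Xi> linkedD(3)[OF l] by simp
qed

lemma Psi_props: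
  fixes A :: "real^'n^'n" and B :: "real^'m^'n" and C :: "real^'n^'p"
  assumes w: "w \<in> convex_dom"
  shows "Psi_inf_d A B C w \<in> lifted_dom" "Phi_inf_d A B C (Psi_inf_d A B C w) = w"
proof -
  obtain \<gamma> \<Lambda> X Y \<Xi> where ww: "w = ((\<gamma>, \<Lambda>, X, Y), \<Xi>)" by (metis prod.collapse)
  have XY: "pos_def (X <|> mat 1 </> mat 1 <|> Y)" and \<Xi>: "invertible \<Xi>" using w by (auto simp: ww
      convex_dom_def)
  define G where "G = blk11 \<Lambda>"
  define F where "F = blk12 \<Lambda>"
  define H where "H = blk21 \<Lambda>"
  define M where "M = blk22 \<Lambda>"
  define X21 where "X21 = - (matrix_inv \<Xi> ** (Y - matrix_inv X) ** X)"
  define P where "P = (Y <|> \<Xi> </> transpose \<Xi> <|> transpose \<Xi> ** matrix_inv (Y - matrix_inv X) ** \<Xi>)"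
  define K where "K = matrix_inv (mat 1 <|> 0 </> Y ** B <|> \<Xi>) ** (G <|> F </> H <|> M - Y ** A **
      X) ** matrix_inv (mat 1 <|> C ** X </> 0 <|> X21)"
  have Psi: "Psi_inf_d A B C w = (K, \<gamma>, P)"
    by (simp add: ww Let_def K_def P_def X21_def G_def F_def H_def M_def)
  have l: "linked P X X21 Y \<Xi>" and X21i: "invertible X21"
    using linked_explicit(1,2)[OF XY \<Xi>] by (simp_all add: P_def X21_def)
  have X: "X \<in> sym_mats" by (rule schur_pos_def(1)[OF XY])
  have P: "pos_def P" using linked_congruence(3)[OF l X] XY by simp
  have P12: "blk12 P = \<Xi>" "blk11 P = Y" by (simp_all add: P_def)
  show "Psi_inf_d A B C w \<in> lifted_dom" unfolding Psi lifted_dom_def using P \<Xi> P12 by simp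
  have "(mat 1 <|> 0 </> Y ** B <|> \<Xi>) ** K ** (mat 1 <|> C ** X </> 0 <|> X21) = (G <|> F </> H <|>
      M - Y ** A ** X)"
    unfolding K_def by (rule mult_inv_cancel(2)) (intro block_triangular_invertible \<Xi> X21i)+
  then have eqs: "blk11 K = G" "blk11 K ** C ** X + blk12 K ** X21 = F" "Y ** B ** blk11 K + \<Xi> **
      blk21 K = H"
    and MM: "\<Xi> ** blk21 K ** C ** X + Y ** B ** blk12 K ** X21 + Y ** B ** blk11 K ** C ** X + \<Xi> **
        blk22 K ** X21 = M - Y ** A ** X"
    unfolding policy_change vcat_eq_iff hcat_eq_iff by blast+
  have M: "\<Xi> ** blk21 K ** C ** X + Y ** B ** blk12 K ** X21 + Y ** (A + B ** blk11 K ** C) ** X + \<Xi>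
      ** blk22 K ** X21 = M"
    using MM by (simp add: matrix_mult_bilinear matrix_mul_assoc algebra_simps)
  note u = linked_unique[OF l pos_def_invertible[OF P]]
  show "Phi_inf_d A B C (Psi_inf_d A B C w) = w"
    unfolding Psi Phi_inf_d.simps Let_def u P12
    unfolding eqs(2,3) M
    unfolding eqs(1) ww G_def F_def H_def M_def blk_collapse ..
qed


section \<open>The diffeomorphism\<close>

lemma open_pos_form: "open {P :: real^'n^'n. \<forall>x. x \<noteq> 0 \<longrightarrow> 0 < x \<bullet> (P *v x)}"
  unfolding open_dist
proof (intro ballI, simp only: mem_Collect_eq)
  fix P :: "real^'n^'n"
  assume P: "\<forall>x. x \<noteq> 0 \<longrightarrow> 0 < x \<bullet> (P *v x)"
  obtain K where K: "0 < K" "\<And>(M :: real^'n^'n) (x :: real^'n). norm (M *v x) \<le> norm M * norm x * K"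
    using bounded_bilinear.pos_bounded[OF bounded_bilinear_matrix_vector_mult] by blast
  have "continuous_on (sphere 0 1) (\<lambda>x. x \<bullet> (P *v x))"
    by (intro continuous_intros bounded_linear.continuous_on[OF matrix_vector_mul_bounded_linear])
  moreover have "norm (axis undefined 1 :: real^'n) = 1" by simp
  then have "sphere 0 1 \<noteq> ({} :: (real^'n) set)" by (metis empty_iff mem_sphere_0)
  ultimately obtain x0 where x0: "norm x0 = 1" "\<And>x. norm x = 1 \<Longrightarrow> x0 \<bullet> (P *v x0) \<le> x \<bullet> (P *v x)"
    using continuous_attains_inf[OF compact_sphere, of 0 1 "\<lambda>x. x \<bullet> (P *v x)"] by auto
  define d where "d = x0 \<bullet> (P *v x0)"
  have "x0 \<noteq> 0" using x0(1) by auto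
  then have d: "0 < d" using P by (simp add: d_def)
  show "\<exists>e>0. \<forall>P'. dist P' P < e \<longrightarrow> (\<forall>x. x \<noteq> 0 \<longrightarrow> 0 < x \<bullet> (P' *v x))"
  proof (intro exI[of _ "d / K"] conjI allI impI)
    show "0 < d / K" using d K by simp
    fix P' and x :: "real^'n" assume P': "dist P' P < d / K" and "x \<noteq> 0"
    define w where "w = (1 / norm x) *\<^sub>R x"
    have w: "norm w = 1" "x = norm x *\<^sub>R w" using \<open>x \<noteq> 0\<close> by (simp_all add: w_def)
    have "norm (P' - P) * K < d" using P' K(1) by (simp add: dist_norm pos_less_divide_eq)
    moreover have "\<bar>w \<bullet> ((P' - P) *v w)\<bar> \<le> norm w * norm ((P' - P) *v w)" by (rule Cauchy_Schwarz_ineq2)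
    ultimately have "\<bar>w \<bullet> ((P' - P) *v w)\<bar> < d" using K(2)[of "P' - P" w] w(1) by simp
    then have "- d < w \<bullet> ((P' - P) *v w)" by (simp add: abs_less_iff)
    moreover have "d \<le> w \<bullet> (P *v w)" using x0(2)[OF w(1)] by (simp add: d_def)
    ultimately have "0 < w \<bullet> (P' *v w)" by (simp add: matrix_vector_bilinear inner_diff_right)
    moreover have "x \<bullet> (P' *v x) = (norm x)\<^sup>2 * (w \<bullet> (P' *v w))"
      by (subst (1 2) w(2)) (simp add: matrix_vector_mult_scaleR power2_eq_square)
    ultimately show "0 < x \<bullet> (P' *v x)" using \<open>x \<noteq> 0\<close> by simp
  qed
qed

lemma openin_lifted_dom:
  "openin (top_of_set lifted_space) (lifted_dom :: ('m::finite, 'n::finite, 'p::finite) lifted_point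
      set)"
proof -
  define O1 where "O1 = {P :: real^('n + 'n)^('n + 'n). \<forall>x. x \<noteq> 0 \<longrightarrow> 0 < x \<bullet> (P *v x)}"
  have "continuous_on UNIV (\<lambda>z :: ('m, 'n, 'p) lifted_point. snd (snd z))"
    "continuous_on UNIV (\<lambda>z :: ('m, 'n, 'p) lifted_point. blk12 (snd (snd z)))"
    unfolding Ck_on.simps(1)[where E = UNIV, symmetric] by (intro Ck_on_intros)+
  then have "open ((\<lambda>z :: ('m, 'n, 'p) lifted_point. snd (snd z)) -` O1 \<inter> (\<lambda>z. blk12 (snd (snd z)))
      -` {M. invertible M})"
    unfolding O1_def by (intro open_Int open_vimage open_pos_form invertible_open)
  moreover have "(lifted_dom :: ('m, 'n, 'p) lifted_point set) =
      lifted_space \<inter> ((\<lambda>z. snd (snd z)) -` O1 \<inter> (\<lambda>z. blk12 (snd (snd z))) -` {M. invertible M})"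
    by (auto simp: lifted_dom_def lifted_space_def O1_def pos_def_def)
  ultimately show ?thesis unfolding openin_open by blast
qed

lemma openin_convex_dom:
  "openin (top_of_set convex_space)
    (convex_dom :: (('m::finite, 'n::finite, 'p::finite) convex_point \<times> (real^'n^'n)) set)"
proof -
  define O1 where "O1 = {P :: real^('n + 'n)^('n + 'n). \<forall>x. x \<noteq> 0 \<longrightarrow> 0 < x \<bullet> (P *v x)}"
  let ?f = "\<lambda>z :: ('m, 'n, 'p) convex_point \<times> (real^'n^'n).
      (fst (snd (snd (fst z))) <|> mat 1 </> mat 1 <|> snd (snd (snd (fst z))))"
  have "continuous_on UNIV ?f"
    "continuous_on UNIV (\<lambda>z :: ('m, 'n, 'p) convex_point \<times> (real^'n^'n). snd z)"
    unfolding Ck_on.simps(1)[where E = UNIV, symmetric] by (intro Ck_on_intros)+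
  then have "open (?f -` O1 \<inter> (\<lambda>z. snd z) -` {M. invertible M})"
    unfolding O1_def by (intro open_Int open_vimage open_pos_form invertible_open)
  moreover have "(convex_dom :: (('m, 'n, 'p) convex_point \<times> (real^'n^'n)) set) =
      convex_space \<inter> (?f -` O1 \<inter> (\<lambda>z. snd z) -` {M. invertible M})"
    by (auto simp: convex_dom_def convex_space_def O1_def pos_def_def sym_blocks_iff)
  ultimately show ?thesis unfolding openin_open by blast
qed

lemma subspace_sym_mats: "subspace (sym_mats :: (real^'n^'n) set)"
  by (rule subspaceI) (auto simp: sym_mats_def transpose_0 transpose_add transpose_scalar)

lemma subspace_lifted_space: "subspace lifted_space"
  unfolding lifted_space_def by (intro subspace_Times subspace_UNIV subspace_sym_mats)

lemma subspace_convex_space: "subspace convex_space"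
  unfolding convex_space_def by (intro subspace_Times subspace_UNIV subspace_sym_mats)

lemma Phi_diffeomorphism:
  fixes A :: "real^'n^'n" and B :: "real^'m^'n" and C :: "real^'n^'p"
  shows "diffeomorphism k lifted_space (L_inf_d A B C Q R W V) convex_space (F_inf_d A B C Q R W V \<times>
      GL) (Phi_inf_d A B C)"
    and "\<And>w. w \<in> F_inf_d A B C Q R W V \<times> GL \<Longrightarrow> inv_into (L_inf_d A B C Q R W V) (Phi_inf_d A B C) w =
        Psi_inf_d A B C w"
proof -
  let ?L = "L_inf_d A B C Q R W V" and ?F = "F_inf_d A B C Q R W V \<times> GL"
  let ?\<Phi> = "Phi_inf_d A B C" and ?\<Psi> = "Psi_inf_d A B C"
  have L: "?L \<subseteq> lifted_dom" by (auto simp: L_inf_d_def lifted_dom_def GL_def)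
  have F: "?F \<subseteq> convex_dom" by (auto simp: F_inf_d_def convex_dom_def GL_def)
  have \<Psi>L: "?\<Psi> w \<in> ?L" if "w \<in> ?F" for w
  proof -
    have w: "w \<in> convex_dom" using F that by blast
    have "?\<Phi> (?\<Psi> w) \<in> ?F" using that by (simp only: Psi_props(2)[OF w])
    then show ?thesis by (rule iffD1[OF Phi_props(3)[OF Psi_props(1)[OF w]]])
  qed
  have \<Phi>F: "?\<Phi> z \<in> ?F" if "z \<in> ?L" for z
    by (rule iffD2[OF Phi_props(3)]) (use L that in auto)
  have \<Psi>\<Phi>: "\<forall>z\<in>lifted_dom. ?\<Psi> (?\<Phi> z) = z" and \<Phi>\<Psi>: "\<forall>w\<in>convex_dom. ?\<Phi> (?\<Psi> w) = w"
    by (intro ballI Phi_props(2) Psi_props(2); assumption)+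
  have bij: "bij_betw ?\<Phi> ?L ?F"
  proof (rule bij_betw_byWitness[where f' = ?\<Psi>])
    show "\<forall>z\<in>?L. ?\<Psi> (?\<Phi> z) = z" using \<Psi>\<Phi> L by blast
    show "\<forall>w\<in>?F. ?\<Phi> (?\<Psi> w) = w" using \<Phi>\<Psi> F by blast
    show "?\<Phi> ` ?L \<subseteq> ?F" using \<Phi>F by blast
    show "?\<Psi> ` ?F \<subseteq> ?L" using \<Psi>L by blast
  qed
  show "inv_into ?L ?\<Phi> w = ?\<Psi> w" if "w \<in> ?F" for w
  proof (rule inv_into_f_eq)
    show "inj_on ?\<Phi> ?L" using bij by (rule bij_betw_imp_inj_on)
    show "?\<Psi> w \<in> ?L" by (rule \<Psi>L[OF that])
    show "?\<Phi> (?\<Psi> w) = w" using \<Phi>\<Psi> F that by blast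
  qed
  have "smooth_on k lifted_space lifted_dom ?\<Phi>"
    unfolding smooth_on_def by (auto intro!: Ck_on_Phi pos_def_invertible simp: lifted_dom_def)
  moreover have "smooth_on k convex_space convex_dom ?\<Psi>"
    unfolding smooth_on_def
  proof (intro allI impI Ck_on_Psi)
    fix \<gamma> :: real and \<Lambda> :: "('m, 'n, 'p) policy" and X Y \<Xi> :: "real^'n^'n"
    assume "((\<gamma>, \<Lambda>, X, Y), \<Xi>) \<in> convex_dom"
    then have XY: "pos_def (X <|> mat 1 </> mat 1 <|> Y)" and \<Xi>: "invertible \<Xi>" by (auto simp:
        convex_dom_def)
    note s = schur_pos_def[OF XY]
    show "invertible X \<and> invertible \<Xi> \<and> invertible (Y - matrix_inv X) \<and>
        invertible (mat 1 <|> 0 </> Y ** B <|> \<Xi>) \<and>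
        invertible (mat 1 <|> C ** X </> 0 <|> - (matrix_inv \<Xi> ** (Y - matrix_inv X) ** X))"
      by (intro conjI block_triangular_invertible linked_explicit(2)[OF XY \<Xi>] \<Xi> pos_def_invertible
          s(3,4))
  qed
  moreover have "bij_betw ?\<Phi> lifted_dom convex_dom"
    by (rule bij_betw_byWitness[where f' = ?\<Psi>, OF \<Psi>\<Phi> \<Phi>\<Psi>])
       (auto simp only: image_subset_iff intro!: Phi_props(1) Psi_props(1))
  moreover have "?F \<subseteq> convex_space"
    by (auto simp: F_inf_d_def convex_space_def)
  ultimately show "diffeomorphism k lifted_space ?L convex_space ?F ?\<Phi>"
    unfolding diffeomorphism_def using L bij \<Psi>\<Phi>
    by (intro conjI subspace_lifted_space subspace_convex_space exI[of _ lifted_dom] exI[of _ convex_dom]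
        exI[of _ ?\<Phi>] exI[of _ ?\<Psi>] openin_lifted_dom openin_convex_dom) simp_all
qed

theorem proposition4p5:
  fixes A :: "real^'n^'n" and B :: "real^'m^'n" and C :: "real^'n^'p"
    and Q W :: "real^'n^'n" and R :: "real^'m^'m" and V :: "real^'p^'p"
  assumes "pos_semidef Q" and "pos_def R" and "pos_semidef W" and "pos_def V"
    and "controllable A (msqrt W)" and "controllable A B"
    and "observable (msqrt Q) A" and "observable C A"
  defines "J \<equiv> J_inf A B C Q R W V"
    and "L \<equiv> L_inf_d A B C Q R W V"
    and "\<F> \<equiv> F_inf_d A B C Q R W V"
    and "\<Phi> \<equiv> Phi_inf_d A B C"
    and "\<Psi> \<equiv> Psi_inf_d A B C"
  shows "epi_gt (stabilizing A B C) J \<subseteq> (\<lambda>(K, \<gamma>, P). (K, \<gamma>)) ` L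
    \<and> (\<lambda>(K, \<gamma>, P). (K, \<gamma>)) ` L \<subseteq> closure (epi_ge (stabilizing A B C) J)
    \<and> diffeomorphism 2 lifted_space L convex_space (\<F> \<times> GL) \<Phi>
    \<and> diffeomorphism \<infinity> lifted_space L convex_space (\<F> \<times> GL) \<Phi>
    \<and> (\<forall>z\<in>\<F> \<times> GL. inv_into L \<Phi> z = \<Psi> z)"
proof (intro conjI)
  show "epi_gt (stabilizing A B C) J \<subseteq> (\<lambda>(K, \<gamma>, P). (K, \<gamma>)) ` L"
  proof
    fix z assume z: "z \<in> epi_gt (stabilizing A B C) J"
    obtain K \<gamma> where zz: "z = (K, \<gamma>)" by (cases z)
    obtain P where "(K, \<gamma>, P) \<in> L"
      using epi_subset_projection[of K \<gamma> A B C Q R W V] z unfolding zz J_def L_def by blast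
    then show "z \<in> (\<lambda>(K, \<gamma>, P). (K, \<gamma>)) ` L" unfolding zz by force
  qed
  have "(\<lambda>(K, \<gamma>, P). (K, \<gamma>)) ` L \<subseteq> epi_ge (stabilizing A B C) J"
    unfolding L_def J_def using projection_subset_epi[OF assms(2,4,5,7)] by auto
  then show "(\<lambda>(K, \<gamma>, P). (K, \<gamma>)) ` L \<subseteq> closure (epi_ge (stabilizing A B C) J)"
    using closure_subset by blast
qed (unfold L_def \<F>_def \<Phi>_def \<Psi>_def, auto intro!: Phi_diffeomorphism)

end
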